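(* Let $\mathcal L$ be a chain quiver with vertices $1,\dots,t$ and, for each $i=1,\dots,t-1$, exactly one arrow $\alpha_i$ joining $i$ and $i+1$ (each arrow having an arbitrary but fixed direction). Let $\mathbb A=(A_1,\dots,A_{t-1})$ be a complex matrix representation of $\mathcal L$, and let $\mathbb L(\mathbb A)$ be the direct sum of representations $\mathbb L_{ij}$ produced from $\mathbb A$ by the algorithm for chains (which uses only unitary transformations; see the context). Then $\mathbb L(\mathbb A)$ is the canonical form of $\mathbb A$; that is, $\mathbb A\simeq\mathbb L(\mathbb A)$, where $\mathbb L(\mathbb A)$ is the direct sum of representations of the form $\mathbb L_{ij}$, $1\le i\le j\le t$, determined by $\mathbb A$ uniquely up to permutation of summands.
   Context: All matrices are over $\mathbb C$. Matrices of sizes $n\times 0$ and $0\times n$ are allowed: for each $n\ge 0$ there is exactly one matrix $0_{n0}$ of size $n\times 0$ and exactly one matrix $0_{0n}$ of size $0\times n$. The direct sum of matrices is block-diagonal. Matrix representations. A matrix representation $\mathbb A$ of dimension $\{d_v\}$ of a quiver assigns to each arrow $\alpha:u\to v$ a matrix $A_\alpha\in\mathbb C^{d_v\times d_u}$ (viewed as a linear map $\mathbb C^{d_u}\to\mathbb C^{d_v}$). Two matrix representations $\mathbb A,\mathbb A'$ are isomorphic, $\mathbb A\simeq\mathbb A'$, if there are nonsingular matrices $S_v$ (one for each vertex) with $A'_\alpha S_u=S_vA_\alpha$ for every arrow $\alpha:u\to v$. Direct sums are taken arrow by arrow. A transformation at vertex $v$ is a change of basis at $v$ only: for a nonsingular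 $S$ it replaces $A_\alpha$ by $SA_\alpha$ for arrows $\alpha$ ending at $v$ and by $A_\alpha S^{-1}$ for arrows starting at $v$; it is unitary if $S$ is unitary. For the chain $\mathcal L$ write $A_i$ for the matrix assigned to $\alpha_i$. For $1\le i\le j\le t$, $\mathbb L_{ij}$ is the matrix representation of $\mathcal L$ having dimension $1$ at the vertices $i,i+1,\dots,j$ and $0$ at the other vertices, with matrix $I_1$ assigned to $\alpha_i,\dots,\alpha_{j-1}$ and zero (empty) matrices assigned to the other arrows. By a theorem of Gabriel, every matrix representation of $\mathcal L$ is isomorphic to a direct sum of representations $\mathbb L_{ij}$, uniquely determined up to permutation of summands; this sum is the canonical form. Algorithm for chains. Let $(d_1,\dots,d_t)$ be the dimension of $\mathbb A$. After step $r$ one has a multiset $\mathcal P_r$ of representations $\mathbb L_{ij}$ with $j\le r$, an ordered list of pairs (fragment start, multiplicity), and (if $r+1<t$) a current matrix $A'_{r+1}$ for the arrow $\alpha_{r+1}$. Start with $\mathcal P_0=\emptyset$, the list $((1,d_1))$ and $A_1'=A_1$. Step $r$ ($r=1,\dots,t-1$). Suppose the list is $((p_1,k_1),\dots,(p_r,k_r))$, where $\{p_1,\dots,p_r\}=\{1,\dots,r\}$, $k_i\ge0$, $k_1+\dots+k_r=d_r$; the basis of the space at vertex $r$ is divided into consecutive groups of sizes $k_1,\dots,k_r$, the $i$th group standing for $k_i$ copies of a fragment $p_i - (p_i+1)-\cdots- r$ with all matrices $I_1$. Case $\alpha_r:r\to r+1$. Divide the $d_{r+1}\times d_r$ matrix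 $A_r'$ into $r$ vertical strips of $k_1,\dots,k_r$ columns. Starting from the first strip, by unitary column transformations within the vertical strips and by unitary row transformations, reduce $A'_r$ to a matrix $B_r$ whose rows are divided into $r+1$ horizontal strips of $l_1,\dots,l_r,\ d_{r+1}-l_1-\dots-l_r$ rows, such that for each $i$ the block of $B_r$ in horizontal strip $i$ and vertical strip $i$ is $[\,0\ \ H_i\,]$ with $H_i$ a nonsingular $l_i\times l_i$ matrix, all blocks of vertical strip $i$ in horizontal strips below the $i$th are zero, and the blocks above the $i$th horizontal strip are arbitrary. The new list is $((p_1,l_1),\dots,(p_r,l_r),(r+1,\ d_{r+1}-l_1-\dots-l_r))$. Case $\alpha_r:r\leftarrow r+1$. Divide the $d_r\times d_{r+1}$ matrix $A_r'$ into $r$ horizontal strips of $k_1,\dots,k_r$ rows. Starting from the lowest strip, by unitary row transformations within the horizontal strips and by unitary column transformations, reduce $A_r'$ to a matrix $B_r$ whose columns are divided into $r+1$ vertical strips of $d_{r+1}-l_1-\dots-l_r,\ l_1,\dots,l_r$ columns (numbered $0,1,\dots,r$), such that for each $i$ the block of $B_r$ in horizontal strip $i$ and vertical strip $i$ is $\begin{bmatrix}H_i\\0\end{bmatrix}$ with $H_i$ a nonsingular $l_i\times l_i$ matrix, all blocks of horizontal strip $i$ in vertical strips with number less than $i$ are zero, and the blocks in vertical strips with number greater than $i$ are arbitrary. The new list is $((r+1,\ d_{r+1}-l_1-\dots-l_r),(p_1,l_1),\dots,(p_r,l_r))$. In both cases $\mathcal P_r$ is obtained from $\mathcal P_{r-1}$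 by adding $k_i-l_i$ copies of $\mathbb L_{p_ir}$ for each $i=1,\dots,r$. The unitary row (respectively column) transformations not restricted to strips are transformations at vertex $r+1$; they also change $A_{r+1}$ (if $r+1<t$), and the new matrix is $A_{r+1}'$. Result. After step $t-1$ the list is $((q_1,m_1),\dots,(q_t,m_t))$; then $\mathbb L(\mathbb A)$ is the direct sum of all members of $\mathcal P_{t-1}$ (with multiplicity) and of $m_i$ copies of $\mathbb L_{q_it}$ for $i=1,\dots,t$. *)

theory Defs
  imports
    "HOL-Library.Multiset"
    "Graph_Theory.Digraph"
    "Jordan_Normal_Form.Schur_Decomposition"
begin

section \<open>Matrix representations of quivers\<close>

text \<open>
  A quiver is a \<^typ>\<open>('v, 'a) pre_digraph\<close> (loops and parallel arrows are allowed). The matrix of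
  an arrow from \<open>u\<close> to \<open>v\<close> has \<open>vdim v\<close> rows and \<open>vdim u\<close> columns; the values of \<open>vdim\<close> and \<open>amat\<close>
  outside \<open>verts\<close> and \<open>arcs\<close> are irrelevant. Matrices with no rows or no columns are genuine
  elements of \<^const>\<open>carrier_mat\<close>, one for each size.
\<close>

record ('v, 'a) quiver_rep =
  vdim :: "'v \<Rightarrow> nat"
  amat :: "'a \<Rightarrow> complex mat"

definition mat_rep :: "('v, 'a) pre_digraph \<Rightarrow> ('v, 'a) quiver_rep \<Rightarrow> bool" where
  "mat_rep Q R \<longleftrightarrow>
     (\<forall>a \<in> arcs Q. amat R a \<in> carrier_mat (vdim R (head Q a)) (vdim R (tail Q a)))"

text \<open>\<^const>\<open>invertible_mat\<close> includes squareness, so isomorphic representations have equal dimensions.\<close>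

definition rep_iso ::
  "('v, 'a) pre_digraph \<Rightarrow> ('v, 'a) quiver_rep \<Rightarrow> ('v, 'a) quiver_rep \<Rightarrow> bool" where
  "rep_iso Q R R' \<longleftrightarrow>
     (\<exists>S. (\<forall>v \<in> verts Q. S v \<in> carrier_mat (vdim R' v) (vdim R v) \<and> invertible_mat (S v)) \<and>
          (\<forall>a \<in> arcs Q. amat R' a * S (tail Q a) = S (head Q a) * amat R a))"

definition direct_sum :: "('v, 'a) quiver_rep list \<Rightarrow> ('v, 'a) quiver_rep" where
  "direct_sum Rs =
     \<lparr> vdim = (\<lambda>v. \<Sum>R\<leftarrow>Rs. vdim R v),
       amat = (\<lambda>a. diag_block_mat (map (\<lambda>R. amat R a) Rs)) \<rparr>"

text \<open>The transformation with the nonsingular matrix \<open>S\<close> at the vertex \<open>v\<close>.\<close>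

definition vertex_transform ::
  "('v, 'a) pre_digraph \<Rightarrow> 'v \<Rightarrow> complex mat \<Rightarrow> ('v, 'a) quiver_rep \<Rightarrow> ('v, 'a) quiver_rep" where
  "vertex_transform Q v S R =
     R \<lparr> amat := (\<lambda>a.
          let B = (if head Q a = v then S * amat R a else amat R a)
          in if tail Q a = v then B * the (mat_inverse S) else B) \<rparr>"

definition unitary_mat :: "nat \<Rightarrow> complex mat \<Rightarrow> bool" where
  "unitary_mat n U \<longleftrightarrow>
     U \<in> carrier_mat n n \<and> U * mat_adjoint U = 1\<^sub>m n \<and> mat_adjoint U * U = 1\<^sub>m n"


section \<open>Chains\<close>

text \<open>
  The arrow number \<open>i\<close> joins \<open>i\<close> and \<open>i + 1\<close>; it points from \<open>i\<close> to \<open>i + 1\<close> iff \<open>right i\<close>.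
\<close>

definition chain :: "nat \<Rightarrow> (nat \<Rightarrow> bool) \<Rightarrow> (nat, nat) pre_digraph" where
  "chain t right =
     \<lparr> verts = {1..t}, arcs = {1..<t},
       tail = (\<lambda>i. if right i then i else i + 1),
       head = (\<lambda>i. if right i then i + 1 else i) \<rparr>"

text \<open>The representation $L_{ij}$, given by the pair of its endpoints.\<close>

definition interval_rep ::
  "nat \<Rightarrow> (nat \<Rightarrow> bool) \<Rightarrow> nat \<times> nat \<Rightarrow> (nat, nat) quiver_rep" where
  "interval_rep t right = (\<lambda>(i, j).
     let d = (\<lambda>v. if i \<le> v \<and> v \<le> j then 1 else 0)
     in \<lparr> vdim = d,
          amat = (\<lambda>a. if i \<le> a \<and> a < j then 1\<^sub>m 1
                      else 0\<^sub>m (d (head (chain t right) a)) (d (tail (chain t right) a))) \<rparr>)"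

definition interval_index :: "nat \<Rightarrow> (nat \<times> nat) set" where
  "interval_index t = {(i, j). 1 \<le> i \<and> i \<le> j \<and> j \<le> t}"

definition interval_sum ::
  "nat \<Rightarrow> (nat \<Rightarrow> bool) \<Rightarrow> (nat \<times> nat) list \<Rightarrow> (nat, nat) quiver_rep" where
  "interval_sum t right xs = direct_sum (map (interval_rep t right) xs)"


section \<open>The algorithm for chains\<close>

text \<open>
  Strips are numbered from 0 here. For a matrix \<open>B\<close> divided into horizontal strips of sizes \<open>rs\<close> and
  vertical strips of sizes \<open>cs\<close>, \<open>strip_block rs cs B i j\<close> is the block in horizontal strip \<open>i\<close> and
  vertical strip \<open>j\<close>.
\<close>

definition strip_block ::
  "nat list \<Rightarrow> nat list \<Rightarrow> complex mat \<Rightarrow> nat \<Rightarrow> nat \<Rightarrow> complex mat" where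
  "strip_block rs cs B i j =
     mat (rs ! i) (cs ! j) (\<lambda>(a, b). B $$ (sum_list (take i rs) + a, sum_list (take j cs) + b))"

definition append_cols :: "complex mat \<Rightarrow> complex mat \<Rightarrow> complex mat" where
  "append_cols A B = four_block_mat A B (0\<^sub>m 0 (dim_col A)) (0\<^sub>m 0 (dim_col B))"

text \<open>
  In the next two definitions \<open>d'\<close> is the dimension at the vertex \<open>r + 1\<close>, \<open>ks\<close> the list
  $k_1,\dots,k_r$ and \<open>ls\<close> the list $l_1,\dots,l_r$.
\<close>

definition reduced_right :: "nat \<Rightarrow> nat list \<Rightarrow> nat list \<Rightarrow> complex mat \<Rightarrow> bool" where
  "reduced_right d' ks ls B \<longleftrightarrow>
     length ls = length ks \<and> sum_list ls \<le> d' \<and>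
     (let rs = ls @ [d' - sum_list ls]; blk = strip_block rs ks B in
      \<forall>i < length ks.
        ls ! i \<le> ks ! i \<and>
        (\<exists>H \<in> carrier_mat (ls ! i) (ls ! i). invertible_mat H \<and>
           blk i i = append_cols (0\<^sub>m (ls ! i) (ks ! i - ls ! i)) H) \<and>
        (\<forall>i'. i < i' \<and> i' \<le> length ks \<longrightarrow> blk i' i = 0\<^sub>m (rs ! i') (ks ! i)))"

text \<open>
  For an arrow pointing to the left, the additional vertical strip of width $d' - l_1 - \dots - l_r$
  comes first, so the vertical strip that belongs to the horizontal strip \<open>i\<close> has number \<open>Suc i\<close>.
\<close>

definition reduced_left :: "nat \<Rightarrow> nat list \<Rightarrow> nat list \<Rightarrow> complex mat \<Rightarrow> bool" where
  "reduced_left d' ks ls B \<longleftrightarrow>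
     length ls = length ks \<and> sum_list ls \<le> d' \<and>
     (let cs = (d' - sum_list ls) # ls; blk = strip_block ks cs B in
      \<forall>i < length ks.
        ls ! i \<le> ks ! i \<and>
        (\<exists>H \<in> carrier_mat (ls ! i) (ls ! i). invertible_mat H \<and>
           blk i (Suc i) = H @\<^sub>r 0\<^sub>m (ks ! i - ls ! i) (ls ! i)) \<and>
        (\<forall>j \<le> i. blk i j = 0\<^sub>m (ks ! i) (cs ! j)))"

text \<open>
  The summands split off in step \<open>r\<close>: $k_i - l_i$ copies of $L_{p_i r}$ for each \<open>i\<close>, where \<open>L\<close> is
  the list of the pairs $(p_i, k_i)$.
\<close>

definition split_off :: "nat \<Rightarrow> (nat \<times> nat) list \<Rightarrow> nat list \<Rightarrow> (nat \<times> nat) multiset" where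
  "split_off r L ls = (\<Sum>i<length L. replicate_mset (snd (L ! i) - ls ! i) (fst (L ! i), r))"

text \<open>
  \<open>chain_run t right A r P L R\<close>: a run of the algorithm on \<open>A\<close> can arrive after step \<open>r\<close> at the
  multiset \<open>P\<close> (of endpoint pairs), the list \<open>L\<close> and the representation \<open>R\<close>, which is \<open>A\<close> after the
  transformations made so far at the vertices \<open>2, \<dots>, r + 1\<close>. Only the matrix of the arrow \<open>r + 1\<close>
  in \<open>R\<close> is used afterwards; it is the current matrix $A'_{r+1}$. The algorithm leaves
  the choice of the unitary matrices open, hence a relation: \<open>S\<close> is the transformation at the vertex
  \<open>r + 1\<close>, and the block-diagonal matrix built from \<open>Vs\<close> acts within the strips.
\<close>

inductive chain_run ::
  "nat \<Rightarrow> (nat \<Rightarrow> bool) \<Rightarrow> (nat, nat) quiver_rep \<Rightarrow> nat \<Rightarrow>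
   (nat \<times> nat) multiset \<Rightarrow> (nat \<times> nat) list \<Rightarrow> (nat, nat) quiver_rep \<Rightarrow> bool"
  for t :: nat and right :: "nat \<Rightarrow> bool" and A :: "(nat, nat) quiver_rep"
where
  start: "chain_run t right A 0 {#} [(1, vdim A 1)] A"
| step_right:
    "\<lbrakk> chain_run t right A (r - 1) P L R; 1 \<le> r; r < t; right r;
       d' = vdim A (r + 1); ks = map snd L;
       unitary_mat d' S; R' = vertex_transform (chain t right) (r + 1) S R;
       list_all2 unitary_mat ks Vs; reduced_right d' ks ls (amat R' r * diag_block_mat Vs) \<rbrakk>
     \<Longrightarrow> chain_run t right A r (P + split_off r L ls)
           (zip (map fst L) ls @ [(r + 1, d' - sum_list ls)]) R'"
| step_left:
    "\<lbrakk> chain_run t right A (r - 1) P L R; 1 \<le> r; r < t; \<not> right r;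
       d' = vdim A (r + 1); ks = map snd L;
       unitary_mat d' S; R' = vertex_transform (chain t right) (r + 1) S R;
       list_all2 unitary_mat ks Vs; reduced_left d' ks ls (diag_block_mat Vs * amat R' r) \<rbrakk>
     \<Longrightarrow> chain_run t right A r (P + split_off r L ls)
           ((r + 1, d' - sum_list ls) # zip (map fst L) ls) R'"

text \<open>
  \<open>chain_result t right A M\<close>: some run of the algorithm on \<open>A\<close> produces the direct sum of the
  $L_{ij}$ for \<open>(i, j)\<close> in the multiset \<open>M\<close>.
\<close>

definition chain_result ::
  "nat \<Rightarrow> (nat \<Rightarrow> bool) \<Rightarrow> (nat, nat) quiver_rep \<Rightarrow> (nat \<times> nat) multiset \<Rightarrow> bool" where
  "chain_result t right A M \<longleftrightarrow>
     (\<exists>P L R. chain_run t right A (t - 1) P L R \<and>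
        M = P + (\<Sum>i<length L. replicate_mset (snd (L ! i)) (fst (L ! i), t)))"

end

theory Submission
  imports Defs
begin

text \<open>
  Decomposing a representation of a chain into intervals amounts to choosing, at every vertex, a
  labelled basis such that each arrow sends a basis vector to the basis vector that continues the
  same interval, or to \<open>0\<close> if the interval ends there. This is \<open>interval_basis\<close>; the lemmas
  \<open>rep_iso_if_interval_basis\<close> and \<open>interval_basis_if_rep_iso\<close> say that it is the same as an
  isomorphism with \<open>interval_sum\<close>.

  A run of the algorithm only changes coordinates, so the representation that it carries along stays
  isomorphic to \<open>A\<close>. What has to be understood is why the block form reached in a step determines
  the summands, although the blocks above the diagonal are arbitrary. The reason is that the order
  of the list of fragments is chosen so that a later fragment may be modified by earlier ones: the
  spans of the first \<open>i\<close> groups of basis vectors at the last vertex form a flag, and every basis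
  adapted to this flag, not just one of them, extends to a decomposition of the part of the
  chain treated so far. This stronger statement is \<open>extends_flags\<close>, and it is inductive.
  Given an adapted basis at the next vertex, an adapted basis at the current vertex has to be found
  that the arrow matches with it. If the arrow points to the right, the reduced matrix maps each
  step of the flag onto the corresponding step of the new flag because the \<open>H\<^sub>i\<close> are nonsingular;
  so the prescribed vectors have preimages of the right level, and the basis vectors of the
  columns left of \<open>H\<^sub>i\<close> can be moved into the kernel by vectors of lower level
  (\<open>reduced_right_lift_basis\<close>). If the arrow points to the left, the prescribed vectors of the
  additional strip are mapped to \<open>0\<close> and the others to independent vectors, which standard basis
  vectors complete to an adapted basis
  (\<open>reduced_left_lift_basis\<close>).

  Uniqueness is the Krull-Schmidt argument for intervals. Let \<open>c\<close> and \<open>c'\<close> be the two base change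
  matrices between two interval bases. Their entries at basis vectors with labels \<open>x\<close> and \<open>y\<close>
  describe homomorphisms between the two interval representations, and for \<open>x \<noteq> y\<close> such
  homomorphisms compose to \<open>0\<close> (\<open>coef_product_vanishes\<close>). Hence the blocks of \<open>c\<close> and \<open>c'\<close> that
  belong to one label are inverse to each other, and comparing the traces of the two products shows
  that both bases contain this label equally often (\<open>interval_basis_unique\<close>).

  That runs exist follows from the decomposition of a matrix by unitary transformations on both
  sides into a nonsingular corner and zeros (\<open>unitary_rank_decomposition\<close>), applied to one strip
  after the other.
\<close>

section \<open>Invertible and unitary matrices\<close>

lemma mult_mat_entry:
  fixes A B :: "complex mat"
  assumes "A \<in> carrier_mat n m" "B \<in> carrier_mat m p" "i < n" "j < p"
  shows "(A * B) $$ (i, j) = (\<Sum>k<m. A $$ (i, k) * B $$ (k, j))"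
  using assms by (simp add: scalar_prod_def atLeast0LessThan)

lemma mult_vec_entry:
  fixes A :: "complex mat"
  assumes "A \<in> carrier_mat n m" "x \<in> carrier_vec m" "i < n"
  shows "(A *\<^sub>v x) $ i = (\<Sum>k<m. A $$ (i, k) * x $ k)"
  using assms by (simp add: scalar_prod_def atLeast0LessThan)

definition inverse_pair :: "nat \<Rightarrow> complex mat \<Rightarrow> complex mat \<Rightarrow> bool" where
  "inverse_pair n E F \<longleftrightarrow>
     E \<in> carrier_mat n n \<and> F \<in> carrier_mat n n \<and> E * F = 1\<^sub>m n \<and> F * E = 1\<^sub>m n"

lemma inverse_pair_sym: "inverse_pair n E F \<Longrightarrow> inverse_pair n F E"
  by (auto simp: inverse_pair_def)

lemma inverse_pair_one: "inverse_pair n (1\<^sub>m n) (1\<^sub>m n)"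
  by (auto simp: inverse_pair_def)

text \<open>
  A one-sided inverse of a square matrix over a field is two-sided.
\<close>

lemma inverse_pairI:
  assumes "E \<in> carrier_mat n n" "F \<in> carrier_mat n n" "E * F = 1\<^sub>m n"
  shows "inverse_pair n E F"
  using assms mat_mult_left_right_inverse[OF assms] by (simp add: inverse_pair_def)

lemma inverse_pair_mult:
  assumes "inverse_pair n E F" "inverse_pair n E' F'"
  shows "inverse_pair n (E * E') (F' * F)"
proof -
  have c: "E \<in> carrier_mat n n" "F \<in> carrier_mat n n" "E' \<in> carrier_mat n n" "F' \<in> carrier_mat n n"
    using assms by (auto simp: inverse_pair_def)
  have "E * E' * (F' * F) = E * ((E' * F') * F)"
    using c by (simp add: assoc_mult_mat[of _ n n _ n _ n])
  also have "\<dots> = 1\<^sub>m n" using assms c by (simp add: inverse_pair_def)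
  finally show ?thesis using inverse_pairI[of "E * E'" n "F' * F"] c by simp
qed

lemma inverse_pair_sum:
  assumes "inverse_pair n E F" "i < n" "j < n"
  shows "(\<Sum>k<n. E $$ (i, k) * F $$ (k, j)) = (if i = j then 1 else 0)"
proof -
  have "E \<in> carrier_mat n n" "F \<in> carrier_mat n n" "E * F = 1\<^sub>m n"
    using assms(1) by (auto simp: inverse_pair_def)
  then show ?thesis using mult_mat_entry[of E n n F n i j] assms by simp
qed

lemma invertible_mat_iff_inverse_pair:
  assumes A: "A \<in> carrier_mat n n"
  shows "invertible_mat A \<longleftrightarrow> (\<exists>B. inverse_pair n A B)"
proof
  assume "invertible_mat A"
  then obtain B where B: "A * B = 1\<^sub>m (dim_row A)" "B * A = 1\<^sub>m (dim_row B)"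
    unfolding invertible_mat_def inverts_mat_def by auto
  have "dim_col B = n" using arg_cong[OF B(1), of dim_col] A by simp
  moreover have "dim_row B = n" using arg_cong[OF B(2), of dim_col] A by simp
  ultimately have "B \<in> carrier_mat n n" by (intro carrier_matI)
  moreover have "A * B = 1\<^sub>m n" using B(1) carrier_matD(1)[OF A] by metis
  ultimately show "\<exists>B. inverse_pair n A B" using inverse_pairI[OF A] by blast
next
  assume "\<exists>B. inverse_pair n A B"
  then obtain B where B: "B \<in> carrier_mat n n" "A * B = 1\<^sub>m n" "B * A = 1\<^sub>m n"
    unfolding inverse_pair_def by blast
  have "inverts_mat A B" "inverts_mat B A"
    unfolding inverts_mat_def carrier_matD(1)[OF A] carrier_matD(1)[OF B(1)] using B by blast+
  then show "invertible_mat A" using A unfolding invertible_mat_def by auto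
qed

lemma ex_invertible_mat_iff:
  assumes "\<And>H. H \<in> carrier_mat n n \<Longrightarrow> P H \<longleftrightarrow> Q H"
  shows "(\<exists>H \<in> carrier_mat n n. invertible_mat H \<and> P H) \<longleftrightarrow> (\<exists>H G. inverse_pair n H G \<and> Q H)"
proof -
  have "(H \<in> carrier_mat n n \<and> invertible_mat H \<and> P H) \<longleftrightarrow> (\<exists>G. inverse_pair n H G \<and> Q H)" for H
    using assms invertible_mat_iff_inverse_pair[of H n] inverse_pair_def by blast
  then show ?thesis by blast
qed

lemma invertible_mat_carrier_square:
  assumes "invertible_mat S" "S \<in> carrier_mat m n"
  shows "m = n"
  using assms by (auto simp: invertible_mat_def)

definition trivial_kernel :: "nat \<Rightarrow> complex mat \<Rightarrow> bool" where
  "trivial_kernel n A \<longleftrightarrow> (\<forall>x \<in> carrier_vec n. A *\<^sub>v x = 0\<^sub>v (dim_row A) \<longrightarrow> x = 0\<^sub>v n)"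

lemma trivial_kernelD:
  assumes "trivial_kernel n A" "A \<in> carrier_mat m n"
    and "\<And>i. i < m \<Longrightarrow> (\<Sum>j<n. A $$ (i, j) * x j) = 0" and "j < n"
  shows "x j = 0"
proof -
  have "A *\<^sub>v vec n x = 0\<^sub>v (dim_row A)"
    using assms by (intro eq_vecI) (auto simp: mult_vec_entry simp del: index_mult_mat_vec)
  with assms(1) have "vec n x = 0\<^sub>v n" by (simp add: trivial_kernel_def)
  then have "vec n x $ j = 0\<^sub>v n $ j" by simp
  then show ?thesis using assms(4) by simp
qed

lemma trivial_kernelI:
  assumes "A \<in> carrier_mat m n"
    and "\<And>x j. (\<And>i. i < m \<Longrightarrow> (\<Sum>j<n. A $$ (i, j) * x j) = 0) \<Longrightarrow> j < n \<Longrightarrow> x j = 0"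
  shows "trivial_kernel n A"
  unfolding trivial_kernel_def
proof (intro ballI impI)
  fix x :: "complex vec" assume x: "x \<in> carrier_vec n" and 0: "A *\<^sub>v x = 0\<^sub>v (dim_row A)"
  have "(\<Sum>j<n. A $$ (i, j) * x $ j) = 0" if "i < m" for i
  proof -
    have "(A *\<^sub>v x) $ i = 0" unfolding 0 using assms(1) that by simp
    then show ?thesis unfolding mult_vec_entry[OF assms(1) x that] .
  qed
  from assms(2)[of "\<lambda>j. x $ j", OF this] have "x $ j = 0" if "j < n" for j using that by blast
  with x show "x = 0\<^sub>v n" by (intro eq_vecI) (simp_all add: carrier_vecD[OF x])
qed

lemma trivial_kernel_imp_inverse_pair:
  assumes "A \<in> carrier_mat n n" "trivial_kernel n A"
  shows "\<exists>B. inverse_pair n A B"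
proof -
  have "det A \<noteq> 0"
    using assms det_0_iff_vec_prod_zero[OF assms(1)] by (auto simp: trivial_kernel_def)
  from det_non_zero_imp_unit[OF assms(1) this, of "()"] show ?thesis
    using assms(1) by (auto simp: Units_def ring_mat_def inverse_pair_def)
qed

lemma inverse_pair_imp_trivial_kernel:
  assumes "inverse_pair n A B" shows "trivial_kernel n A"
  unfolding trivial_kernel_def
proof (intro ballI impI)
  fix x :: "complex vec" assume x: "x \<in> carrier_vec n" and 0: "A *\<^sub>v x = 0\<^sub>v (dim_row A)"
  have c: "A \<in> carrier_mat n n" "B \<in> carrier_mat n n" "B * A = 1\<^sub>m n"
    using assms by (auto simp: inverse_pair_def)
  have "x = (B * A) *\<^sub>v x" using x c by simp
  also have "\<dots> = B *\<^sub>v (A *\<^sub>v x)" using x c by (intro assoc_mult_mat_vec) auto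
  also have "\<dots> = 0\<^sub>v n" unfolding 0 using c by auto
  finally show "x = 0\<^sub>v n" .
qed

text \<open>
  If there were more columns than rows, padding with zero rows would give a square matrix with
  trivial kernel, hence invertible, whose last row is zero.
\<close>

lemma trivial_kernel_imp_dim_le:
  assumes "A \<in> carrier_mat m n" "trivial_kernel n A" shows "n \<le> m"
proof (rule ccontr)
  assume "\<not> n \<le> m"
  define B where "B = mat n n (\<lambda>(i, j). if i < m then A $$ (i, j) else 0)"
  have B: "B \<in> carrier_mat n n" by (simp add: B_def)
  have "trivial_kernel n B"
  proof (rule trivial_kernelI[OF B])
    fix x j assume *: "\<And>i. i < n \<Longrightarrow> (\<Sum>j<n. B $$ (i, j) * x j) = 0" and "j < n"
    have "(\<Sum>j<n. A $$ (i, j) * x j) = 0" if "i < m" for i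
      using *[of i] that \<open>\<not> n \<le> m\<close> by (simp add: B_def)
    then show "x j = 0" using trivial_kernelD[OF assms(2,1) _ \<open>j < n\<close>] by blast
  qed
  then obtain C where C: "inverse_pair n B C" using trivial_kernel_imp_inverse_pair[OF B] by blast
  then have "(B * C) $$ (n - 1, n - 1) = 1" using \<open>\<not> n \<le> m\<close> by (simp add: inverse_pair_def)
  moreover have "(B * C) $$ (n - 1, n - 1) = (\<Sum>k<n. B $$ (n - 1, k) * C $$ (k, n - 1))"
    using C \<open>\<not> n \<le> m\<close> by (intro mult_mat_entry[of _ n n _ n]) (auto simp: inverse_pair_def)
  moreover have "(\<Sum>k<n. B $$ (n - 1, k) * C $$ (k, n - 1)) = 0"
    using \<open>\<not> n \<le> m\<close> by (simp add: B_def)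
  ultimately show False by (metis zero_neq_one)
qed

lemma adjoint_dim [simp]:
  "dim_row (mat_adjoint A) = dim_col A" "dim_col (mat_adjoint A) = dim_row A"
  unfolding mat_adjoint_def mat_of_rows_def by (simp_all add: cols_def)

lemma adjoint_carrier [simp]: "A \<in> carrier_mat n m \<Longrightarrow> mat_adjoint A \<in> carrier_mat m n"
  unfolding mat_adjoint_def mat_of_rows_def by (simp add: cols_def)

lemma adjoint_entry:
  fixes A :: "complex mat"
  assumes "A \<in> carrier_mat n m" "i < m" "j < n"
  shows "mat_adjoint A $$ (i, j) = cnj (A $$ (j, i))"
  using assms unfolding mat_adjoint_def mat_of_rows_def by (simp add: cols_def)

lemma adjoint_adjoint:
  fixes A :: "complex mat"
  assumes "A \<in> carrier_mat n m" shows "mat_adjoint (mat_adjoint A) = A"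
proof -
  have c: "mat_adjoint A \<in> carrier_mat m n" "mat_adjoint (mat_adjoint A) \<in> carrier_mat n m"
    using assms by simp_all
  show ?thesis
  proof (rule eq_matI)
    fix i j assume "i < dim_row A" "j < dim_col A"
    then show "mat_adjoint (mat_adjoint A) $$ (i, j) = A $$ (i, j)"
      using assms by (simp add: adjoint_entry[OF c(1)] adjoint_entry[OF assms])
  qed (use assms c in auto)
qed

lemma adjoint_mult:
  fixes A B :: "complex mat"
  assumes "A \<in> carrier_mat n m" "B \<in> carrier_mat m p"
  shows "mat_adjoint (A * B) = mat_adjoint B * mat_adjoint A"
proof -
  have c: "A * B \<in> carrier_mat n p" "mat_adjoint (A * B) \<in> carrier_mat p n"
    "mat_adjoint B \<in> carrier_mat p m" "mat_adjoint A \<in> carrier_mat m n"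
    "mat_adjoint B * mat_adjoint A \<in> carrier_mat p n"
    using assms mult_carrier_mat[of "mat_adjoint B" p m "mat_adjoint A" n] by simp_all
  show ?thesis
  proof (rule eq_matI)
    fix i j assume "i < dim_row (mat_adjoint B * mat_adjoint A)" "j < dim_col (mat_adjoint B * mat_adjoint A)"
    then have ij: "i < p" "j < n" using c by auto
    have "mat_adjoint (A * B) $$ (i, j) = cnj (\<Sum>k<m. A $$ (j, k) * B $$ (k, i))"
      unfolding adjoint_entry[OF c(1) ij] mult_mat_entry[OF assms ij(2,1)] ..
    also have "\<dots> = (mat_adjoint B * mat_adjoint A) $$ (i, j)"
      unfolding mult_mat_entry[OF c(3,4) ij] cnj_sum
      by (rule sum.cong) (simp_all add: adjoint_entry[OF assms(1)] adjoint_entry[OF assms(2)] ij mult.commute)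
    finally show "mat_adjoint (A * B) $$ (i, j) = (mat_adjoint B * mat_adjoint A) $$ (i, j)" .
  qed (use c in auto)
qed

lemma unitary_mat_iff_inverse_pair: "unitary_mat n U \<longleftrightarrow> inverse_pair n U (mat_adjoint U)"
  unfolding unitary_mat_def inverse_pair_def using adjoint_carrier by blast

lemma unitary_carrier: "unitary_mat n U \<Longrightarrow> U \<in> carrier_mat n n"
  by (simp add: unitary_mat_def)

lemma unitary_adjoint: "unitary_mat n U \<Longrightarrow> unitary_mat n (mat_adjoint U)"
  by (auto simp: unitary_mat_def adjoint_adjoint[of U n n])

lemma unitary_mult:
  assumes "unitary_mat n U" "unitary_mat n V" shows "unitary_mat n (U * V)"
  using inverse_pair_mult[OF assms[unfolded unitary_mat_iff_inverse_pair]]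
  unfolding unitary_mat_iff_inverse_pair
  unfolding adjoint_mult[OF unitary_carrier[OF assms(1)] unitary_carrier[OF assms(2)]] .

lemma adjoint_one: "mat_adjoint (1\<^sub>m n :: complex mat) = 1\<^sub>m n"
proof -
  have c: "mat_adjoint (1\<^sub>m n :: complex mat) \<in> carrier_mat n n" by simp
  show ?thesis
    by (rule eq_matI) (use c in \<open>auto simp: adjoint_entry[of _ n n]\<close>)
qed

lemma unitary_one: "unitary_mat n (1\<^sub>m n)"
  by (simp add: unitary_mat_def adjoint_one)

text \<open>
  Orthonormality of the columns suffices, again because one-sided inverses are two-sided.
\<close>

lemma unitary_matI:
  assumes U: "U \<in> carrier_mat n n"
    and "\<And>i j. i < n \<Longrightarrow> j < n \<Longrightarrow> (\<Sum>k<n. cnj (U $$ (k, i)) * U $$ (k, j)) = (if i = j then 1 else 0)"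
  shows "unitary_mat n U"
proof -
  have c: "mat_adjoint U \<in> carrier_mat n n" using U by simp
  have "mat_adjoint U * U = 1\<^sub>m n"
  proof (rule eq_matI)
    fix i j assume "i < dim_row (1\<^sub>m n :: complex mat)" "j < dim_col (1\<^sub>m n :: complex mat)"
    then have ij: "i < n" "j < n" by auto
    show "(mat_adjoint U * U) $$ (i, j) = 1\<^sub>m n $$ (i, j)"
      unfolding mult_mat_entry[OF c U ij] using assms(2)[OF ij] ij
      by (simp add: adjoint_entry[OF U])
  qed (use c U in auto)
  then show ?thesis
    using inverse_pairI[OF c U] by (simp add: unitary_mat_iff_inverse_pair inverse_pair_sym)
qed

lemma unitary_column_inner:
  assumes "unitary_mat n U" "i < n" "j < n"
  shows "(\<Sum>k<n. cnj (U $$ (k, i)) * U $$ (k, j)) = (if i = j then 1 else 0)"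
proof -
  have U: "U \<in> carrier_mat n n" "mat_adjoint U \<in> carrier_mat n n" 
    using assms by (auto simp: unitary_mat_def)
  have "(mat_adjoint U * U) $$ (i, j) = (1\<^sub>m n) $$ (i, j)" using assms by (simp add: unitary_mat_def)
  then show ?thesis unfolding mult_mat_entry[OF U(2,1) assms(2,3)]
    using assms by (simp add: adjoint_entry[OF U(1)])
qed

lemma unitary_permute_columns:
  assumes "unitary_mat n U" "bij_betw p {..<n} {..<n}"
  shows "unitary_mat n (mat n n (\<lambda>(i, j). U $$ (i, p j)))"
proof (rule unitary_matI)
  fix i j assume ij: "i < n" "j < n"
  then have "p i < n" "p j < n" "p i = p j \<longleftrightarrow> i = j"
    using assms(2) by (auto simp: bij_betw_def inj_on_def)
  then show "(\<Sum>k<n. cnj (mat n n (\<lambda>(i, j). U $$ (i, p j)) $$ (k, i)) *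
      mat n n (\<lambda>(i, j). U $$ (i, p j)) $$ (k, j)) = (if i = j then 1 else 0)"
    using unitary_column_inner[OF assms(1), of "p i" "p j"] ij by simp
qed simp

lemma unitary_four_block_diag:
  assumes "unitary_mat m U" "unitary_mat n V"
  shows "unitary_mat (m + n) (four_block_mat U (0\<^sub>m m n) (0\<^sub>m n m) V)"
proof (rule unitary_matI)
  have c: "U \<in> carrier_mat m m" "V \<in> carrier_mat n n" using assms by (auto simp: unitary_mat_def)
  let ?W = "four_block_mat U (0\<^sub>m m n) (0\<^sub>m n m) V"
  show "?W \<in> carrier_mat (m + n) (m + n)" using c by simp
  fix i j assume ij: "i < m + n" "j < m + n"
  have split: "(\<Sum>k<m+n. f k) = (\<Sum>k<m. f k) + (\<Sum>k<n. f (m + k))" for f :: "nat \<Rightarrow> complex"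
    by (induction n) (simp_all add: add.assoc)
  show "(\<Sum>k<m + n. cnj (?W $$ (k, i)) * ?W $$ (k, j)) = (if i = j then 1 else 0)"
    unfolding split using c ij
      unitary_column_inner[OF assms(1), of i j] unitary_column_inner[OF assms(2), of "i - m" "j - m"]
    by (cases "i < m"; cases "j < m") (auto simp: not_less)
qed

section \<open>Strips of a matrix\<close>

text \<open>
  The number of the strip that contains the index \<open>c\<close>. Indices beyond the last strip get
  the number \<open>length ks\<close>, which is the number of the additional strip in \<open>reduced_right\<close>.
\<close>

fun strip_of :: "nat list \<Rightarrow> nat \<Rightarrow> nat" where
  "strip_of [] c = 0"
| "strip_of (k # ks) c = (if c < k then 0 else Suc (strip_of ks (c - k)))"

definition off :: "nat list \<Rightarrow> nat \<Rightarrow> nat" where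
  "off ks i = sum_list (take i ks)"

lemma off_0 [simp]: "off ks 0 = 0"
  by (simp add: off_def)

lemma off_Cons_Suc [simp]: "off (k # ks) (Suc i) = k + off ks i"
  by (simp add: off_def)

lemma off_Suc: "i < length ks \<Longrightarrow> off ks (Suc i) = off ks i + ks ! i"
  by (simp add: off_def take_Suc_conv_app_nth)

lemma off_length [simp]: "off ks (length ks) = sum_list ks"
  by (simp add: off_def)

lemma off_append [simp]: "i \<le> length ks \<Longrightarrow> off (ks @ ks') i = off ks i"
  by (simp add: off_def)

lemma off_mono: "i \<le> j \<Longrightarrow> off ks i \<le> off ks j"
proof (induction ks arbitrary: i j)
  case Nil then show ?case by (simp add: off_def)
next
  case (Cons k ks) then show ?case by (cases i; cases j) auto
qed

lemma off_le_sum: "off ks i \<le> sum_list ks"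
  by (metis le_add1 append_take_drop_id sum_list_append off_def)

lemma strip_of_off:
  "i < length ks \<Longrightarrow> a < ks ! i \<Longrightarrow> strip_of ks (off ks i + a) = i"
proof (induction ks arbitrary: i)
  case (Cons k ks) then show ?case by (cases i) auto
qed simp

lemma strip_of_less:
  "c < sum_list ks \<Longrightarrow> strip_of ks c < length ks"
proof (induction ks arbitrary: c)
  case (Cons k ks) from Cons.IH[of "c - k"] Cons.prems show ?case by auto
qed simp

lemma off_strip_of_le: "c < sum_list ks \<Longrightarrow> off ks (strip_of ks c) \<le> c"
proof (induction ks arbitrary: c)
  case (Cons k ks)
  show ?case
  proof (cases "c < k")
    case False
    then have "c - k < sum_list ks" using Cons.prems by simp
    from Cons.IH[OF this] False show ?thesis by simp
  qed simp
qed simp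

lemma strip_of_remainder:
  "c < sum_list ks \<Longrightarrow> c - off ks (strip_of ks c) < ks ! strip_of ks c"
proof (induction ks arbitrary: c)
  case (Cons k ks)
  show ?case
  proof (cases "c < k")
    case False
    then have "c - k < sum_list ks" using Cons.prems by simp
    from Cons.IH[OF this] False show ?thesis by simp
  qed simp
qed simp

lemma off_add_less_sum: "i < length ks \<Longrightarrow> a < ks ! i \<Longrightarrow> off ks i + a < sum_list ks"
  using off_Suc[of i ks] off_le_sum[of ks "Suc i"] by linarith

lemma strip_cases:
  assumes "c < sum_list ks"
  obtains i a where "i < length ks" "a < ks ! i" "c = off ks i + a" "strip_of ks c = i"
  using strip_of_less[OF assms] off_strip_of_le[OF assms] strip_of_remainder[OF assms]
  by (metis le_add_diff_inverse)

lemma strip_of_append: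
  "strip_of (ks @ ks') c =
    (if c < sum_list ks then strip_of ks c else length ks + strip_of ks' (c - sum_list ks))"
  by (induction ks arbitrary: c) auto

lemma strip_of_ge: "sum_list ks \<le> c \<Longrightarrow> strip_of ks c = length ks"
  using strip_of_append[of ks "[]" c] by simp

lemma strip_of_less_iff:
  assumes "i \<le> length ks" shows "strip_of ks c < i \<longleftrightarrow> c < off ks i"
  using assms
proof (induction ks arbitrary: c i)
  case (Cons k ks) then show ?case by (cases i) auto
qed simp

text \<open>
  The blocks need not be square and may have no rows or no columns; this is used below for sums of
  interval representations, whose blocks have sizes 0 and 1.
\<close>

lemma diag_block_mat_entry:
  assumes "a < sum_list (map dim_row Bs)" "c < sum_list (map dim_col Bs)"
  shows "diag_block_mat Bs $$ (a, c) =
    (let i = strip_of (map dim_row Bs) a in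
     if i = strip_of (map dim_col Bs) c
     then Bs ! i $$ (a - off (map dim_row Bs) i, c - off (map dim_col Bs) i) else 0)"
  using assms
proof (induction Bs arbitrary: a c)
  case (Cons B Bs)
  have d: "dim_row (diag_block_mat Bs) = sum_list (map dim_row Bs)"
    "dim_col (diag_block_mat Bs) = sum_list (map dim_col Bs)"
    by (simp_all add: dim_diag_block_mat)
  show ?case
    using Cons.prems Cons.IH[of "a - dim_row B" "c - dim_col B"]
    by (auto simp: d Let_def)
qed simp

lemma strip_block_entry:
  "a < rs ! i \<Longrightarrow> b < cs ! j \<Longrightarrow>
    strip_block rs cs B i j $$ (a, b) = B $$ (off rs i + a, off cs j + b)"
  by (simp add: strip_block_def off_def)

lemma strip_block_eq_iff:
  assumes "C \<in> carrier_mat (rs ! i) (cs ! j)"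
  shows "strip_block rs cs B i j = C \<longleftrightarrow>
    (\<forall>a < rs ! i. \<forall>b < cs ! j. B $$ (off rs i + a, off cs j + b) = C $$ (a, b))"
proof
  assume "strip_block rs cs B i j = C"
  then show "\<forall>a < rs ! i. \<forall>b < cs ! j. B $$ (off rs i + a, off cs j + b) = C $$ (a, b)"
    by (auto simp: strip_block_entry)
next
  assume *: "\<forall>a < rs ! i. \<forall>b < cs ! j. B $$ (off rs i + a, off cs j + b) = C $$ (a, b)"
  show "strip_block rs cs B i j = C"
  proof (rule eq_matI)
    fix a b assume "a < dim_row C" "b < dim_col C"
    then show "strip_block rs cs B i j $$ (a, b) = C $$ (a, b)"
      using * assms by (simp add: strip_block_entry)
  qed (use assms in \<open>auto simp: strip_block_def\<close>)
qed

text \<open>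
  The entries are addressed by offsets, and the zero blocks below the diagonal are merged into one
  zero region, so that no statement about single blocks is needed later.
\<close>

lemma reduced_right_iff:
  "reduced_right d' ks ls B \<longleftrightarrow>
     length ls = length ks \<and> sum_list ls \<le> d' \<and>
     (\<forall>i < length ks. ls ! i \<le> ks ! i \<and>
        (\<exists>H G. inverse_pair (ls ! i) H G \<and>
           (\<forall>a < ls ! i. \<forall>b < ks ! i. B $$ (off ls i + a, off ks i + b) =
              (if b < ks ! i - ls ! i then 0 else H $$ (a, b - (ks ! i - ls ! i))))) \<and>
        (\<forall>a < d'. off ls (Suc i) \<le> a \<longrightarrow> (\<forall>b < ks ! i. B $$ (a, off ks i + b) = 0)))"
  (is "?l \<longleftrightarrow> ?r")
proof (cases "length ls = length ks \<and> sum_list ls \<le> d'")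
  case len: True
  let ?rs = "ls @ [d' - sum_list ls]"
  have sum: "sum_list ?rs = d'" using len by simp
  have 1: "(\<exists>H \<in> carrier_mat (ls ! i) (ls ! i). invertible_mat H \<and>
           strip_block ?rs ks B i i = append_cols (0\<^sub>m (ls ! i) (ks ! i - ls ! i)) H) \<longleftrightarrow>
        (\<exists>H G. inverse_pair (ls ! i) H G \<and>
           (\<forall>a < ls ! i. \<forall>b < ks ! i. B $$ (off ls i + a, off ks i + b) =
              (if b < ks ! i - ls ! i then 0 else H $$ (a, b - (ks ! i - ls ! i)))))"
    (is "?L \<longleftrightarrow> ?R")
    if i: "i < length ks" and le: "ls ! i \<le> ks ! i" for i
  proof -
    have rs: "?rs ! i = ls ! i" "off ?rs i = off ls i" using len i by (simp_all add: nth_append)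
    have *: "strip_block ?rs ks B i i = append_cols (0\<^sub>m (ls ! i) (ks ! i - ls ! i)) H \<longleftrightarrow>
      (\<forall>a < ls ! i. \<forall>b < ks ! i. B $$ (off ls i + a, off ks i + b) =
              (if b < ks ! i - ls ! i then 0 else H $$ (a, b - (ks ! i - ls ! i))))"
      if H: "H \<in> carrier_mat (ls ! i) (ls ! i)" for H
    proof -
      have c: "append_cols (0\<^sub>m (ls ! i) (ks ! i - ls ! i)) H \<in> carrier_mat (?rs ! i) (ks ! i)"
        using H le unfolding append_cols_def rs by auto
      have e: "append_cols (0\<^sub>m (ls ! i) (ks ! i - ls ! i)) H $$ (a, b) =
          (if b < ks ! i - ls ! i then 0 else H $$ (a, b - (ks ! i - ls ! i)))"
        if "a < ls ! i" "b < ks ! i" for a b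
        using H that le unfolding append_cols_def by auto
      show ?thesis unfolding strip_block_eq_iff[OF c] unfolding rs using e by auto
    qed
    show ?thesis by (rule ex_invertible_mat_iff[OF *])
  qed
  have 2: "(\<forall>i'. i < i' \<and> i' \<le> length ks \<longrightarrow> strip_block ?rs ks B i' i = 0\<^sub>m (?rs ! i') (ks ! i)) \<longleftrightarrow>
      (\<forall>a < d'. off ls (Suc i) \<le> a \<longrightarrow> (\<forall>b < ks ! i. B $$ (a, off ks i + b) = 0))" (is "?L \<longleftrightarrow> ?R")
    if i: "i < length ks" for i
  proof
    assume L: ?L
    show ?R
    proof (intro allI impI)
      fix a b assume a: "a < d'" "off ls (Suc i) \<le> a" and b: "b < ks ! i"
      from a(1) sum have "a < sum_list ?rs" by simp
      then obtain i' a' where i': "i' < length ?rs" "a' < ?rs ! i'" "a = off ?rs i' + a'" "strip_of ?rs a = i'"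
        by (rule strip_cases)
      have "\<not> strip_of ?rs a < Suc i"
        using strip_of_less_iff[of "Suc i" ?rs a] a(2) i len by simp
      then have *: "i < i' \<and> i' \<le> length ks" using i' len by simp
      then have "strip_block ?rs ks B i' i = 0\<^sub>m (?rs ! i') (ks ! i)" using L by blast
      then show "B $$ (a, off ks i + b) = 0"
        using strip_block_entry[OF i'(2) b, of B] i'(2,3) b by simp
    qed
  next
    assume R: ?R
    show ?L
    proof (intro allI impI)
      fix i' assume i': "i < i' \<and> i' \<le> length ks"
      have "B $$ (off ?rs i' + a, off ks i + b) = 0" if "a < ?rs ! i'" "b < ks ! i" for a b
      proof -
        have "off ls (Suc i) = off ?rs (Suc i)" using i len by simp
        also have "\<dots> \<le> off ?rs i'" using i' by (intro off_mono) simp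
        finally have "off ls (Suc i) \<le> off ?rs i' + a" by simp
        moreover have "off ?rs i' + a < d'" using off_add_less_sum[of i' ?rs a] that i' len sum by simp
        ultimately show ?thesis using R that by blast
      qed
      then show "strip_block ?rs ks B i' i = 0\<^sub>m (?rs ! i') (ks ! i)"
        by (subst strip_block_eq_iff) auto
    qed
  qed
  have "?l \<longleftrightarrow> (\<forall>i < length ks. ls ! i \<le> ks ! i \<and>
     (\<exists>H \<in> carrier_mat (ls ! i) (ls ! i). invertible_mat H \<and>
           strip_block ?rs ks B i i = append_cols (0\<^sub>m (ls ! i) (ks ! i - ls ! i)) H) \<and>
     (\<forall>i'. i < i' \<and> i' \<le> length ks \<longrightarrow> strip_block ?rs ks B i' i = 0\<^sub>m (?rs ! i') (ks ! i)))"
    using len unfolding reduced_right_def Let_def by (simp cong: conj_cong)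
  also have "\<dots> \<longleftrightarrow> ?r" using len 1 2 by (simp cong: conj_cong)
  finally show ?thesis .
qed (auto simp: reduced_right_def)

text \<open>
  The counterpart for arrows to the left; the additional strip comes first, which shifts all column
  offsets by its width.
\<close>

lemma reduced_left_iff:
  "reduced_left d' ks ls B \<longleftrightarrow>
     length ls = length ks \<and> sum_list ls \<le> d' \<and>
     (\<forall>i < length ks. ls ! i \<le> ks ! i \<and>
        (\<exists>H G. inverse_pair (ls ! i) H G \<and>
           (\<forall>a < ks ! i. \<forall>b < ls ! i. B $$ (off ks i + a, d' - sum_list ls + off ls i + b) =
              (if a < ls ! i then H $$ (a, b) else 0))) \<and>
        (\<forall>a < ks ! i. \<forall>b < d' - sum_list ls + off ls i. B $$ (off ks i + a, b) = 0))"
  (is "?l \<longleftrightarrow> ?r")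
proof (cases "length ls = length ks \<and> sum_list ls \<le> d'")
  case len: True
  let ?cs = "(d' - sum_list ls) # ls"
  have 1: "(\<exists>H \<in> carrier_mat (ls ! i) (ls ! i). invertible_mat H \<and>
           strip_block ks ?cs B i (Suc i) = H @\<^sub>r 0\<^sub>m (ks ! i - ls ! i) (ls ! i)) \<longleftrightarrow>
        (\<exists>H G. inverse_pair (ls ! i) H G \<and>
           (\<forall>a < ks ! i. \<forall>b < ls ! i. B $$ (off ks i + a, d' - sum_list ls + off ls i + b) =
              (if a < ls ! i then H $$ (a, b) else 0)))"
    (is "?L \<longleftrightarrow> ?R")
    if i: "i < length ks" and le: "ls ! i \<le> ks ! i" for i
  proof -
    have *: "strip_block ks ?cs B i (Suc i) = H @\<^sub>r 0\<^sub>m (ks ! i - ls ! i) (ls ! i) \<longleftrightarrow>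
      (\<forall>a < ks ! i. \<forall>b < ls ! i. B $$ (off ks i + a, d' - sum_list ls + off ls i + b) =
              (if a < ls ! i then H $$ (a, b) else 0))"
      if H: "H \<in> carrier_mat (ls ! i) (ls ! i)" for H
    proof -
      have c: "H @\<^sub>r 0\<^sub>m (ks ! i - ls ! i) (ls ! i) \<in> carrier_mat (ks ! i) (?cs ! Suc i)"
        using H le unfolding append_rows_def by auto
      have e: "(H @\<^sub>r 0\<^sub>m (ks ! i - ls ! i) (ls ! i)) $$ (a, b) =
          (if a < ls ! i then H $$ (a, b) else 0)"
        if "a < ks ! i" "b < ls ! i" for a b
        using H that le unfolding append_rows_def by auto
      show ?thesis unfolding strip_block_eq_iff[OF c] using e by auto
    qed
    show ?thesis by (rule ex_invertible_mat_iff[OF *])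
  qed
  have 2: "(\<forall>j \<le> i. strip_block ks ?cs B i j = 0\<^sub>m (ks ! i) (?cs ! j)) \<longleftrightarrow>
      (\<forall>a < ks ! i. \<forall>b < d' - sum_list ls + off ls i. B $$ (off ks i + a, b) = 0)" (is "?L \<longleftrightarrow> ?R")
    if i: "i < length ks" for i
  proof
    assume L: ?L
    show ?R
    proof (intro allI impI)
      fix a b assume a: "a < ks ! i" and b: "b < d' - sum_list ls + off ls i"
      have b': "b < sum_list ?cs" using b off_le_sum[of ls i] by simp
      then obtain j e where j: "j < length ?cs" "e < ?cs ! j" "b = off ?cs j + e" "strip_of ?cs b = j"
        by (rule strip_cases)
      have "strip_of ?cs b < Suc i"
        using strip_of_less_iff[of "Suc i" ?cs b] b i len by simp
      then have "strip_block ks ?cs B i j = 0\<^sub>m (ks ! i) (?cs ! j)" using L j(4) by simp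
      then show "B $$ (off ks i + a, b) = 0"
        using strip_block_entry[OF a j(2), of B] j(2,3) a by simp
    qed
  next
    assume R: ?R
    show ?L
    proof (intro allI impI)
      fix j assume j: "j \<le> i"
      have "B $$ (off ks i + a, off ?cs j + b) = 0" if "a < ks ! i" "b < ?cs ! j" for a b
      proof -
        have "off ?cs j + b < off ?cs (Suc j)" using off_Suc[of j ?cs] that j i len by simp
        also have "\<dots> \<le> off ?cs (Suc i)" using j by (intro off_mono) simp
        finally show ?thesis using R that by simp
      qed
      then show "strip_block ks ?cs B i j = 0\<^sub>m (ks ! i) (?cs ! j)"
        by (subst strip_block_eq_iff) auto
    qed
  qed
  have "?l \<longleftrightarrow> (\<forall>i < length ks. ls ! i \<le> ks ! i \<and>
     (\<exists>H \<in> carrier_mat (ls ! i) (ls ! i). invertible_mat H \<and>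
           strip_block ks ?cs B i (Suc i) = H @\<^sub>r 0\<^sub>m (ks ! i - ls ! i) (ls ! i)) \<and>
     (\<forall>j \<le> i. strip_block ks ?cs B i j = 0\<^sub>m (ks ! i) (?cs ! j)))"
    using len unfolding reduced_left_def Let_def by (simp cong: conj_cong)
  also have "\<dots> \<longleftrightarrow> ?r" using len 1 2 by (simp cong: conj_cong)
  finally show ?thesis .
qed (auto simp: reduced_left_def)

lemma diag_block_unitary:
  assumes "list_all2 unitary_mat ks Vs"
  shows "unitary_mat (sum_list ks) (diag_block_mat Vs)"
  using assms
proof (induction rule: list_all2_induct)
  case Nil
  have "0\<^sub>m 0 0 = (1\<^sub>m 0 :: complex mat)" by (rule eq_matI) auto
  then show ?case using unitary_one[of 0] by simp
next
  case (Cons k ks V Vs)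
  have "V \<in> carrier_mat k k" "diag_block_mat Vs \<in> carrier_mat (sum_list ks) (sum_list ks)"
    using Cons by (auto simp: unitary_mat_def)
  then show ?case
    using unitary_four_block_diag[OF Cons(1) Cons.IH] by (auto simp: Let_def)
qed

section \<open>Block triangular matrices and surviving basis vectors\<close>

text \<open>
  For a level function \<open>g\<close>, the matrices that map each span of the basis vectors of level at most
  \<open>i\<close> into itself. Below, \<open>g\<close> is \<open>strip_of ks\<close>, and such an invertible matrix is a basis adapted
  to the flag of strips.
\<close>

definition block_upper :: "nat \<Rightarrow> (nat \<Rightarrow> nat) \<Rightarrow> complex mat \<Rightarrow> bool" where
  "block_upper n g E \<longleftrightarrow> (\<forall>a<n. \<forall>c<n. E $$ (a, c) \<noteq> 0 \<longrightarrow> g a \<le> g c)"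

lemma block_upper_mult:
  assumes "E \<in> carrier_mat n n" "F \<in> carrier_mat n n" "block_upper n g E" "block_upper n g F"
  shows "block_upper n g (E * F)"
  unfolding block_upper_def
proof (intro allI impI)
  fix a c assume ac: "a < n" "c < n" and "(E * F) $$ (a, c) \<noteq> 0"
  then have "(\<Sum>b<n. E $$ (a, b) * F $$ (b, c)) \<noteq> 0"
    unfolding mult_mat_entry[OF assms(1,2) ac] by blast
  then obtain b where "b < n" "E $$ (a, b) * F $$ (b, c) \<noteq> 0"
    by (meson lessThan_iff sum.not_neutral_contains_not_neutral)
  then show "g a \<le> g c"
    using assms(3,4) ac unfolding block_upper_def by (metis mult_eq_0_iff order_trans)
qed

text \<open>
  The span of the vectors of level at most \<open>g c\<close> is invariant under \<open>E\<close> and finite-dimensional, so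
  the injective map \<open>E\<close> is also onto there. To express this with square matrices, \<open>E\<close> is replaced
  by the identity outside this span.
\<close>

lemma block_upper_inverse:
  assumes inv: "inverse_pair n E F" and up: "block_upper n g E"
  shows "block_upper n g F"
  unfolding block_upper_def
proof (intro allI impI, rule ccontr)
  fix a c assume a: "a < n" and c: "c < n" and nz: "F $$ (a, c) \<noteq> 0" and "\<not> g a \<le> g c"
  then have ga: "g c < g a" by simp
  have E: "E \<in> carrier_mat n n" and F: "F \<in> carrier_mat n n" and FE: "F * E = 1\<^sub>m n"
    using inv by (auto simp: inverse_pair_def)
  define D where "D = mat n n (\<lambda>(a, b). if g a \<le> g c then if g b \<le> g c then E $$ (a, b) else 0
    else if a = b then 1 else 0)"
  have D: "D \<in> carrier_mat n n" by (simp add: D_def)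
  have row_out: "(\<Sum>b<n. D $$ (i, b) * x b) = x i" if "i < n" "\<not> g i \<le> g c" for x i
  proof -
    have "(\<Sum>b<n. D $$ (i, b) * x b) = (\<Sum>b<n. if i = b then x b else 0)"
      by (rule sum.cong) (use that in \<open>auto simp: D_def\<close>)
    then show ?thesis using that by simp
  qed
  have row_in: "(\<Sum>b<n. E $$ (i, b) * x b) = (if g i \<le> g c then \<Sum>b<n. D $$ (i, b) * x b else 0)"
    if i: "i < n" and x: "\<And>b. b < n \<Longrightarrow> \<not> g b \<le> g c \<Longrightarrow> x b = 0" for x i
  proof (cases "g i \<le> g c")
    case True
    have "E $$ (i, b) * x b = D $$ (i, b) * x b" if "b < n" for b
      using True i that x by (cases "g b \<le> g c") (auto simp: D_def)
    then have "(\<Sum>b<n. E $$ (i, b) * x b) = (\<Sum>b<n. D $$ (i, b) * x b)" by (intro sum.cong) auto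
    then show ?thesis using True by simp
  next
    case False
    have "E $$ (i, b) * x b = 0" if "b < n" for b
      using False i that x[OF that] up unfolding block_upper_def by (cases "g b \<le> g c") (force, simp)
    then have "(\<Sum>b<n. E $$ (i, b) * x b) = 0" by (intro sum.neutral) auto
    then show ?thesis using False by simp
  qed
  have "trivial_kernel n D"
  proof (rule trivial_kernelI[OF D])
    fix x j assume 0: "\<And>i. i < n \<Longrightarrow> (\<Sum>j<n. D $$ (i, j) * x j) = 0" and j: "j < n"
    have "x b = 0" if "b < n" "\<not> g b \<le> g c" for b using 0[OF that(1)] row_out[OF that] by simp
    then have "(\<Sum>b<n. E $$ (i, b) * x b) = 0" if "i < n" for i
      using row_in[OF that, of x] 0[OF that] by simp
    then show "x j = 0"
      using trivial_kernelD[OF inverse_pair_imp_trivial_kernel[OF inv] E _ j] by blast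
  qed
  then obtain D' where D': "inverse_pair n D D'" using trivial_kernel_imp_inverse_pair[OF D] by blast
  \<comment> \<open>Solving \<open>D z = e\<^sub>c\<close> yields a solution of \<open>E z = e\<^sub>c\<close> without components of level above \<open>g c\<close>; it is column \<open>c\<close> of \<open>F\<close>.\<close>
  define z where "z b = D' $$ (b, c)" for b
  have Dz: "(\<Sum>b<n. D $$ (i, b) * z b) = (if i = c then 1 else 0)" if "i < n" for i
  proof -
    have "(D * D') $$ (i, c) = (\<Sum>b<n. D $$ (i, b) * z b)"
      unfolding z_def by (rule mult_mat_entry[OF D _ that c]) (use D' in \<open>auto simp: inverse_pair_def\<close>)
    then show ?thesis using D' that c by (simp add: inverse_pair_def)
  qed
  have z: "z b = 0" if "b < n" "\<not> g b \<le> g c" for b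
    using Dz[OF that(1)] row_out[OF that, of z] that(2) by auto
  have Ez: "(\<Sum>b<n. E $$ (i, b) * z b) = (if i = c then 1 else 0)" if "i < n" for i
    using row_in[OF that, of z] z Dz[OF that] by auto
  have "z a = (\<Sum>b<n. (F * E) $$ (a, b) * z b)" unfolding FE using a by (simp add: if_distrib[of "\<lambda>x. x * _"] cong: if_cong)
  also have "\<dots> = (\<Sum>b<n. (\<Sum>i<n. F $$ (a, i) * E $$ (i, b)) * z b)"
    by (rule sum.cong) (simp_all add: mult_mat_entry[OF F E a] del: index_mult_mat)
  also have "\<dots> = (\<Sum>b<n. \<Sum>i<n. F $$ (a, i) * (E $$ (i, b) * z b))"
    by (simp add: sum_distrib_right mult.assoc)
  also have "\<dots> = (\<Sum>i<n. F $$ (a, i) * (\<Sum>b<n. E $$ (i, b) * z b))"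
    by (subst sum.swap) (simp add: sum_distrib_left)
  also have "\<dots> = (\<Sum>i<n. F $$ (a, i) * (if i = c then 1 else 0))" using Ez by simp
  also have "\<dots> = F $$ (a, c)"
    using c by (simp add: if_distrib[of "(*) _"] cong: if_cong)
  finally show False using z[OF a] ga nz by simp
qed

text \<open>
  The index in the strips \<open>ks\<close> that corresponds to the index \<open>c\<close> in the strips \<open>ls\<close>: strip
  \<open>i\<close> of \<open>ls\<close> is placed inside strip \<open>i\<close> of \<open>ks\<close> with \<open>e i\<close> positions left free before it. It tells
  which fragment is continued by a basis vector of the next vertex.
\<close>

definition survivor :: "(nat \<Rightarrow> nat) \<Rightarrow> nat list \<Rightarrow> nat list \<Rightarrow> nat \<Rightarrow> nat" where
  "survivor e ks ls c =
     (let i = strip_of ls c in off ks i + e i + (c - off ls i))"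

definition strip_fits :: "(nat \<Rightarrow> nat) \<Rightarrow> nat list \<Rightarrow> nat list \<Rightarrow> bool" where
  "strip_fits e ks ls \<longleftrightarrow> length ls = length ks \<and> (\<forall>i<length ks. e i + ls ! i \<le> ks ! i)"

lemma survivor_off:
  "strip_fits e ks ls \<Longrightarrow> i < length ks \<Longrightarrow> a < ls ! i \<Longrightarrow>
    survivor e ks ls (off ls i + a) = off ks i + (e i + a)"
  by (simp add: survivor_def strip_fits_def strip_of_off)

lemma survivor_less_and_strip:
  assumes "strip_fits e ks ls" "c < sum_list ls"
  shows "survivor e ks ls c < sum_list ks \<and> strip_of ks (survivor e ks ls c) = strip_of ls c"
proof -
  obtain i a where i: "i < length ls" "a < ls ! i" "c = off ls i + a" "strip_of ls c = i"
    using strip_cases[OF assms(2)] .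
  have i': "i < length ks" "e i + a < ks ! i" using assms(1) i(1,2)
    by (auto simp: strip_fits_def intro: less_le_trans[OF add_strict_left_mono])
  then have s: "survivor e ks ls c = off ks i + (e i + a)" using survivor_off[OF assms(1)] i by simp
  show ?thesis unfolding s i(4) using off_add_less_sum[OF i'] strip_of_off[OF i'] by simp
qed

lemma survivor_inj: 
  assumes "strip_fits e ks ls" shows "inj_on (survivor e ks ls) {..<sum_list ls}"
proof (rule inj_onI)
  fix c c' assume c: "c \<in> {..<sum_list ls}" "c' \<in> {..<sum_list ls}"
    and eq: "survivor e ks ls c = survivor e ks ls c'"
  have "strip_of ls c = strip_of ls c'"
    using survivor_less_and_strip[OF assms] c eq by (metis lessThan_iff)
  then show "c = c'"
    using eq c off_strip_of_le[of c ls] off_strip_of_le[of c' ls] by (simp add: survivor_def Let_def)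
qed

lemma card_strip:
  assumes "i < length ks" shows "card {c. c < sum_list ks \<and> strip_of ks c = i} = ks ! i"
proof -
  have "{c. c < sum_list ks \<and> strip_of ks c = i} = (\<lambda>a. off ks i + a) ` {..<ks ! i}"
  proof (intro equalityI subsetI)
    fix c assume "c \<in> {c. c < sum_list ks \<and> strip_of ks c = i}"
    then have c: "c < sum_list ks" "strip_of ks c = i" by auto
    then show "c \<in> (\<lambda>a. off ks i + a) ` {..<ks ! i}"
      by (metis image_eqI lessThan_iff strip_cases)
  qed (use assms in \<open>auto simp: strip_of_off off_add_less_sum\<close>)
  then show ?thesis by (simp add: card_image)
qed

lemma card_nonsurvivors:
  assumes fit: "strip_fits e ks ls" and i: "i < length ks"
  shows "card {c \<in> {..<sum_list ks} - survivor e ks ls ` {..<sum_list ls}. strip_of ks c = i} = ks ! i - ls ! i"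
proof -
  let ?A = "{c. c < sum_list ks \<and> strip_of ks c = i}"
  let ?B = "{c. c < sum_list ls \<and> strip_of ls c = i}"
  have "{c \<in> {..<sum_list ks} - survivor e ks ls ` {..<sum_list ls}. strip_of ks c = i}
      = ?A - survivor e ks ls ` ?B"
    using survivor_less_and_strip[OF fit] by auto
  moreover have "survivor e ks ls ` ?B \<subseteq> ?A"
    using survivor_less_and_strip[OF fit] by auto
  moreover have "card (survivor e ks ls ` ?B) = ls ! i"
    using card_strip[of i ls] fit i survivor_inj[OF fit]
    by (subst card_image) (auto simp: strip_fits_def intro: inj_on_subset)
  moreover have "card ?A = ks ! i" using card_strip[OF i] .
  ultimately show ?thesis by (simp add: card_Diff_subset)
qed

lemma sum_window:
  fixes f :: "nat \<Rightarrow> complex"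
  assumes "s + l \<le> d" and "\<And>c. c < d \<Longrightarrow> c < s \<or> s + l \<le> c \<Longrightarrow> f c = 0"
  shows "(\<Sum>c<d. f c) = (\<Sum>e<l. f (s + e))"
proof -
  have "(\<Sum>c<d. f c) = (\<Sum>c\<in>{s..<s+l}. f c)"
    using assms by (intro sum.mono_neutral_right) auto
  also have "\<dots> = (\<Sum>e<l. f (s + e))"
    by (rule sum.reindex_bij_witness[of _ "\<lambda>e. s + e" "\<lambda>c. c - s"]) auto
  finally show ?thesis .
qed

lemma sum_survivors:
  fixes f :: "nat \<Rightarrow> complex"
  assumes fit: "strip_fits e ks ls"
    and "\<And>c. c < sum_list ks \<Longrightarrow> c \<notin> survivor e ks ls ` {..<sum_list ls} \<Longrightarrow> f c = 0"
  shows "(\<Sum>c<sum_list ks. f c) = (\<Sum>b<sum_list ls. f (survivor e ks ls b))"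
proof -
  have "(\<Sum>c<sum_list ks. f c) = (\<Sum>c\<in>survivor e ks ls ` {..<sum_list ls}. f c)"
    using assms(2) survivor_less_and_strip[OF fit] by (intro sum.mono_neutral_right) auto
  also have "\<dots> = (\<Sum>b<sum_list ls. f (survivor e ks ls b))"
    by (rule sum.reindex_cong[OF survivor_inj[OF fit]]) auto
  finally show ?thesis .
qed

section \<open>Lifting adapted bases through a reduced matrix\<close>

text \<open>
  For an arrow to the right the nonsingular block stands at the right end of its strip, for an
  arrow to the left at the top.
\<close>

abbreviation right_survivor :: "nat list \<Rightarrow> nat list \<Rightarrow> nat \<Rightarrow> nat" where
  "right_survivor ks ls \<equiv> survivor (\<lambda>i. ks ! i - ls ! i) ks ls"

abbreviation left_survivor :: "nat list \<Rightarrow> nat list \<Rightarrow> nat \<Rightarrow> nat" where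
  "left_survivor ks ls \<equiv> survivor (\<lambda>i. 0) ks ls"

lemma reduced_right_fits:
  "reduced_right d' ks ls B \<Longrightarrow> strip_fits (\<lambda>i. ks ! i - ls ! i) ks ls"
  unfolding reduced_right_iff strip_fits_def by simp

lemma reduced_left_fits:
  "reduced_left d' ks ls B \<Longrightarrow> strip_fits (\<lambda>i. 0) ks ls"
  unfolding reduced_left_iff strip_fits_def by simp

text \<open>
  A reduced matrix respects the levels, and it strictly lowers them on the columns to the left of the
  blocks \<open>H\<^sub>i\<close>. The strict part is what allows these columns to be moved into the kernel.
\<close>

lemma reduced_right_upper:
  assumes red: "reduced_right d' ks ls B" and a: "a < d'" and c: "c < sum_list ks"
    and nz: "B $$ (a, c) \<noteq> 0"
  shows "strip_of ls a \<le> strip_of ks c \<and>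
    (c \<notin> right_survivor ks ls ` {..<sum_list ls} \<longrightarrow> strip_of ls a < strip_of ks c)"
proof -
  note r = red[unfolded reduced_right_iff]
  obtain i b where i: "i < length ks" "b < ks ! i" "c = off ks i + b" "strip_of ks c = i"
    using strip_cases[OF c] .
  have "\<not> off ls (Suc i) \<le> a" using r i a nz by auto
  then have le: "strip_of ls a \<le> i" using strip_of_less_iff[of "Suc i" ls a] i r by auto
  moreover have "strip_of ls a \<noteq> i" if c': "c \<notin> right_survivor ks ls ` {..<sum_list ls}"
  proof
    assume s: "strip_of ls a = i"
    then have "a < sum_list ls" using strip_of_ge[of ls a] i(1) r by force
    then obtain a' where a': "a' < ls ! i" "a = off ls i + a'" using s by (metis strip_cases)
    obtain H where "\<forall>a < ls ! i. \<forall>b < ks ! i. B $$ (off ls i + a, off ks i + b) =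
              (if b < ks ! i - ls ! i then 0 else H $$ (a, b - (ks ! i - ls ! i)))"
      using r i(1) by blast
    then have "\<not> b < ks ! i - ls ! i" using nz a' i by auto
    moreover have "ls ! i \<le> ks ! i" using r i(1) by blast
    ultimately have b: "b - (ks ! i - ls ! i) < ls ! i" "b = (ks ! i - ls ! i) + (b - (ks ! i - ls ! i))"
      using i(2) by auto
    have "c = right_survivor ks ls (off ls i + (b - (ks ! i - ls ! i)))"
      using survivor_off[OF reduced_right_fits[OF red] i(1) b(1)] b(2) i(3) by simp
    moreover have "off ls i + (b - (ks ! i - ls ! i)) < sum_list ls"
      using off_add_less_sum b(1) i(1) r by auto
    ultimately show False using c' by blast
  qed
  ultimately show ?thesis using i(4) by auto
qed

text \<open>
  Each step of the flag is mapped onto the corresponding step: the component of highest level is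
  hit with the inverse of \<open>H\<^sub>j\<close>, and what remains has lower level.
\<close>

lemma reduced_right_onto:
  assumes red: "reduced_right d' ks ls B" and j: "j \<le> length ks"
    and w: "\<And>a. a < d' \<Longrightarrow> w a \<noteq> 0 \<Longrightarrow> strip_of ls a < j"
  shows "\<exists>x. (\<forall>c. x c \<noteq> 0 \<longrightarrow> c < sum_list ks \<and> strip_of ks c < j) \<and>
    (\<forall>a<d'. (\<Sum>c<sum_list ks. B $$ (a, c) * x c) = w a)"
  using j w
proof (induction j arbitrary: w)
  case 0
  then show ?case by (intro exI[of _ "\<lambda>_. 0"]) force
next
  case (Suc j)
  note r = red[unfolded reduced_right_iff]
  let ?d = "sum_list ks" and ?l = "ls ! j" and ?e = "ks ! j - ls ! j"
  let ?s = "off ks j + ?e"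
  have j: "j < length ks" using Suc.prems(1) by simp
  have le: "?l \<le> ks ! j" using r j by blast
  have sl: "?s + ?l \<le> ?d" using off_Suc[OF j] off_le_sum[of ks "Suc j"] le by simp
  obtain H G where HG: "inverse_pair ?l H G" and
    H: "\<And>a b. a < ?l \<Longrightarrow> b < ks ! j \<Longrightarrow> B $$ (off ls j + a, off ks j + b) =
              (if b < ?e then 0 else H $$ (a, b - ?e))"
    using r j by blast
  \<comment> \<open>The vector \<open>y\<close> carries \<open>H\<^sub>j\<close> inverse applied to the component of \<open>w\<close> in strip \<open>j\<close>, placed at the columns of \<open>H\<^sub>j\<close>.\<close>
  define u where "u e = (\<Sum>b<?l. G $$ (e, b) * w (off ls j + b))" for e
  define y where "y c = (if ?s \<le> c \<and> c < ?s + ?l then u (c - ?s) else 0)" for c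
  have y_strip: "c < ?d \<and> strip_of ks c = j" if "y c \<noteq> 0" for c
  proof -
    have c: "?s \<le> c" "c < ?s + ?l" using that by (auto simp: y_def split: if_splits)
    then have "c - off ks j < ks ! j" "c = off ks j + (c - off ks j)" using le by auto
    then show ?thesis using strip_of_off[OF j] off_add_less_sum[OF j] by metis
  qed
  have By: "(\<Sum>c<?d. B $$ (a, c) * y c) = (\<Sum>e<?l. B $$ (a, ?s + e) * u e)" for a
    by (subst sum_window[OF sl]) (auto simp: y_def)
  have Hu: "(\<Sum>e<?l. H $$ (a, e) * u e) = w (off ls j + a)" if a: "a < ?l" for a
  proof -
    have "(\<Sum>e<?l. H $$ (a, e) * u e) = (\<Sum>b<?l. (\<Sum>e<?l. H $$ (a, e) * G $$ (e, b)) * w (off ls j + b))"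
      unfolding u_def sum_distrib_left sum_distrib_right
      by (subst sum.swap) (simp add: mult.assoc)
    also have "\<dots> = (\<Sum>b<?l. if b = a then w (off ls j + b) else 0)"
      using a by (intro sum.cong) (auto simp: inverse_pair_sum[OF HG])
    also have "\<dots> = w (off ls j + a)" using a by simp
    finally show ?thesis .
  qed
  define w' where "w' a = w a - (\<Sum>c<?d. B $$ (a, c) * y c)" for a
  have w': "strip_of ls a < j" if a: "a < d'" and nz: "w' a \<noteq> 0" for a
  proof (rule ccontr)
    assume "\<not> strip_of ls a < j"
    then consider "strip_of ls a = j" | "j < strip_of ls a" by linarith
    then show False
    proof cases
      case 1
      then have "a < sum_list ls" using strip_of_ge[of ls a] j r by force
      then obtain a' where a': "a' < ?l" "a = off ls j + a'" using 1 by (metis strip_cases)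
      have "B $$ (a, ?s + e) = H $$ (a', e)" if "e < ?l" for e
        using H[OF a'(1), of "?e + e"] that le a'(2) by (simp add: add.assoc)
      then have "(\<Sum>c<?d. B $$ (a, c) * y c) = w a"
        unfolding By using Hu[OF a'(1)] a'(2) by simp
      then show False using nz by (simp add: w'_def)
    next
      case 2
      have "B $$ (a, c) * y c = 0" if "c < ?d" for c
        using reduced_right_upper[OF red a that] y_strip[of c] 2 by force
      then have "(\<Sum>c<?d. B $$ (a, c) * y c) = 0" by (intro sum.neutral) auto
      moreover have "w a = 0" using Suc.prems(2)[OF a] 2 by force
      ultimately show False using nz by (simp add: w'_def)
    qed
  qed
  obtain x where x: "\<forall>c. x c \<noteq> 0 \<longrightarrow> c < ?d \<and> strip_of ks c < j"
    "\<forall>a<d'. (\<Sum>c<?d. B $$ (a, c) * x c) = w' a"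
    using Suc.IH[of w'] Suc.prems(1) w' by auto
  have "\<forall>c. x c + y c \<noteq> 0 \<longrightarrow> c < ?d \<and> strip_of ks c < Suc j"
    using x(1) y_strip by (metis add.right_neutral less_SucI lessI)
  moreover have "\<forall>a<d'. (\<Sum>c<?d. B $$ (a, c) * (x c + y c)) = w a"
    using x(2) by (simp add: w'_def distrib_left sum.distrib)
  ultimately show ?case by (intro exI[of _ "\<lambda>c. x c + y c"]) simp
qed

text \<open>
  At the surviving positions, the columns of \<open>E\<close> are preimages of the columns of \<open>E'\<close>; elsewhere they are
  kernel vectors, namely standard basis vectors minus corrections of lower level. They are
  independent: applying \<open>B\<close> to a relation shows that the coefficients of the surviving columns
  vanish, as the columns of \<open>E'\<close> are independent, and the remaining columns are unitriangular with
  respect to the levels.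
\<close>

lemma reduced_right_lift_basis:
  assumes red: "reduced_right d' ks ls B" and B: "B \<in> carrier_mat d' (sum_list ks)"
    and inv: "inverse_pair d' E' F'"
    and up: "block_upper d' (strip_of (ls @ [d' - sum_list ls])) E'"
  shows "\<exists>E F. inverse_pair (sum_list ks) E F \<and> block_upper (sum_list ks) (strip_of ks) E \<and>
    (\<forall>a<d'. \<forall>b<sum_list ls. (B * E) $$ (a, right_survivor ks ls b) = E' $$ (a, b)) \<and>
    (\<forall>a<d'. \<forall>c<sum_list ks. c \<notin> right_survivor ks ls ` {..<sum_list ls} \<longrightarrow> (B * E) $$ (a, c) = 0)"
proof -
  let ?d = "sum_list ks" and ?m = "sum_list ls" and ?g = "strip_of ks" and ?s = "right_survivor ks ls"
  note fit = reduced_right_fits[OF red]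
  have len: "length ls = length ks" "?m \<le> d'" using red by (auto simp: reduced_right_iff)
  have gr: "strip_of (ls @ [d' - ?m]) a = strip_of ls a" if "a < d'" for a
    using that by (auto simp: strip_of_append strip_of_ge)
  have up': "strip_of ls a \<le> strip_of ls b" if "a < d'" "b < d'" "E' $$ (a, b) \<noteq> 0" for a b
    using up that gr unfolding block_upper_def by metis
  \<comment> \<open>What is required of column \<open>c\<close>, called \<open>x\<close>; the last part is the unitriangularity off the survivors.\<close>
  define good where "good c x \<longleftrightarrow> (\<forall>a<?d. x a \<noteq> 0 \<longrightarrow> ?g a \<le> ?g c) \<and>
      (\<forall>b<?m. ?s b = c \<longrightarrow> (\<forall>a<d'. (\<Sum>k<?d. B $$ (a, k) * x k) = E' $$ (a, b))) \<and>
      (c \<notin> ?s ` {..<?m} \<longrightarrow> (\<forall>a<d'. (\<Sum>k<?d. B $$ (a, k) * x k) = 0) \<and>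
         x c = 1 \<and> (\<forall>a<?d. a \<noteq> c \<longrightarrow> x a \<noteq> 0 \<longrightarrow> ?g a < ?g c))" for c x
  have "\<exists>x. good c x" if c: "c < ?d" for c
  proof (cases "c \<in> ?s ` {..<?m}")
    case True
    then obtain b where b: "b < ?m" "c = ?s b" by blast
    have sb: "?g c = strip_of ls b" using survivor_less_and_strip[OF fit b(1)] b(2) by simp
    have j: "Suc (?g c) \<le> length ks" using strip_of_less[OF c] by simp
    have "strip_of ls a < Suc (?g c)" if "a < d'" "E' $$ (a, b) \<noteq> 0" for a
      using up'[OF that(1) _ that(2)] b(1) len sb by simp
    from reduced_right_onto[OF red j, of "\<lambda>a. E' $$ (a, b)", OF this] obtain x where
      x: "\<forall>k. x k \<noteq> 0 \<longrightarrow> k < ?d \<and> ?g k < Suc (?g c)"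
      "\<forall>a<d'. (\<Sum>k<?d. B $$ (a, k) * x k) = E' $$ (a, b)" by blast
    have unique: "b' = b" if "b' < ?m" "?s b' = c" for b'
      using inj_onD[OF survivor_inj[OF fit], of b' b] that b by simp
    show ?thesis unfolding good_def
    proof (intro exI[of _ x] conjI)
      show "\<forall>a<?d. x a \<noteq> 0 \<longrightarrow> ?g a \<le> ?g c" using x(1) by (simp add: less_Suc_eq_le)
      show "\<forall>b'<?m. ?s b' = c \<longrightarrow> (\<forall>a<d'. (\<Sum>k<?d. B $$ (a, k) * x k) = E' $$ (a, b'))"
        using x(2) unique by metis
    qed (use True in simp)
  next
    case False
    have j: "?g c \<le> length ks" using strip_of_less[OF c] by simp
    have "strip_of ls a < ?g c" if "a < d'" "B $$ (a, c) \<noteq> 0" for a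
      using reduced_right_upper[OF red that(1) c that(2)] False by blast
    from reduced_right_onto[OF red j, of "\<lambda>a. B $$ (a, c)", OF this] obtain x where
      x: "\<forall>k. x k \<noteq> 0 \<longrightarrow> k < ?d \<and> ?g k < ?g c"
      "\<forall>a<d'. (\<Sum>k<?d. B $$ (a, k) * x k) = B $$ (a, c)" by blast
    let ?y = "\<lambda>k. (if k = c then 1 else 0) - x k"
    have "(\<Sum>k<?d. B $$ (a, k) * ?y k) = 0" if "a < d'" for a
      using x(2) that c
      by (simp add: right_diff_distrib sum_subtractf if_distrib[of "(*) _"] cong: if_cong)
    then show ?thesis unfolding good_def using x False by (intro exI[of _ ?y]) force
  qed
  then obtain f where "\<And>c. c < ?d \<Longrightarrow> good c (f c)" by metis
  note f = this[unfolded good_def]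
  define E where "E = mat ?d ?d (\<lambda>(a, c). f c a)"
  have E: "E \<in> carrier_mat ?d ?d" by (simp add: E_def)
  have E_entry: "E $$ (a, c) = f c a" if "a < ?d" "c < ?d" for a c using that by (simp add: E_def)
  have BE: "(B * E) $$ (a, c) = (\<Sum>k<?d. B $$ (a, k) * f c k)" if "a < d'" "c < ?d" for a c
    unfolding mult_mat_entry[OF B E that] using that by (simp add: E_entry)
  have BE1: "(B * E) $$ (a, ?s b) = E' $$ (a, b)" if "a < d'" "b < ?m" for a b
    using BE[OF that(1), of "?s b"] f[of "?s b"] survivor_less_and_strip[OF fit that(2)] that by simp
  have BE0: "(B * E) $$ (a, c) = 0" if "a < d'" "c < ?d" "c \<notin> ?s ` {..<?m}" for a c
    using BE[OF that(1,2)] f[OF that(2)] that by simp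
  have "block_upper ?d ?g E" unfolding block_upper_def using f by (simp add: E_def)
  moreover have "trivial_kernel ?d E"
  proof (rule trivial_kernelI[OF E])
    fix x j assume 0: "\<And>i. i < ?d \<Longrightarrow> (\<Sum>j<?d. E $$ (i, j) * x j) = 0" and j: "j < ?d"
    have surv0: "x (?s b) = 0" if b: "b < ?m" for b
    proof -
      have "(\<Sum>k<d'. E' $$ (a, k) * (if k < ?m then x (?s k) else 0)) = 0" if a: "a < d'" for a
      proof -
        have "(\<Sum>k<d'. E' $$ (a, k) * (if k < ?m then x (?s k) else 0))
            = (\<Sum>b<?m. (B * E) $$ (a, ?s b) * x (?s b))"
          using len(2) a BE1
          by (subst sum.mono_neutral_right[of "{..<d'}" "{..<?m}"]) (auto simp del: index_mult_mat)
        also have "\<dots> = (\<Sum>c<?d. (B * E) $$ (a, c) * x c)"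
          by (rule sum_survivors[OF fit, symmetric]) (use BE0[OF a] in \<open>simp del: index_mult_mat\<close>)
        also have "\<dots> = (\<Sum>c<?d. \<Sum>k<?d. B $$ (a, k) * (E $$ (k, c) * x c))"
          by (rule sum.cong) (simp_all add: mult_mat_entry[OF B E a] sum_distrib_right mult.assoc del: index_mult_mat)
        also have "\<dots> = (\<Sum>k<?d. B $$ (a, k) * (\<Sum>c<?d. E $$ (k, c) * x c))"
          by (subst sum.swap) (simp add: sum_distrib_left)
        also have "\<dots> = 0" using 0 by simp
        finally show ?thesis .
      qed
      moreover have "E' \<in> carrier_mat d' d'" using inv by (simp add: inverse_pair_def)
      ultimately have "(if b < ?m then x (?s b) else 0) = 0"
        using b len by (intro trivial_kernelD[OF inverse_pair_imp_trivial_kernel[OF inv],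
              where x = "\<lambda>k. if k < ?m then x (?s k) else 0"]) auto
      then show ?thesis using b by simp
    qed
    show "x j = 0"
    proof (rule ccontr)
      assume "x j \<noteq> 0"
      \<comment> \<open>A nonzero coefficient of maximal level cannot be cancelled, since the other columns involved vanish at its position.\<close>
      let ?X = "{c. c < ?d \<and> x c \<noteq> 0}"
      have fin: "finite (?g ` ?X)" and ne: "?g ` ?X \<noteq> {}" using j \<open>x j \<noteq> 0\<close> by auto
      from Max_in[OF fin ne] obtain c where c: "c < ?d" "x c \<noteq> 0" "?g c = Max (?g ` ?X)" by auto
      have c_max: "?g k \<le> ?g c" if "k < ?d" "x k \<noteq> 0" for k
        unfolding c(3) by (rule Max_ge[OF fin]) (use that in blast)
      have nonsurv: "k \<notin> ?s ` {..<?m}" if "x k \<noteq> 0" for k using surv0 that by auto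
      have "E $$ (c, k) * x k = (if k = c then x c else 0)" if k: "k < ?d" for k
      proof (cases "x k = 0 \<or> k = c")
        case True
        moreover have "f c c = 1" using f[OF c(1)] nonsurv[OF c(2)] by blast
        ultimately show ?thesis using c(1) k by (auto simp: E_entry)
      next
        case False
        then have "\<forall>a<?d. a \<noteq> k \<longrightarrow> f k a \<noteq> 0 \<longrightarrow> ?g a < ?g k" "?g k \<le> ?g c"
          using f[OF k] nonsurv[of k] c_max[OF k] by blast+
        moreover have "c \<noteq> k" using False by simp
        ultimately have "f k c = 0" using c(1) by (metis leD)
        then show ?thesis using False c(1) k by (simp add: E_entry)
      qed
      then have "(\<Sum>k<?d. E $$ (c, k) * x k) = x c" using c(1) by simp
      then show False using 0[OF c(1)] c(2) by simp
    qed
  qed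
  ultimately show ?thesis using trivial_kernel_imp_inverse_pair[OF E] BE1 BE0 by blast
qed

lemma reduced_left_upper:
  assumes red: "reduced_left d' ks ls B" and a: "a < sum_list ks" and b: "b < d'"
    and nz: "B $$ (a, b) \<noteq> 0"
  shows "Suc (strip_of ks a) \<le> strip_of ((d' - sum_list ls) # ls) b"
proof -
  note r = red[unfolded reduced_left_iff]
  let ?cs = "(d' - sum_list ls) # ls"
  obtain i e where i: "i < length ks" "e < ks ! i" "a = off ks i + e" "strip_of ks a = i"
    using strip_cases[OF a] .
  have "\<not> b < off ?cs (Suc i)" using r i nz by auto
  then show ?thesis using strip_of_less_iff[of "Suc i" ?cs b] i r by auto
qed

text \<open>
  At the surviving positions, the columns of \<open>E\<close> are the images under \<open>B\<close> of the columns of \<open>E'\<close> outside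
  the additional strip; elsewhere they are standard basis vectors. To see that they are independent,
  write a linear relation as \<open>B y + z = 0\<close>, where \<open>y\<close> combines columns of \<open>E'\<close> outside the additional
  strip and \<open>z\<close> has no components at surviving positions. Nor has \<open>B y\<close> then, and as the \<open>H\<^sub>i\<close> are
  nonsingular, \<open>y\<close> lies in the span of the additional strip. The inverse of \<open>E'\<close> preserves this span,
  so all coefficients in \<open>y\<close> vanish, and with them \<open>z\<close>.
\<close>

lemma reduced_left_lift_basis:
  assumes red: "reduced_left d' ks ls B" and B: "B \<in> carrier_mat (sum_list ks) d'"
    and inv: "inverse_pair d' E' F'"
    and up: "block_upper d' (strip_of ((d' - sum_list ls) # ls)) E'"
  shows "\<exists>E F. inverse_pair (sum_list ks) E F \<and> block_upper (sum_list ks) (strip_of ks) E \<and>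
    (\<forall>a<sum_list ks. \<forall>b<d' - sum_list ls. (B * E') $$ (a, b) = 0) \<and>
    (\<forall>a<sum_list ks. \<forall>b<sum_list ls.
       (B * E') $$ (a, d' - sum_list ls + b) = E $$ (a, left_survivor ks ls b))"
proof -
  let ?d = "sum_list ks" and ?m = "sum_list ls" and ?g = "strip_of ks" and ?s = "left_survivor ks ls"
  let ?q = "d' - sum_list ls"
  let ?h = "strip_of (?q # ls)"
  note r = red[unfolded reduced_left_iff]
  note fit = reduced_left_fits[OF red]
  have len: "length ls = length ks" "?m \<le> d'" using r by auto
  have E': "E' \<in> carrier_mat d' d'" and F': "F' \<in> carrier_mat d' d'"
    using inv by (auto simp: inverse_pair_def)
  have BE'_upper: "Suc (?g a) \<le> ?h b" if a: "a < ?d" and b: "b < d'" and nz: "(B * E') $$ (a, b) \<noteq> 0" for a b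
  proof -
    have "(\<Sum>k<d'. B $$ (a, k) * E' $$ (k, b)) \<noteq> 0" using nz unfolding mult_mat_entry[OF B E' a b] .
    then obtain k where k: "k < d'" "B $$ (a, k) \<noteq> 0" "E' $$ (k, b) \<noteq> 0"
      by (metis (no_types, lifting) lessThan_iff mult_eq_0_iff sum.neutral)
    have "?h k \<le> ?h b" using up k b unfolding block_upper_def by blast
    then show ?thesis using reduced_left_upper[OF red a k(1,2)] by simp
  qed
  define p where "p c = inv_into {..<?m} ?s c" for c
  have p: "p (?s b) = b" if "b < ?m" for b
    unfolding p_def using inv_into_f_f[OF survivor_inj[OF fit]] that by simp
  define E where "E = mat ?d ?d (\<lambda>(a, c). if c \<in> ?s ` {..<?m} then (B * E') $$ (a, ?q + p c)
    else if a = c then 1 else 0)"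
  have E: "E \<in> carrier_mat ?d ?d" by (simp add: E_def)
  have E_surv: "E $$ (a, ?s b) = (B * E') $$ (a, ?q + b)" if "a < ?d" "b < ?m" for a b
    using that survivor_less_and_strip[OF fit that(2)] by (simp add: E_def p del: index_mult_mat)
  have E_other: "E $$ (a, c) = (if a = c then 1 else 0)" if "a < ?d" "c < ?d" "c \<notin> ?s ` {..<?m}" for a c
    using that by (simp add: E_def)
  have zero: "(B * E') $$ (a, b) = 0" if "a < ?d" "b < ?q" for a b
    using BE'_upper[of a b] that by fastforce
  have "block_upper ?d ?g E"
    unfolding block_upper_def
  proof (intro allI impI)
    fix a c assume a: "a < ?d" and c: "c < ?d" and nz: "E $$ (a, c) \<noteq> 0"
    show "?g a \<le> ?g c"
    proof (cases "c \<in> ?s ` {..<?m}")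
      case True
      then obtain b where b: "b < ?m" "c = ?s b" by blast
      have "(B * E') $$ (a, ?q + b) \<noteq> 0" using nz E_surv[OF a b(1)] b(2) by simp
      then have "Suc (?g a) \<le> ?h (?q + b)" using BE'_upper[OF a, of "?q + b"] b len by simp
      then show ?thesis using survivor_less_and_strip[OF fit b(1)] b(2) by simp
    next
      case False
      then show ?thesis using E_other[OF a c] nz by (auto split: if_splits)
    qed
  qed
  moreover have "trivial_kernel ?d E"
  proof (rule trivial_kernelI[OF E])
    fix x j assume 0: "\<And>i. i < ?d \<Longrightarrow> (\<Sum>j<?d. E $$ (i, j) * x j) = 0" and j: "j < ?d"
    \<comment> \<open>The relation \<open>x\<close> splits into \<open>u\<close>, the coefficients of the surviving columns, and \<open>z\<close>, those of the standard basis vectors.\<close>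
    define u where "u b = (if b < ?q then 0 else x (?s (b - ?q)))" for b
    define y where "y b = (\<Sum>k<d'. E' $$ (b, k) * u k)" for b
    define z where "z c = (if c \<in> ?s ` {..<?m} then 0 else x c)" for c
    have By: "(\<Sum>b<d'. B $$ (a, b) * y b) = - z a" if a: "a < ?d" for a
    proof -
      have "(\<Sum>b<d'. B $$ (a, b) * y b) = (\<Sum>k<d'. (B * E') $$ (a, k) * u k)"
        unfolding y_def sum_distrib_left
        by (subst sum.swap) (simp add: mult_mat_entry[OF B E' a] sum_distrib_right mult.assoc del: index_mult_mat)
      also have "\<dots> = (\<Sum>b<?m. (B * E') $$ (a, ?q + b) * u (?q + b))"
        using len by (intro sum_window) (auto simp: u_def)
      also have "\<dots> = (\<Sum>b<?m. E $$ (a, ?s b) * (x (?s b) - z (?s b)))"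
        by (rule sum.cong) (simp_all add: E_surv[OF a] u_def z_def del: index_mult_mat)
      also have "\<dots> = (\<Sum>c<?d. E $$ (a, c) * (x c - z c))"
        by (rule sum_survivors[OF fit, symmetric]) (simp add: z_def)
      also have "\<dots> = (\<Sum>c<?d. E $$ (a, c) * x c) - (\<Sum>c<?d. E $$ (a, c) * z c)"
        by (simp add: right_diff_distrib sum_subtractf)
      also have "(\<Sum>c<?d. E $$ (a, c) * x c) = 0" using 0[OF a] .
      also have "(\<Sum>c<?d. E $$ (a, c) * z c) = (\<Sum>c<?d. if c = a then z a else 0)"
      proof (rule sum.cong)
        fix c assume c: "c \<in> {..<?d}"
        show "E $$ (a, c) * z c = (if c = a then z a else 0)"
          using E_other[OF a, of c] c by (cases "c \<in> ?s ` {..<?m}") (auto simp: z_def)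
      qed simp
      also have "\<dots> = z a" using a by simp
      finally show ?thesis by simp
    qed
    have y0: "?h b = 0" if b: "b < d'" "y b \<noteq> 0" for b
    proof (rule ccontr)
      assume b0: "?h b \<noteq> 0"
      let ?X = "{b. b < d' \<and> y b \<noteq> 0}"
      have fin: "finite (?h ` ?X)" and ne: "?h ` ?X \<noteq> {}" using b by auto
      from Max_in[OF fin ne] obtain c where c: "c < d'" "y c \<noteq> 0" "?h c = Max (?h ` ?X)" by auto
      have c_max: "?h k \<le> ?h c" if "k < d'" "y k \<noteq> 0" for k
        unfolding c(3) by (rule Max_ge[OF fin]) (use that in blast)
      obtain i where i: "?h c = Suc i" using c_max[OF b] b0 by (cases "?h c") auto
      have c': "c < sum_list (?q # ls)" using c(1) len by simp
      have il: "i < length ks" using strip_of_less[OF c'] i len by simp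
      let ?l = "ls ! i"
      obtain e where e: "e < ?l" "c = ?q + off ls i + e"
        using c' i by (metis nth_Cons_Suc off_Cons_Suc strip_cases)
      obtain H G where HG: "inverse_pair ?l H G" and
        H: "\<And>a b. a < ks ! i \<Longrightarrow> b < ?l \<Longrightarrow> B $$ (off ks i + a, ?q + off ls i + b) =
              (if a < ?l then H $$ (a, b) else 0)"
        using r il by blast
      have le: "?l \<le> ks ! i" using r il by blast
      have window: "?q + off ls i + ?l \<le> d'"
        using off_Suc[of i ls] off_le_sum[of ls "Suc i"] il len by simp
      have "(\<Sum>k<?l. H $$ (a, k) * y (?q + off ls i + k)) = 0" if a: "a < ?l" for a
      proof -
        let ?a = "off ks i + a"
        have a': "a < ks ! i" using a le by simp
        have ad: "?a < ?d" "?g ?a = i" using off_add_less_sum[OF il a'] strip_of_off[OF il a'] by auto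
        have "?a = ?s (off ls i + a)" using survivor_off[OF fit il a] by simp
        moreover have "off ls i + a < ?m" using off_add_less_sum[of i ls a] il len a by simp
        ultimately have "z ?a = 0" by (simp add: z_def)
        then have "0 = (\<Sum>b<d'. B $$ (?a, b) * y b)" using By[OF ad(1)] by simp
        also have "\<dots> = (\<Sum>k<?l. B $$ (?a, ?q + off ls i + k) * y (?q + off ls i + k))"
        proof (rule sum_window[OF window])
          fix k assume k: "k < d'" "k < ?q + off ls i \<or> ?q + off ls i + ?l \<le> k"
          show "B $$ (?a, k) * y k = 0"
          proof (rule ccontr)
            assume "B $$ (?a, k) * y k \<noteq> 0"
            then have "Suc i \<le> ?h k" "?h k \<le> Suc i"
              using reduced_left_upper[OF red ad(1) k(1)] ad(2) c_max[OF k(1)] i by auto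
            then show False using k(2) strip_of_less_iff[of "Suc i" "?q # ls" k]
                strip_of_less_iff[of "Suc (Suc i)" "?q # ls" k] il len off_Suc[of i ls] by auto
          qed
        qed
        also have "\<dots> = (\<Sum>k<?l. H $$ (a, k) * y (?q + off ls i + k))"
          using H[OF a'] a by (intro sum.cong) auto
        finally show ?thesis by simp
      qed
      then have "y (?q + off ls i + e) = 0"
        using HG e(1) by (intro trivial_kernelD[OF inverse_pair_imp_trivial_kernel[OF HG],
              where x = "\<lambda>k. y (?q + off ls i + k)"]) (auto simp: inverse_pair_def)
      then show False using c(2) e(2) by simp
    qed
    have u0: "u k = 0" if k: "k < d'" for k
    proof (rule ccontr)
      assume nz: "u k \<noteq> 0"
      have "(\<Sum>b<d'. F' $$ (k, b) * y b) = (\<Sum>l<d'. (\<Sum>b<d'. F' $$ (k, b) * E' $$ (b, l)) * u l)"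
        unfolding y_def sum_distrib_left sum_distrib_right by (subst sum.swap) (simp add: mult.assoc)
      also have "\<dots> = (\<Sum>l<d'. if l = k then u k else 0)"
        using k by (intro sum.cong) (auto simp: inverse_pair_sum[OF inverse_pair_sym[OF inv]])
      also have "\<dots> = u k" using k by simp
      finally have "(\<Sum>b<d'. F' $$ (k, b) * y b) \<noteq> 0" using nz by simp
      then obtain b where b: "b < d'" "F' $$ (k, b) \<noteq> 0" "y b \<noteq> 0"
        by (metis (no_types, lifting) lessThan_iff mult_eq_0_iff sum.neutral)
      have "?h k \<le> ?h b" using block_upper_inverse[OF inv up] b k unfolding block_upper_def by blast
      then have "?h k = 0" using y0 b by simp
      then have "k < ?q" by (simp split: if_splits)
      then show False using nz by (simp add: u_def)
    qed
    then have "y b = 0" if "b < d'" for b by (simp add: y_def)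
    then have z0: "z a = 0" if "a < ?d" for a using By[OF that] by simp
    show "x j = 0"
    proof (cases "j \<in> ?s ` {..<?m}")
      case True
      then obtain b where b: "b < ?m" "j = ?s b" by blast
      have "x (?s b) = u (?q + b)" by (simp add: u_def)
      moreover have "u (?q + b) = 0" by (rule u0) (use b len in simp)
      ultimately show ?thesis using b by simp
    next
      case False
      then show ?thesis using z0[OF j] by (simp add: z_def)
    qed
  qed
  ultimately show ?thesis using trivial_kernel_imp_inverse_pair[OF E] E_surv zero by metis
qed

section \<open>Isomorphisms of representations\<close>

abbreviation src :: "(nat \<Rightarrow> bool) \<Rightarrow> nat \<Rightarrow> nat" where
  "src right i \<equiv> if right i then i else i + 1"

abbreviation tgt :: "(nat \<Rightarrow> bool) \<Rightarrow> nat \<Rightarrow> nat" where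
  "tgt right i \<equiv> if right i then i + 1 else i"

lemma chain_simps [simp]:
  "verts (chain t right) = {1..t}" "arcs (chain t right) = {1..<t}"
  "tail (chain t right) i = src right i" "head (chain t right) i = tgt right i"
  by (simp_all add: chain_def)

lemma wf_chain: "wf_digraph (chain t right)"
  by unfold_locales auto

lemma rep_isoE:
  assumes "rep_iso Q R R'"
  obtains S T where "\<And>v. v \<in> verts Q \<Longrightarrow> vdim R' v = vdim R v \<and> inverse_pair (vdim R v) (S v) (T v)"
    and "\<And>a. a \<in> arcs Q \<Longrightarrow> amat R' a * S (tail Q a) = S (head Q a) * amat R a"
proof -
  obtain S where S: "\<forall>v \<in> verts Q. S v \<in> carrier_mat (vdim R' v) (vdim R v) \<and> invertible_mat (S v)"
    "\<forall>a \<in> arcs Q. amat R' a * S (tail Q a) = S (head Q a) * amat R a"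
    using assms unfolding rep_iso_def by blast
  have "\<exists>T. vdim R' v = vdim R v \<and> inverse_pair (vdim R v) (S v) T" if "v \<in> verts Q" for v
  proof -
    have "S v \<in> carrier_mat (vdim R' v) (vdim R v)" "invertible_mat (S v)" using S(1) that by auto
    moreover from this have "vdim R' v = vdim R v" using invertible_mat_carrier_square by blast
    ultimately show ?thesis using invertible_mat_iff_inverse_pair[of "S v" "vdim R v"] by auto
  qed
  then obtain T where "\<And>v. v \<in> verts Q \<Longrightarrow> vdim R' v = vdim R v \<and> inverse_pair (vdim R v) (S v) (T v)"
    by metis
  with S(2) show thesis using that by blast
qed

lemma rep_isoI:
  assumes "\<And>v. v \<in> verts Q \<Longrightarrow> vdim R' v = vdim R v \<and> inverse_pair (vdim R v) (S v) (T v)"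
    and "\<And>a. a \<in> arcs Q \<Longrightarrow> amat R' a * S (tail Q a) = S (head Q a) * amat R a"
  shows "rep_iso Q R R'"
  unfolding rep_iso_def
proof (intro exI[of _ S] conjI ballI)
  fix v assume "v \<in> verts Q"
  from assms(1)[OF this] have "vdim R' v = vdim R v" and p: "inverse_pair (vdim R v) (S v) (T v)" by auto
  moreover from p have "S v \<in> carrier_mat (vdim R v) (vdim R v)" by (simp add: inverse_pair_def)
  ultimately show "S v \<in> carrier_mat (vdim R' v) (vdim R v)" "invertible_mat (S v)"
    using invertible_mat_iff_inverse_pair by auto
qed (use assms(2) in blast)

lemma rep_iso_refl: "mat_rep Q R \<Longrightarrow> rep_iso Q R R"
  by (rule rep_isoI[where S = "\<lambda>v. 1\<^sub>m (vdim R v)" and T = "\<lambda>v. 1\<^sub>m (vdim R v)"])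
    (auto simp: inverse_pair_one mat_rep_def)

lemma rep_iso_sym:
  assumes wf: "wf_digraph Q" and R: "mat_rep Q R" and R': "mat_rep Q R'" and iso: "rep_iso Q R R'"
  shows "rep_iso Q R' R"
proof -
  obtain S T where S: "\<And>v. v \<in> verts Q \<Longrightarrow> vdim R' v = vdim R v \<and> inverse_pair (vdim R v) (S v) (T v)"
    and eq: "\<And>a. a \<in> arcs Q \<Longrightarrow> amat R' a * S (tail Q a) = S (head Q a) * amat R a"
    by (rule rep_isoE[OF iso]) blast
  show ?thesis
  proof (rule rep_isoI[where S = T and T = S])
    fix v assume "v \<in> verts Q"
    then show "vdim R v = vdim R' v \<and> inverse_pair (vdim R' v) (T v) (S v)"
      using S inverse_pair_sym by metis
  next
    fix a assume a: "a \<in> arcs Q"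
    let ?u = "tail Q a" and ?w = "head Q a"
    have uw: "?u \<in> verts Q" "?w \<in> verts Q" using a wf by (auto simp: wf_digraph_def)
    let ?m = "vdim R ?u" and ?n = "vdim R ?w"
    have c: "S ?u \<in> carrier_mat ?m ?m" "T ?u \<in> carrier_mat ?m ?m" "S ?u * T ?u = 1\<^sub>m ?m"
      "S ?w \<in> carrier_mat ?n ?n" "T ?w \<in> carrier_mat ?n ?n" "T ?w * S ?w = 1\<^sub>m ?n"
      using S[OF uw(1)] S[OF uw(2)] by (auto simp: inverse_pair_def)
    have A: "amat R a \<in> carrier_mat ?n ?m" using R a by (auto simp: mat_rep_def)
    have A': "amat R' a \<in> carrier_mat ?n ?m" using R' a S[OF uw(1)] S[OF uw(2)] by (auto simp: mat_rep_def)
    have "amat R a * T ?u = (T ?w * S ?w) * (amat R a * T ?u)" using c A by simp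
    also have "\<dots> = T ?w * (S ?w * (amat R a * T ?u))"
      by (rule assoc_mult_mat[of _ ?n ?n _ ?n _ ?m]) (use c A in simp_all)
    also have "S ?w * (amat R a * T ?u) = (S ?w * amat R a) * T ?u"
      by (rule assoc_mult_mat[of _ ?n ?n _ ?m _ ?m, symmetric]) (use c A in simp_all)
    also have "\<dots> = (amat R' a * S ?u) * T ?u" using eq[OF a] by simp
    also have "\<dots> = amat R' a * (S ?u * T ?u)"
      by (rule assoc_mult_mat[of _ ?n ?m _ ?m _ ?m]) (use c A' in simp_all)
    also have "\<dots> = amat R' a" using c A' by simp
    finally show "amat R a * T ?u = T ?w * amat R' a" .
  qed
qed

lemma rep_iso_trans:
  assumes wf: "wf_digraph Q" and R: "mat_rep Q R" and R': "mat_rep Q R'" and R'': "mat_rep Q R''"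
    and iso: "rep_iso Q R R'" "rep_iso Q R' R''"
  shows "rep_iso Q R R''"
proof -
  obtain S T where S: "\<And>v. v \<in> verts Q \<Longrightarrow> vdim R' v = vdim R v \<and> inverse_pair (vdim R v) (S v) (T v)"
    and eq: "\<And>a. a \<in> arcs Q \<Longrightarrow> amat R' a * S (tail Q a) = S (head Q a) * amat R a"
    by (rule rep_isoE[OF iso(1)]) blast
  obtain S' T' where S': "\<And>v. v \<in> verts Q \<Longrightarrow> vdim R'' v = vdim R' v \<and> inverse_pair (vdim R' v) (S' v) (T' v)"
    and eq': "\<And>a. a \<in> arcs Q \<Longrightarrow> amat R'' a * S' (tail Q a) = S' (head Q a) * amat R' a"
    by (rule rep_isoE[OF iso(2)]) blast
  show ?thesis
  proof (rule rep_isoI[where S = "\<lambda>v. S' v * S v" and T = "\<lambda>v. T v * T' v"])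
    fix v assume v: "v \<in> verts Q"
    then show "vdim R'' v = vdim R v \<and> inverse_pair (vdim R v) (S' v * S v) (T v * T' v)"
      using S[OF v] S'[OF v] by (auto intro: inverse_pair_mult)
  next
    fix a assume a: "a \<in> arcs Q"
    let ?u = "tail Q a" and ?w = "head Q a"
    have uw: "?u \<in> verts Q" "?w \<in> verts Q" using a wf by (auto simp: wf_digraph_def)
    let ?m = "vdim R ?u" and ?n = "vdim R ?w"
    have d: "vdim R' ?u = ?m" "vdim R'' ?u = ?m" "vdim R' ?w = ?n" "vdim R'' ?w = ?n"
      using S[OF uw(1)] S[OF uw(2)] S'[OF uw(1)] S'[OF uw(2)] by auto
    have c: "S ?u \<in> carrier_mat ?m ?m" "S' ?u \<in> carrier_mat ?m ?m"
      "S ?w \<in> carrier_mat ?n ?n" "S' ?w \<in> carrier_mat ?n ?n"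
      using S[OF uw(1)] S[OF uw(2)] S'[OF uw(1)] S'[OF uw(2)] by (auto simp: inverse_pair_def)
    have A: "amat R a \<in> carrier_mat ?n ?m" "amat R' a \<in> carrier_mat ?n ?m" "amat R'' a \<in> carrier_mat ?n ?m"
      using R R' R'' a d by (auto simp: mat_rep_def)
    have "amat R'' a * (S' ?u * S ?u) = (amat R'' a * S' ?u) * S ?u"
      by (rule assoc_mult_mat[of _ ?n ?m _ ?m _ ?m, symmetric]) (use c A in simp_all)
    also have "\<dots> = (S' ?w * amat R' a) * S ?u" using eq'[OF a] by simp
    also have "\<dots> = S' ?w * (amat R' a * S ?u)"
      by (rule assoc_mult_mat[of _ ?n ?n _ ?m _ ?m]) (use c A in simp_all)
    also have "\<dots> = S' ?w * (S ?w * amat R a)" using eq[OF a] by simp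
    also have "\<dots> = (S' ?w * S ?w) * amat R a"
      by (rule assoc_mult_mat[of _ ?n ?n _ ?n _ ?m, symmetric]) (use c A in simp_all)
    finally show "amat R'' a * (S' ?u * S ?u) = (S' ?w * S ?w) * amat R a" .
  qed
qed

lemma the_mat_inverse:
  assumes "inverse_pair n S T" shows "the (mat_inverse S) = T"
proof -
  have S: "S \<in> carrier_mat n n" and T: "T \<in> carrier_mat n n" and 1: "S * T = 1\<^sub>m n" "T * S = 1\<^sub>m n"
    using assms by (auto simp: inverse_pair_def)
  have "S \<in> Units (ring_mat TYPE(complex) n ())"
    using S T 1 by (auto simp: Units_def ring_mat_def)
  with mat_inverse(1)[OF S, where b = "()"] obtain T' where T': "mat_inverse S = Some T'"
    by (cases "mat_inverse S") auto
  have c: "S * T' = 1\<^sub>m n" "T' * S = 1\<^sub>m n" "T' \<in> carrier_mat n n" using mat_inverse(2)[OF S T'] by auto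
  have "T' = T' * (S * T)" using 1 c by simp
  also have "\<dots> = (T' * S) * T" by (rule assoc_mult_mat[symmetric]) (use c S T in auto)
  also have "\<dots> = T" using c T by simp
  finally show ?thesis using T' by simp
qed

lemma vertex_transform_vdim [simp]: "vdim (vertex_transform Q v S R) = vdim R"
  by (simp add: vertex_transform_def)

text \<open>
  The isomorphism is \<open>S\<close> at \<open>v\<close> and the identity elsewhere.
\<close>

lemma vertex_transform_rep:
  assumes R: "mat_rep Q R" and S: "inverse_pair (vdim R v) S T"
  shows "mat_rep Q (vertex_transform Q v S R) \<and> rep_iso Q R (vertex_transform Q v S R)"
proof -
  let ?R' = "vertex_transform Q v S R"
  let ?P = "\<lambda>u. if u = v then S else 1\<^sub>m (vdim R u)"
  have c: "S \<in> carrier_mat (vdim R v) (vdim R v)" "T \<in> carrier_mat (vdim R v) (vdim R v)" "T * S = 1\<^sub>m (vdim R v)"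
    using S by (auto simp: inverse_pair_def)
  have *: "amat ?R' a \<in> carrier_mat (vdim R (head Q a)) (vdim R (tail Q a)) \<and>
      amat ?R' a * ?P (tail Q a) = ?P (head Q a) * amat R a" if a: "a \<in> arcs Q" for a
  proof -
    let ?m = "vdim R (tail Q a)" and ?n = "vdim R (head Q a)"
    have A: "amat R a \<in> carrier_mat ?n ?m" using R a by (auto simp: mat_rep_def)
    define B where "B = (if head Q a = v then S * amat R a else amat R a)"
    have B: "B \<in> carrier_mat ?n ?m" "B = ?P (head Q a) * amat R a" using A c by (auto simp: B_def)
    have eq: "amat ?R' a = (if tail Q a = v then B * T else B)"
      by (simp add: vertex_transform_def B_def Let_def the_mat_inverse[OF S])
    show ?thesis
    proof (cases "tail Q a = v")
      case True
      then have "(B * T) * S = B * (T * S)" using c B(1) by (intro assoc_mult_mat) auto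
      then show ?thesis using True B c eq by auto
    next
      case False
      then have "amat ?R' a = B" using eq by simp
      then show ?thesis using False B(1) unfolding B(2)[symmetric] by simp
    qed
  qed
  have "rep_iso Q R ?R'"
    by (rule rep_isoI[where S = ?P and T = "\<lambda>u. if u = v then T else 1\<^sub>m (vdim R u)"])
      (use S * in \<open>auto simp: inverse_pair_one\<close>)
  then show ?thesis using * by (simp add: mat_rep_def)
qed


section \<open>Interval bases\<close>

text \<open>
  A basis of $\<complex>^d$ indexed by \<open>I\<close> together with its dual basis, in coordinates. Carrying the dual
  basis along avoids enumerating \<open>I\<close>, which would be needed to speak of an invertible matrix.
\<close>

definition dual_families ::
  "nat \<Rightarrow> 'k set \<Rightarrow> ('k \<Rightarrow> nat \<Rightarrow> complex) \<Rightarrow> ('k \<Rightarrow> nat \<Rightarrow> complex) \<Rightarrow> bool" where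
  "dual_families d I b f \<longleftrightarrow>
     (\<forall>k\<in>I. \<forall>l\<in>I. (\<Sum>a<d. f k a * b l a) = (if k = l then 1 else 0)) \<and>
     (\<forall>a<d. \<forall>a'<d. (\<Sum>k\<in>I. b k a * f k a') = (if a = a' then 1 else 0))"

text \<open>
  The two numbers are the traces of the products, in both orders, of the matrices formed by \<open>b\<close> and \<open>f\<close>.
\<close>

lemma dual_families_card:
  assumes "finite I" "dual_families d I b f" shows "card I = d"
proof -
  have "complex_of_nat (card I) = (\<Sum>k\<in>I. \<Sum>a<d. f k a * b k a)"
    using assms(2) by (simp add: dual_families_def)
  also have "\<dots> = (\<Sum>a<d. \<Sum>k\<in>I. b k a * f k a)" by (subst sum.swap) (simp add: mult.commute)
  also have "\<dots> = complex_of_nat d" using assms(2) by (simp add: dual_families_def)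
  finally show ?thesis using of_nat_eq_iff by blast
qed

lemma dual_families_of_inverse_pair:
  assumes pos: "bij_betw pos {..<d} I" and inv: "inverse_pair d E F"
  defines "p \<equiv> inv_into {..<d} pos"
  shows "dual_families d I (\<lambda>k a. E $$ (a, p k)) (\<lambda>k a. F $$ (p k, a))"
  unfolding dual_families_def
proof (intro conjI ballI allI impI)
  have p: "bij_betw p I {..<d}" unfolding p_def by (rule bij_betw_inv_into[OF pos])
  {
    fix x y assume xy: "x \<in> I" "y \<in> I"
    then have "p x < d" "p y < d" "p x = p y \<longleftrightarrow> x = y"
      using p by (auto simp: bij_betw_def inj_on_def)
    then show "(\<Sum>a<d. F $$ (p x, a) * E $$ (a, p y)) = (if x = y then 1 else 0)"
      using inverse_pair_sum[OF inverse_pair_sym[OF inv]] by simp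
  next
    fix a a' assume a: "a < d" "a' < d"
    have "(\<Sum>x\<in>I. E $$ (a, p x) * F $$ (p x, a')) = (\<Sum>c<d. E $$ (a, c) * F $$ (c, a'))"
      by (rule sum.reindex_bij_betw[OF p])
    then show "(\<Sum>x\<in>I. E $$ (a, p x) * F $$ (p x, a')) = (if a = a' then 1 else 0)"
      using inverse_pair_sum[OF inv a] by simp
  }
qed

definition alive :: "('k \<Rightarrow> nat \<times> nat) \<Rightarrow> 'k set \<Rightarrow> nat \<Rightarrow> 'k set" where
  "alive lab K v = {k \<in> K. fst (lab k) \<le> v \<and> v \<le> snd (lab k)}"

text \<open>
  The part of the chain on the vertices \<open>1, \<dots>, n\<close> is a direct sum of intervals, one for each
  \<open>k \<in> K\<close>: the vectors \<open>b v k\<close> of the intervals through \<open>v\<close> form a basis at \<open>v\<close> with dual basis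
  \<open>f v k\<close>, and the arrows map \<open>b u k\<close> to \<open>b w k\<close>, or to \<open>0\<close> if \<open>k\<close> does not reach \<open>w\<close>.
\<close>

definition interval_basis ::
  "nat \<Rightarrow> (nat \<Rightarrow> bool) \<Rightarrow> (nat, nat) quiver_rep \<Rightarrow> 'k set \<Rightarrow> ('k \<Rightarrow> nat \<times> nat) \<Rightarrow>
   (nat \<Rightarrow> 'k \<Rightarrow> nat \<Rightarrow> complex) \<Rightarrow> (nat \<Rightarrow> 'k \<Rightarrow> nat \<Rightarrow> complex) \<Rightarrow> bool" where
  "interval_basis n right R K lab b f \<longleftrightarrow>
     finite K \<and> lab ` K \<subseteq> interval_index n \<and>
     (\<forall>v\<in>{1..n}. dual_families (vdim R v) (alive lab K v) (b v) (f v)) \<and>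
     (\<forall>i\<in>{1..<n}. \<forall>k \<in> alive lab K (src right i). \<forall>a < vdim R (tgt right i).
        (\<Sum>a'<vdim R (src right i). amat R i $$ (a, a') * b (src right i) k a') =
        (if k \<in> alive lab K (tgt right i) then b (tgt right i) k a else 0))"

text \<open>
  With strips of width 0 and 1, positions correspond to the strips of width 1. This identifies the
  coordinates of a sum of intervals at a vertex with the intervals through that vertex.
\<close>

lemma strip_of_bij_zero_one:
  assumes "\<And>i. i < length ks \<Longrightarrow> ks ! i \<le> 1"
  shows "bij_betw (strip_of ks) {..<sum_list ks} {i. i < length ks \<and> ks ! i = 1}"
proof (rule bij_betw_imageI)
  have *: "c = off ks (strip_of ks c) \<and> strip_of ks c < length ks \<and> ks ! strip_of ks c = 1"
    if c: "c < sum_list ks" for c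
  proof -
    obtain i a where i: "i < length ks" "a < ks ! i" "c = off ks i + a" "strip_of ks c = i"
      using strip_cases[OF c] .
    with assms[OF i(1)] show ?thesis by simp
  qed
  show "inj_on (strip_of ks) {..<sum_list ks}"
    by (rule inj_onI) (metis * lessThan_iff)
  show "strip_of ks ` {..<sum_list ks} = {i. i < length ks \<and> ks ! i = 1}"
  proof (intro equalityI subsetI)
    fix i assume i: "i \<in> {i. i < length ks \<and> ks ! i = 1}"
    then have "strip_of ks (off ks i + 0) = i" "off ks i + 0 < sum_list ks"
      by (intro strip_of_off off_add_less_sum; simp)+
    then show "i \<in> strip_of ks ` {..<sum_list ks}" by (metis image_eqI lessThan_iff)
  qed (use * in auto)
qed

definition interval_dims :: "(nat \<times> nat) list \<Rightarrow> nat \<Rightarrow> nat list" where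
  "interval_dims xs v = map (\<lambda>x. if fst x \<le> v \<and> v \<le> snd x then 1 else 0) xs"

lemma vdim_interval_sum: "vdim (interval_sum t right xs) v = sum_list (interval_dims xs v)"
  unfolding interval_sum_def direct_sum_def interval_dims_def interval_rep_def
  by (simp add: comp_def case_prod_beta Let_def)

lemma interval_dims_bij:
  "bij_betw (strip_of (interval_dims xs v)) {..<vdim (interval_sum t right xs) v}
     (alive ((!) xs) {..<length xs} v)"
proof -
  have "{i. i < length (interval_dims xs v) \<and> interval_dims xs v ! i = 1} = alive ((!) xs) {..<length xs} v"
    by (auto simp: interval_dims_def alive_def split: if_splits)
  then show ?thesis
    using strip_of_bij_zero_one[of "interval_dims xs v"] unfolding vdim_interval_sum
    by (simp add: interval_dims_def)
qed

text \<open>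
  In terms of intervals instead of positions, an arrow acts on a sum of intervals as the partial
  identity.
\<close>

lemma interval_sum_mat:
  assumes "A = amat (interval_sum t right xs) i"
  shows "A \<in> carrier_mat (vdim (interval_sum t right xs) (tgt right i)) (vdim (interval_sum t right xs) (src right i))"
    and "a < vdim (interval_sum t right xs) (tgt right i) \<Longrightarrow> c < vdim (interval_sum t right xs) (src right i) \<Longrightarrow>
      A $$ (a, c) = (if strip_of (interval_dims xs (tgt right i)) a = strip_of (interval_dims xs (src right i)) c
        then 1 else 0)"
proof -
  let ?u = "src right i" and ?w = "tgt right i"
  define Bs where "Bs = map (\<lambda>x. amat (interval_rep t right x) i) xs"
  have A: "A = diag_block_mat Bs"
    unfolding assms interval_sum_def direct_sum_def Bs_def by (simp add: comp_def)
  have block: "amat (interval_rep t right x) i =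
      (if fst x \<le> i \<and> i < snd x then 1\<^sub>m 1
       else 0\<^sub>m (if fst x \<le> ?w \<and> ?w \<le> snd x then 1 else 0) (if fst x \<le> ?u \<and> ?u \<le> snd x then 1 else 0))" for x
    by (simp add: interval_rep_def case_prod_beta Let_def)
  have rows: "map dim_row Bs = interval_dims xs ?w" and cols: "map dim_col Bs = interval_dims xs ?u"
    by (auto simp: Bs_def interval_dims_def block)
  show "A \<in> carrier_mat (vdim (interval_sum t right xs) ?w) (vdim (interval_sum t right xs) ?u)"
    unfolding A vdim_interval_sum using rows cols by (intro carrier_matI) (simp_all add: dim_diag_block_mat)
  assume a: "a < vdim (interval_sum t right xs) ?w" and c: "c < vdim (interval_sum t right xs) ?u"
  let ?k = "strip_of (interval_dims xs ?w) a"
  show "A $$ (a, c) = (if ?k = strip_of (interval_dims xs ?u) c then 1 else 0)"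
  proof (cases "?k = strip_of (interval_dims xs ?u) c")
    case True
    obtain i1 a1 where k: "i1 < length (interval_dims xs ?w)" "a1 < interval_dims xs ?w ! i1"
        "a = off (interval_dims xs ?w) i1 + a1" "?k = i1"
      using strip_cases[OF a[unfolded vdim_interval_sum]] .
    obtain i2 a2 where l: "i2 < length (interval_dims xs ?u)" "a2 < interval_dims xs ?u ! i2"
        "c = off (interval_dims xs ?u) i2 + a2" "strip_of (interval_dims xs ?u) c = i2"
      using strip_cases[OF c[unfolded vdim_interval_sum]] .
    have len: "i1 < length xs" using k by (simp add: interval_dims_def)
    have i: "i2 = i1" using True k l by simp
    have 0: "a1 = 0" "a2 = 0" "fst (xs ! i1) \<le> ?w" "?w \<le> snd (xs ! i1)" "fst (xs ! i1) \<le> ?u" "?u \<le> snd (xs ! i1)"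
      using k(2) l(2) len unfolding i by (auto simp: interval_dims_def split: if_splits)
    have "A $$ (a, c) = Bs ! i1 $$ (a - off (interval_dims xs ?w) i1, c - off (interval_dims xs ?u) i1)"
      unfolding A using a c True k(4)
      by (subst diag_block_mat_entry) (simp_all add: rows cols vdim_interval_sum Let_def)
    also have "\<dots> = Bs ! i1 $$ (0, 0)" using k(3) l(3) 0 i by simp
    also have "\<dots> = 1" using len 0 by (simp add: Bs_def block split: if_splits)
    finally show ?thesis using True by simp
  next
    case False
    then show ?thesis unfolding A using a c
      by (subst diag_block_mat_entry) (simp_all add: rows cols vdim_interval_sum Let_def)
  qed
qed

lemma mat_rep_interval_sum: "mat_rep (chain t right) (interval_sum t right xs)"
  unfolding mat_rep_def using interval_sum_mat(1) by simp

text \<open>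
  The basis vectors at each vertex are the columns of the isomorphism.
\<close>

lemma rep_iso_if_interval_basis:
  assumes R: "mat_rep (chain t right) R"
    and basis: "interval_basis t right R {..<length xs} ((!) xs) b f"
  shows "rep_iso (chain t right) (interval_sum t right xs) R"
proof -
  let ?N = "interval_sum t right xs" and ?K = "{..<length xs}"
  let ?k = "\<lambda>v. strip_of (interval_dims xs v)" and ?I = "alive ((!) xs) {..<length xs}"
  define S where "S v = mat (vdim R v) (vdim R v) (\<lambda>(a, c). b v (?k v c) a)" for v
  define T where "T v = mat (vdim R v) (vdim R v) (\<lambda>(c, a). f v (?k v c) a)" for v
  have dual: "dual_families (vdim R v) (?I v) (b v) (f v)" if "v \<in> {1..t}" for v
    using basis that by (simp add: interval_basis_def)
  have dim: "vdim ?N v = vdim R v" if v: "v \<in> {1..t}" for v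
    using dual_families_card[OF _ dual[OF v]] bij_betw_same_card[OF interval_dims_bij[of xs v t right]]
    by (simp add: alive_def)
  have k: "bij_betw (?k v) {..<vdim R v} (?I v)" if v: "v \<in> {1..t}" for v
    using interval_dims_bij[of xs v t right] dim[OF v] by simp
  show ?thesis
  proof (rule rep_isoI[where S = S and T = T])
    fix v assume "v \<in> verts (chain t right)"
    then have v: "v \<in> {1..t}" by simp
    have c: "S v \<in> carrier_mat (vdim R v) (vdim R v)" "T v \<in> carrier_mat (vdim R v) (vdim R v)"
      by (simp_all add: S_def T_def)
    have "S v * T v = 1\<^sub>m (vdim R v)"
    proof (rule eq_matI)
      fix a a' assume "a < dim_row (1\<^sub>m (vdim R v))" "a' < dim_col (1\<^sub>m (vdim R v))"
      then have a: "a < vdim R v" "a' < vdim R v" by auto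
      have "(S v * T v) $$ (a, a') = (\<Sum>c<vdim R v. b v (?k v c) a * f v (?k v c) a')"
        unfolding mult_mat_entry[OF c a] using a by (simp add: S_def T_def)
      also have "\<dots> = (\<Sum>k\<in>?I v. b v k a * f v k a')"
        by (rule sum.reindex_bij_betw[OF k[OF v]])
      also have "\<dots> = 1\<^sub>m (vdim R v) $$ (a, a')" using dual[OF v] a by (simp add: dual_families_def)
      finally show "(S v * T v) $$ (a, a') = 1\<^sub>m (vdim R v) $$ (a, a')" .
    qed (simp_all add: S_def T_def)
    then have "inverse_pair (vdim R v) (S v) (T v)" by (rule inverse_pairI[OF c])
    then show "vdim R v = vdim ?N v \<and> inverse_pair (vdim ?N v) (S v) (T v)" using dim[OF v] by simp
  next
    fix i assume i: "i \<in> arcs (chain t right)"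
    let ?u = "src right i" and ?w = "tgt right i"
    have uw: "?u \<in> {1..t}" "?w \<in> {1..t}" using i by auto
    have A: "amat R i \<in> carrier_mat (vdim R ?w) (vdim R ?u)" using R i by (auto simp: mat_rep_def)
    have N: "amat ?N i \<in> carrier_mat (vdim R ?w) (vdim R ?u)"
      using interval_sum_mat(1)[OF refl, of t right xs i] dim[OF uw(1)] dim[OF uw(2)] by simp
    have S: "S v \<in> carrier_mat (vdim R v) (vdim R v)" for v by (simp add: S_def)
    have "amat R i * S ?u = S ?w * amat ?N i"
    proof (rule eq_matI)
      fix a c assume "a < dim_row (S ?w * amat ?N i)" "c < dim_col (S ?w * amat ?N i)"
      then have a: "a < vdim R ?w" and c: "c < vdim R ?u" using N S[of ?w] by auto
      have kc: "?k ?u c \<in> ?I ?u" using k[OF uw(1)] c by (auto simp: bij_betw_def)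
      have "(amat R i * S ?u) $$ (a, c) = (\<Sum>a'<vdim R ?u. amat R i $$ (a, a') * b ?u (?k ?u c) a')"
        unfolding mult_mat_entry[OF A S a c] using c by (simp add: S_def)
      also have "\<dots> = (if ?k ?u c \<in> ?I ?w then b ?w (?k ?u c) a else 0)"
        using basis i kc a by (simp add: interval_basis_def)
      also have "\<dots> = (\<Sum>k\<in>?I ?w. if k = ?k ?u c then b ?w k a else 0)"
        by (simp add: alive_def)
      also have "\<dots> = (\<Sum>c'<vdim R ?w. if ?k ?w c' = ?k ?u c then b ?w (?k ?w c') a else 0)"
        by (rule sum.reindex_bij_betw[OF k[OF uw(2)], symmetric])
      also have "\<dots> = (\<Sum>c'<vdim R ?w. S ?w $$ (a, c') * amat ?N i $$ (c', c))"
      proof (rule sum.cong)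
        fix c' assume c': "c' \<in> {..<vdim R ?w}"
        then have "amat ?N i $$ (c', c) = (if ?k ?w c' = ?k ?u c then 1 else 0)"
          using c dim[OF uw(1)] dim[OF uw(2)] by (intro interval_sum_mat(2)[OF refl]) auto
        then show "(if ?k ?w c' = ?k ?u c then b ?w (?k ?w c') a else 0) = S ?w $$ (a, c') * amat ?N i $$ (c', c)"
          using a c' by (simp add: S_def)
      qed simp
      also have "\<dots> = (S ?w * amat ?N i) $$ (a, c)" by (rule mult_mat_entry[OF S N a c, symmetric])
      finally show "(amat R i * S ?u) $$ (a, c) = (S ?w * amat ?N i) $$ (a, c)" .
    qed (use A N S[of ?u] S[of ?w] in auto)
    then show "amat R i * S (tail (chain t right) i) = S (head (chain t right) i) * amat ?N i"
      unfolding chain_simps .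
  qed
qed

text \<open>
  The basis is the image of the standard basis; its dual is read off from the inverse.
\<close>

lemma interval_basis_if_rep_iso:
  assumes R: "mat_rep (chain t right) R" and xs: "set xs \<subseteq> interval_index t"
    and iso: "rep_iso (chain t right) (interval_sum t right xs) R"
  shows "\<exists>b f. interval_basis t right R {..<length xs} ((!) xs) b f"
proof -
  let ?N = "interval_sum t right xs" and ?K = "{..<length xs}"
  let ?k = "\<lambda>v. strip_of (interval_dims xs v)" and ?I = "alive ((!) xs) {..<length xs}"
  obtain S T where S: "\<And>v. v \<in> verts (chain t right) \<Longrightarrow> vdim R v = vdim ?N v \<and> inverse_pair (vdim ?N v) (S v) (T v)"
    and eq: "\<And>a. a \<in> arcs (chain t right) \<Longrightarrow>
      amat R a * S (tail (chain t right) a) = S (head (chain t right) a) * amat ?N a"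
    by (rule rep_isoE[OF iso]) blast
  define p where "p v = inv_into {..<vdim ?N v} (?k v)" for v
  have k: "bij_betw (?k v) {..<vdim ?N v} (?I v)" for v
    by (rule interval_dims_bij)
  have p: "bij_betw (p v) (?I v) {..<vdim ?N v}" for v
    unfolding p_def by (rule bij_betw_inv_into[OF k])
  have kp: "?k v (p v x) = x" if "x \<in> ?I v" for v x
    unfolding p_def using k that by (metis bij_betw_inv_into_right)
  have p_less: "p v x < vdim ?N v" if "x \<in> ?I v" for v x
    using p that by (auto simp: bij_betw_def)
  define b where "b v x a = S v $$ (a, p v x)" for v x a
  define f where "f v x a = T v $$ (p v x, a)" for v x a
  have "dual_families (vdim R v) (?I v) (b v) (f v)" if v: "v \<in> {1..t}" for v
  proof -
    have inv: "inverse_pair (vdim ?N v) (S v) (T v)" and d: "vdim R v = vdim ?N v" using S v by auto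
    show ?thesis unfolding b_def f_def p_def d by (rule dual_families_of_inverse_pair[OF k inv])
  qed
  moreover have "(\<Sum>a'<vdim R (src right i). amat R i $$ (a, a') * b (src right i) x a') =
        (if x \<in> ?I (tgt right i) then b (tgt right i) x a else 0)"
    if i: "i \<in> {1..<t}" and x: "x \<in> ?I (src right i)" and a: "a < vdim R (tgt right i)" for i x a
  proof -
    let ?u = "src right i" and ?w = "tgt right i"
    have uw: "?u \<in> {1..t}" "?w \<in> {1..t}" using i by auto
    have d: "vdim R ?u = vdim ?N ?u" "vdim R ?w = vdim ?N ?w" using S uw by (metis chain_simps(1))+
    have c: "S ?u \<in> carrier_mat (vdim R ?u) (vdim R ?u)" "S ?w \<in> carrier_mat (vdim R ?w) (vdim R ?w)"
      using S[of ?u] S[of ?w] uw by (auto simp: inverse_pair_def)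
    have A: "amat R i \<in> carrier_mat (vdim R ?w) (vdim R ?u)" using R i by (auto simp: mat_rep_def)
    have N: "amat ?N i \<in> carrier_mat (vdim R ?w) (vdim R ?u)"
      using interval_sum_mat(1)[OF refl, of t right xs i] d by simp
    have px: "p ?u x < vdim R ?u" using p_less[OF x] d by simp
    have "(\<Sum>a'<vdim R ?u. amat R i $$ (a, a') * b ?u x a') = (amat R i * S ?u) $$ (a, p ?u x)"
      unfolding b_def by (rule mult_mat_entry[OF A c(1) a px, symmetric])
    also have "amat R i * S ?u = S ?w * amat ?N i" using eq[of i] i by simp
    also have "(S ?w * amat ?N i) $$ (a, p ?u x) = (\<Sum>c'<vdim R ?w. S ?w $$ (a, c') * amat ?N i $$ (c', p ?u x))"
      by (rule mult_mat_entry[OF c(2) N a px])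
    also have "\<dots> = (\<Sum>c'<vdim ?N ?w. S ?w $$ (a, c') * (if ?k ?w c' = x then 1 else 0))"
      unfolding d
    proof (rule sum.cong)
      fix c' assume "c' \<in> {..<vdim ?N ?w}"
      then have "amat ?N i $$ (c', p ?u x) = (if ?k ?w c' = ?k ?u (p ?u x) then 1 else 0)"
        using px d by (intro interval_sum_mat(2)[OF refl]) auto
      then show "S ?w $$ (a, c') * amat ?N i $$ (c', p ?u x) = S ?w $$ (a, c') * (if ?k ?w c' = x then 1 else 0)"
        unfolding kp[OF x] by simp
    qed simp
    also have "\<dots> = (\<Sum>y\<in>?I ?w. S ?w $$ (a, p ?w y) * (if ?k ?w (p ?w y) = x then 1 else 0))"
      by (rule sum.reindex_bij_betw[OF p, symmetric])
    also have "\<dots> = (\<Sum>y\<in>?I ?w. if y = x then b ?w y a else 0)"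
      by (rule sum.cong) (auto simp: kp b_def)
    also have "\<dots> = (if x \<in> ?I ?w then b ?w x a else 0)" by (simp add: alive_def)
    finally show ?thesis .
  qed
  moreover have "(!) xs ` {..<length xs} \<subseteq> interval_index t" using xs by (auto simp: set_conv_nth)
  ultimately have "interval_basis t right R {..<length xs} ((!) xs) b f"
    unfolding interval_basis_def by simp
  then show ?thesis by blast
qed

lemma enumerate_labels:
  assumes "finite K" "mset xs = image_mset lab (mset_set K)"
  shows "\<exists>zs. distinct zs \<and> set zs = K \<and> map lab zs = xs"
  using assms
proof (induction xs arbitrary: K)
  case Nil
  then show ?case by (simp add: mset_set_empty_iff)
next
  case (Cons x xs)
  have "x \<in># image_mset lab (mset_set K)" by (simp flip: Cons.prems(2))
  then obtain k where k: "k \<in> K" "lab k = x" using Cons.prems(1) by auto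
  have "mset_set K = add_mset k (mset_set (K - {k}))"
    using k(1) Cons.prems(1) by (simp add: mset_set.remove)
  then have "mset xs = image_mset lab (mset_set (K - {k}))"
    using Cons.prems(2) k(2) by simp
  then obtain zs where "distinct zs" "set zs = K - {k}" "map lab zs = xs"
    using Cons.IH[of "K - {k}"] Cons.prems(1) by auto
  then show ?case using k by (intro exI[of _ "k # zs"]) auto
qed

lemma interval_basis_reindex:
  assumes bij: "bij_betw p I K" and basis: "interval_basis n right R K lab b f"
    and lab': "\<And>i. i \<in> I \<Longrightarrow> lab' i = lab (p i)"
  shows "interval_basis n right R I lab' (\<lambda>v i. b v (p i)) (\<lambda>v i. f v (p i))"
proof -
  have al: "i \<in> alive lab' I v \<longleftrightarrow> i \<in> I \<and> p i \<in> alive lab K v" for i v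
    using bij lab' by (auto simp: alive_def bij_betw_def)
  have bij': "bij_betw p (alive lab' I v) (alive lab K v)" for v
    using bij by (rule bij_betw_subset) (use bij lab' in \<open>auto simp: alive_def bij_betw_def image_iff\<close>)
  have "dual_families d (alive lab' I v) (\<lambda>i. b v (p i)) (\<lambda>i. f v (p i))"
    if "dual_families d (alive lab K v) (b v) (f v)" for d v
    unfolding dual_families_def
  proof (intro conjI ballI allI impI)
    fix k l assume "k \<in> alive lab' I v" "l \<in> alive lab' I v"
    moreover from this have "p k = p l \<longleftrightarrow> k = l"
      using bij al by (auto simp: bij_betw_def inj_on_def)
    ultimately show "(\<Sum>a<d. f v (p k) a * b v (p l) a) = (if k = l then 1 else 0)"
      using that al by (simp add: dual_families_def)
  next
    fix a a' assume "a < d" "a' < d"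
    then show "(\<Sum>k\<in>alive lab' I v. b v (p k) a * f v (p k) a') = (if a = a' then 1 else 0)"
      using that sum.reindex_bij_betw[OF bij', of "\<lambda>k. b v k a * f v k a'" v]
      by (simp add: dual_families_def)
  qed
  moreover have "finite I" using bij basis bij_betw_finite by (auto simp: interval_basis_def)
  moreover have "lab' ` I \<subseteq> interval_index n"
    using basis bij lab' by (auto simp: interval_basis_def bij_betw_def)
  ultimately show ?thesis using basis unfolding interval_basis_def by (simp add: al)
qed

text \<open>
  The basis \<open>E\<close> at the vertex \<open>n\<close> is part of an interval basis on the vertices \<open>1, \<dots>, n\<close>. There the
  columns of \<open>E\<close> belong to the intervals through \<open>n\<close>, with the starts recorded in \<open>L\<close>, and \<open>P\<close>
  consists of the intervals that end earlier. Intervals are indexed by the vertex of their birth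
  and a number, so that fresh indices are at hand at each vertex.
\<close>

definition extends_basis ::
  "nat \<Rightarrow> (nat \<Rightarrow> bool) \<Rightarrow> (nat, nat) quiver_rep \<Rightarrow> (nat \<times> nat) list \<Rightarrow> (nat \<times> nat) multiset \<Rightarrow>
   complex mat \<Rightarrow> bool" where
  "extends_basis n right R L P E \<longleftrightarrow>
     (\<exists>(K :: (nat \<times> nat) set) lab b f pos.
        K \<subseteq> {..n} \<times> UNIV \<and> interval_basis n right R K lab b f \<and>
        bij_betw pos {..<vdim R n} (alive lab K n) \<and>
        (\<forall>c<vdim R n. lab (pos c) = (fst (L ! strip_of (map snd L) c), n)) \<and>
        (\<forall>c<vdim R n. \<forall>a<vdim R n. b n (pos c) a = E $$ (a, c)) \<and>
        image_mset lab (mset_set (K - alive lab K n)) = P)"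

section \<open>The invariant of a run\<close>

text \<open>
  The flag is given by the strips of \<open>L\<close>. Admitting all bases adapted to it, instead of asking for one
  that extends, is what makes this property inductive.
\<close>

definition extends_flags ::
  "nat \<Rightarrow> (nat \<Rightarrow> bool) \<Rightarrow> (nat, nat) quiver_rep \<Rightarrow> (nat \<times> nat) list \<Rightarrow> (nat \<times> nat) multiset \<Rightarrow> bool" where
  "extends_flags n right R L P \<longleftrightarrow>
     sum_list (map snd L) = vdim R n \<and>
     (\<forall>E F. inverse_pair (vdim R n) E F \<and> block_upper (vdim R n) (strip_of (map snd L)) E \<longrightarrow>
       extends_basis n right R L P E)"

text \<open>
  In terms of the bases \<open>E\<close> at the old and \<open>E'\<close> at the new end of an arrow, the arrow identifies the
  vector \<open>j \<in> D\<close> at the new end with the vector \<open>s j\<close> at the old end, and it maps the unmatched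
  vectors at its source to \<open>0\<close>.
\<close>

definition arrow_matches ::
  "bool \<Rightarrow> complex mat \<Rightarrow> nat \<Rightarrow> nat \<Rightarrow> nat set \<Rightarrow> (nat \<Rightarrow> nat) \<Rightarrow> complex mat \<Rightarrow> complex mat \<Rightarrow> bool" where
  "arrow_matches to_right M d d' D s E E' \<longleftrightarrow>
     (if to_right
      then (\<forall>a<d'. \<forall>j\<in>D. (M * E) $$ (a, s j) = E' $$ (a, j)) \<and>
           (\<forall>a<d'. \<forall>c<d. c \<notin> s ` D \<longrightarrow> (M * E) $$ (a, c) = 0)
      else (\<forall>a<d. \<forall>j\<in>D. (M * E') $$ (a, j) = E $$ (a, s j)) \<and>
           (\<forall>a<d. \<forall>j<d'. j \<notin> D \<longrightarrow> (M * E') $$ (a, j) = 0))"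

lemma extends_flags_start: "extends_flags 1 right R [(1, vdim R 1)] {#}"
proof -
  let ?d = "vdim R 1"
  have "extends_basis 1 right R [(1, ?d)] {#} E"
    if inv: "inverse_pair ?d E F" for E F
  proof -
    define K :: "(nat \<times> nat) set" where "K = {1} \<times> {..<?d}"
    define pos :: "nat \<Rightarrow> nat \<times> nat" where "pos c = (1, c)" for c
    define lab :: "nat \<times> nat \<Rightarrow> nat \<times> nat" where "lab k = (1, 1)" for k
    let ?p = "inv_into {..<?d} pos"
    have al: "alive lab K 1 = K" by (auto simp: alive_def lab_def)
    have pos: "bij_betw pos {..<?d} K" by (auto simp: bij_betw_def inj_on_def pos_def K_def)
    have "interval_basis 1 right R K lab (\<lambda>v k a. E $$ (a, ?p k)) (\<lambda>v k a. F $$ (?p k, a))"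
      unfolding interval_basis_def
      using dual_families_of_inverse_pair[OF pos inv] al
      by (auto simp: K_def lab_def interval_index_def)
    moreover have "?p (pos c) = c" if "c < ?d" for c
      using pos that by (auto simp: bij_betw_def)
    moreover have "lab (pos c) = (fst ([(1, ?d)] ! strip_of (map snd [(1, ?d)]) c), 1)" if "c < ?d" for c
      using that by (simp add: lab_def)
    ultimately show ?thesis unfolding extends_basis_def using pos al
      by (intro exI[of _ K] exI[of _ lab] exI[of _ "\<lambda>v k a. E $$ (a, ?p k)"]
          exI[of _ "\<lambda>v k a. F $$ (?p k, a)"] exI[of _ pos]) (auto simp: K_def)
  qed
  then show ?thesis unfolding extends_flags_def by auto
qed

text \<open>
  The common part of both directions of the arrow. The set \<open>D\<close> contains the new basis vectors that
  continue an old one, and \<open>s\<close> says which; \<open>lift\<close> provides an adapted basis at \<open>n\<close> that the arrow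
  matches with a prescribed one at \<open>n + 1\<close>. The old intervals through \<open>n\<close> that are not continued
  end at \<open>n\<close> and are added to \<open>P\<close>.
\<close>

lemma extends_flags_step:
  assumes n: "1 \<le> n"
    and ext: "extends_flags n right R L P"
    and dim: "vdim R' = vdim R" and same: "\<And>i. 1 \<le> i \<Longrightarrow> i < n \<Longrightarrow> amat R' i = amat R i"
    and M: "amat R' n \<in> carrier_mat (vdim R (tgt right n)) (vdim R (src right n))"
    and L': "sum_list (map snd L') = vdim R (Suc n)"
    and D: "D \<subseteq> {..<vdim R (Suc n)}" and s_inj: "inj_on s D" and s_less: "\<And>j. j \<in> D \<Longrightarrow> s j < vdim R n"
    and old: "\<And>j. j \<in> D \<Longrightarrow>
      fst (L' ! strip_of (map snd L') j) = fst (L ! strip_of (map snd L) (s j))"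
    and new: "\<And>j. j < vdim R (Suc n) \<Longrightarrow> j \<notin> D \<Longrightarrow> fst (L' ! strip_of (map snd L') j) = Suc n"
    and lift: "\<And>E' F'. inverse_pair (vdim R (Suc n)) E' F' \<Longrightarrow>
       block_upper (vdim R (Suc n)) (strip_of (map snd L')) E' \<Longrightarrow>
       \<exists>E F. inverse_pair (vdim R n) E F \<and> block_upper (vdim R n) (strip_of (map snd L)) E \<and>
         arrow_matches (right n) (amat R' n) (vdim R n) (vdim R (Suc n)) D s E E'"
    and P': "P' = P + image_mset (\<lambda>c. (fst (L ! strip_of (map snd L) c), n)) (mset_set ({..<vdim R n} - s ` D))"
  shows "extends_flags (Suc n) right R' L' P'"
proof -
  let ?d = "vdim R n" and ?d' = "vdim R (Suc n)"
  have "extends_basis (Suc n) right R' L' P' E'"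
    if inv': "inverse_pair ?d' E' F'" and up': "block_upper ?d' (strip_of (map snd L')) E'" for E' F'
  proof -
    obtain E F where inv: "inverse_pair ?d E F" and up: "block_upper ?d (strip_of (map snd L)) E"
      and "arrow_matches (right n) (amat R' n) ?d ?d' D s E E'"
      using lift[OF inv' up'] by blast
    note rel = this(3)[unfolded arrow_matches_def]
    have E: "E \<in> carrier_mat ?d ?d" and E': "E' \<in> carrier_mat ?d' ?d'"
      using inv inv' by (auto simp: inverse_pair_def)
    obtain K :: "(nat \<times> nat) set" and lab b f pos where K: "K \<subseteq> {..n} \<times> UNIV"
      and basis: "interval_basis n right R K lab b f"
      and pos: "bij_betw pos {..<?d} (alive lab K n)"
      and lab: "\<And>c. c < ?d \<Longrightarrow> lab (pos c) = (fst (L ! strip_of (map snd L) c), n)"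
      and b: "\<And>c a. c < ?d \<Longrightarrow> a < ?d \<Longrightarrow> b n (pos c) a = E $$ (a, c)"
      and P: "image_mset lab (mset_set (K - alive lab K n)) = P"
      using ext inv up unfolding extends_flags_def extends_basis_def by metis
    have fin: "finite K" and idx: "\<And>k. k \<in> K \<Longrightarrow> 1 \<le> fst (lab k) \<and> fst (lab k) \<le> snd (lab k) \<and> snd (lab k) \<le> n"
      using basis by (auto simp: interval_basis_def interval_index_def)
    have pos_inj: "pos c = pos c' \<longleftrightarrow> c = c'" if "c < ?d" "c' < ?d" for c c'
      using pos that by (auto simp: bij_betw_def inj_on_def)
    have al_n: "alive lab K n = pos ` {..<?d}" using pos by (simp add: bij_betw_def)
    have pos_K: "pos c \<in> K" if "c < ?d" for c using al_n that by (auto simp: alive_def)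
    have fresh: "(Suc n, j) \<notin> K" for j using K by auto
    \<comment> \<open>\<open>S\<close> contains the continued intervals and \<open>N\<close> the intervals that start at the new vertex.\<close>
    define S where "S = pos ` s ` D"
    define N where "N = {Suc n} \<times> ({..<?d'} - D)"
    have SK: "S \<subseteq> K" using s_less pos_K by (auto simp: S_def)
    have KN: "K \<inter> N = {}" using fresh by (auto simp: N_def)
    define K' where "K' = K \<union> N"
    define lab' where "lab' k = (if k \<in> S then (fst (lab k), Suc n) else if k \<in> K then lab k
      else (Suc n, Suc n))" for k
    define pos' where "pos' j = (if j \<in> D then pos (s j) else (Suc n, j))" for j
    let ?p = "inv_into {..<?d'} pos'"
    define b' where "b' v k a = (if v = Suc n then E' $$ (a, ?p k) else b v k a)" for v k a
    define f' where "f' v k a = (if v = Suc n then F' $$ (?p k, a) else f v k a)" for v k a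
    have snd_S: "snd (lab k) = n" if "k \<in> S" for k using that lab s_less by (auto simp: S_def)
    have al_old: "alive lab' K' v = alive lab K v" if "v \<le> n" for v
    proof (intro equalityI subsetI)
      fix k assume "k \<in> alive lab' K' v"
      then show "k \<in> alive lab K v"
        using that snd_S[of k] SK by (auto simp: alive_def lab'_def K'_def split: if_splits)
    next
      fix k assume "k \<in> alive lab K v"
      then show "k \<in> alive lab' K' v"
        using that snd_S[of k] by (auto simp: alive_def lab'_def K'_def)
    qed
    have al_set: "alive lab' K' (Suc n) = S \<union> N"
    proof (intro equalityI subsetI)
      fix k assume "k \<in> alive lab' K' (Suc n)"
      then show "k \<in> S \<union> N"
        using idx[of k] by (auto simp: alive_def lab'_def K'_def split: if_splits)
    next
      fix k assume k: "k \<in> S \<union> N"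
      show "k \<in> alive lab' K' (Suc n)"
      proof (cases "k \<in> S")
        case True
        then have "k \<in> K" using SK by blast
        then show ?thesis using idx[of k] True by (simp add: alive_def lab'_def K'_def)
      next
        case False
        then have "k \<in> N" "k \<notin> K" using k KN by auto
        then show ?thesis using False by (simp add: alive_def lab'_def K'_def)
      qed
    qed
    have pos'_inj: "inj_on pos' {..<?d'}"
    proof (rule inj_onI)
      fix j j' assume "j \<in> {..<?d'}" "j' \<in> {..<?d'}" and eq: "pos' j = pos' j'"
      show "j = j'"
      proof (cases "j \<in> D"; cases "j' \<in> D")
        assume "j \<in> D" "j' \<in> D"
        then have "s j = s j'" using eq pos_inj s_less by (simp add: pos'_def)
        then show ?thesis using \<open>j \<in> D\<close> \<open>j' \<in> D\<close> s_inj by (simp add: inj_on_eq_iff)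
      next
        assume "j \<in> D" "j' \<notin> D"
        then show ?thesis using eq fresh[of j'] pos_K[OF s_less[of j]] by (simp add: pos'_def)
      next
        assume "j \<notin> D" "j' \<in> D"
        then show ?thesis using eq fresh[of j] pos_K[OF s_less[of j']] by (simp add: pos'_def)
      next
        assume "j \<notin> D" "j' \<notin> D"
        then show ?thesis using eq by (simp add: pos'_def)
      qed
    qed
    have pos'_image: "pos' ` {..<?d'} = S \<union> N"
      using D by (force simp: pos'_def S_def N_def)
    have pos': "bij_betw pos' {..<?d'} (alive lab' K' (Suc n))"
      unfolding bij_betw_def al_set using pos'_inj pos'_image by blast
    have p: "?p (pos' j) = j" if "j < ?d'" for j
      using inv_into_f_f[OF pos'_inj] that by simp
    have b'_pos: "b' (Suc n) (pos' j) a = E' $$ (a, j)" if "j < ?d'" for j a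
      using p[OF that] by (simp add: b'_def)
    have dual: "dual_families (vdim R' v) (alive lab' K' v) (b' v) (f' v)" if v: "v \<in> {1..Suc n}" for v
    proof (cases "v = Suc n")
      case True
      moreover have "b' (Suc n) = (\<lambda>k a. E' $$ (a, ?p k))" "f' (Suc n) = (\<lambda>k a. F' $$ (?p k, a))"
        by (auto simp: b'_def f'_def fun_eq_iff)
      ultimately show ?thesis using dual_families_of_inverse_pair[OF pos' inv'] dim by simp
    next
      case False
      then have "v \<in> {1..n}" using v by auto
      moreover have "b' v = b v" "f' v = f v" using False by (auto simp: b'_def f'_def fun_eq_iff)
      ultimately show ?thesis using basis dim al_old[of v] by (simp add: interval_basis_def)
    qed
    have arrow: "(\<Sum>a'<vdim R' (src right i). amat R' i $$ (a, a') * b' (src right i) k a') =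
        (if k \<in> alive lab' K' (tgt right i) then b' (tgt right i) k a else 0)"
      if i: "i \<in> {1..<Suc n}" and k: "k \<in> alive lab' K' (src right i)" and a: "a < vdim R' (tgt right i)"
      for i k a
    proof (cases "i = n")
      case False
      then have i': "i \<in> {1..<n}" "src right i \<le> n" "tgt right i \<le> n" using i by auto
      then have "b' (src right i) = b (src right i)" "b' (tgt right i) = b (tgt right i)"
        by (auto simp: b'_def fun_eq_iff)
      then show ?thesis using basis i' k a dim same[of i] al_old[OF i'(2)] al_old[OF i'(3)]
        by (simp add: interval_basis_def)
    next
      case i: True
      have b'_n: "b' n = b n" by (auto simp: b'_def fun_eq_iff)
      show ?thesis
      proof (cases "right n")
        case True
        then have a: "a < ?d'" and k: "k \<in> alive lab K n" using a k i dim al_old[of n] by auto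
        obtain c where c: "c < ?d" "k = pos c" using k al_n by auto
        have M: "amat R' n \<in> carrier_mat ?d' ?d" using M True by simp
        have "(\<Sum>a'<?d. amat R' n $$ (a, a') * b' n k a') = (\<Sum>a'<?d. amat R' n $$ (a, a') * E $$ (a', c))"
          using b[OF c(1)] c(2) by (intro sum.cong) (auto simp: b'_n)
        also have "\<dots> = (amat R' n * E) $$ (a, c)"
          by (rule mult_mat_entry[OF M E a c(1), symmetric])
        also have "\<dots> = (if k \<in> alive lab' K' (Suc n) then b' (Suc n) k a else 0)"
        proof (cases "c \<in> s ` D")
          case c': True
          then obtain j where j: "j \<in> D" "c = s j" by blast
          then have "k = pos' j" "j < ?d'" using c(2) D by (auto simp: pos'_def)
          then have "k \<in> alive lab' K' (Suc n)" "b' (Suc n) k a = E' $$ (a, j)"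
            using b'_pos al_set pos'_image by auto
          then show ?thesis using rel True j a by (simp del: index_mult_mat)
        next
          case c': False
          have "k \<notin> S \<union> N"
          proof
            assume "k \<in> S \<union> N"
            then have "k \<in> S" using pos_K[OF c(1)] c(2) KN by auto
            then obtain j where "j \<in> D" "pos c = pos (s j)" using c(2) by (auto simp: S_def)
            then show False using c' c(1) s_less pos_inj by blast
          qed
          then show ?thesis using rel True c' c(1) a al_set by (simp del: index_mult_mat)
        qed
        finally show ?thesis using True i dim by simp
      next
        case False
        then have a: "a < ?d" and k: "k \<in> alive lab' K' (Suc n)" using a k i dim by auto
        obtain j where j: "j < ?d'" "k = pos' j" using k al_set pos'_image by auto
        have M: "amat R' n \<in> carrier_mat ?d ?d'" using M False by simp
        have "(\<Sum>a'<?d'. amat R' n $$ (a, a') * b' (Suc n) k a') = (\<Sum>a'<?d'. amat R' n $$ (a, a') * E' $$ (a', j))"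
          using b'_pos[OF j(1)] j(2) by simp
        also have "\<dots> = (amat R' n * E') $$ (a, j)"
          by (rule mult_mat_entry[OF M E' a j(1), symmetric])
        also have "\<dots> = (if k \<in> alive lab K n then b n k a else 0)"
        proof (cases "j \<in> D")
          case j': True
          then have k': "k = pos (s j)" "s j < ?d" using j s_less by (auto simp: pos'_def)
          then have "k \<in> alive lab K n" "b n k a = E $$ (a, s j)" using al_n b a by auto
          then show ?thesis using rel False j' a by (simp del: index_mult_mat)
        next
          case j': False
          then have "k \<notin> K" using j fresh by (simp add: pos'_def)
          then show ?thesis using rel False j' j(1) a by (simp add: alive_def del: index_mult_mat)
        qed
        finally show ?thesis using False i dim al_old[of n] b'_n by simp
      qed
    qed
    have "lab' ` K' \<subseteq> interval_index (Suc n)"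
    proof
      fix x assume "x \<in> lab' ` K'"
      then obtain k where k: "k \<in> K'" "x = lab' k" by blast
      show "x \<in> interval_index (Suc n)"
        using idx[of k] k SK n by (auto simp: interval_index_def lab'_def K'_def case_prod_beta split: if_splits)
    qed
    moreover have "finite K'" using fin by (simp add: K'_def N_def)
    ultimately have basis': "interval_basis (Suc n) right R' K' lab' b' f'"
      unfolding interval_basis_def using dual arrow by blast
    have lab'_pos: "lab' (pos' j) = (fst (L' ! strip_of (map snd L') j), Suc n)" if "j < ?d'" for j
    proof (cases "j \<in> D")
      case True
      then have "pos' j \<in> S" "pos' j = pos (s j)" by (auto simp: pos'_def S_def)
      then show ?thesis using lab[OF s_less[OF True]] old[OF True] by (simp add: lab'_def)
    next
      case False
      then have "pos' j \<notin> S" "pos' j \<notin> K" using fresh SK by (auto simp: pos'_def)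
      then show ?thesis using new[OF that False] by (simp add: lab'_def)
    qed
    have "K' - alive lab' K' (Suc n) = (K - alive lab K n) \<union> pos ` ({..<?d} - s ` D)" (is "_ = ?X \<union> ?Y")
    proof -
      have "K' - alive lab' K' (Suc n) = K - S"
        using KN unfolding al_set unfolding K'_def by blast
      moreover have "?Y = alive lab K n - S"
      proof -
        have "pos ` ({..<?d} - s ` D) = pos ` {..<?d} - pos ` s ` D"
          by (rule inj_on_image_set_diff[of pos "{..<?d}"])
            (use pos s_less in \<open>auto simp: bij_betw_def\<close>)
        then show ?thesis by (simp add: al_n S_def)
      qed
      moreover have "S \<subseteq> alive lab K n" using s_less unfolding S_def al_n by auto
      moreover have "alive lab K n \<subseteq> K" unfolding alive_def by blast
      ultimately show ?thesis by blast
    qed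
    moreover have "?X \<inter> ?Y = {}" using al_n by auto
    ultimately have "mset_set (K' - alive lab' K' (Suc n)) = mset_set ?X + mset_set ?Y"
      using fin by (simp add: mset_set_Union)
    moreover have "image_mset lab' (mset_set ?X) = P"
      unfolding P[symmetric]
      using fin SK s_less by (intro image_mset_cong) (auto simp: lab'_def S_def al_n)
    moreover have "image_mset lab' (mset_set ?Y) =
        image_mset (\<lambda>c. (fst (L ! strip_of (map snd L) c), n)) (mset_set ({..<?d} - s ` D))"
    proof -
      have "inj_on pos ({..<?d} - s ` D)" using pos by (auto simp: bij_betw_def intro: inj_on_subset)
      then have "mset_set ?Y = image_mset pos (mset_set ({..<?d} - s ` D))"
        by (simp add: image_mset_mset_set)
      moreover have "lab' (pos c) = (fst (L ! strip_of (map snd L) c), n)" if "c < ?d" "c \<notin> s ` D" for c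
      proof -
        have "pos c \<notin> S" using that s_less pos_inj by (force simp: S_def)
        then show ?thesis using lab[OF that(1)] pos_K[OF that(1)] by (simp add: lab'_def)
      qed
      ultimately show ?thesis by (simp add: multiset.map_comp) (intro image_mset_cong, simp)
    qed
    ultimately have "image_mset lab' (mset_set (K' - alive lab' K' (Suc n))) = P'"
      using P' by simp
    moreover have "K' \<subseteq> {..Suc n} \<times> UNIV" using K by (auto simp: K'_def N_def)
    ultimately show ?thesis unfolding extends_basis_def using dim basis' pos' lab'_pos b'_pos by metis
  qed
  then show ?thesis unfolding extends_flags_def dim using L' by blast
qed

lemma image_mset_by_fibres:
  fixes m :: nat
  assumes "finite X" "\<And>c. c \<in> X \<Longrightarrow> h c < m"
  shows "image_mset (\<lambda>c. g (h c)) (mset_set X) = (\<Sum>i<m. replicate_mset (card {c \<in> X. h c = i}) (g i))"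
  using assms
proof (induction X rule: finite_induct)
  case empty
  then show ?case by simp
next
  case (insert x X)
  have "replicate_mset (card {c \<in> insert x X. h c = i}) (g i) =
      replicate_mset (card {c \<in> X. h c = i}) (g i) + (if i = h x then {#g (h x)#} else {#})" for i
  proof (cases "i = h x")
    case True
    then have "{c \<in> insert x X. h c = i} = insert x {c \<in> X. h c = i}" by auto
    then show ?thesis using insert True by simp
  next
    case False
    then have "{c \<in> insert x X. h c = i} = {c \<in> X. h c = i}" by auto
    then show ?thesis using False by simp
  qed
  then show ?case using insert by (simp add: sum.distrib)
qed

text \<open>
  The intervals split off in a step belong to the positions that do not survive.
\<close>

lemma split_off_eq:
  assumes fit: "strip_fits e (map snd L) ls"
  shows "split_off r L ls = image_mset (\<lambda>c. (fst (L ! strip_of (map snd L) c), r))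
    (mset_set ({..<sum_list (map snd L)} - survivor e (map snd L) ls ` {..<sum_list ls}))"
proof -
  let ?ks = "map snd L"
  let ?X = "{..<sum_list ?ks} - survivor e ?ks ls ` {..<sum_list ls}"
  have "image_mset (\<lambda>c. (fst (L ! strip_of ?ks c), r)) (mset_set ?X) =
      (\<Sum>i<length L. replicate_mset (card {c \<in> ?X. strip_of ?ks c = i}) (fst (L ! i), r))"
    using strip_of_less[of _ ?ks]
    by (intro image_mset_by_fibres[where g = "\<lambda>i. (fst (L ! i), r)" and h = "strip_of ?ks"]) auto
  also have "\<dots> = split_off r L ls"
    unfolding split_off_def using card_nonsurvivors[OF fit] by (intro sum.cong refl) simp
  finally show ?thesis ..
qed

lemma diag_block_upper:
  assumes "list_all2 unitary_mat ks Vs"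
  shows "block_upper (sum_list ks) (strip_of ks) (diag_block_mat Vs)"
proof -
  have "map dim_row Vs = ks" "map dim_col Vs = ks"
    using assms by (auto simp: list_all2_conv_all_nth unitary_mat_def intro!: nth_equalityI)
  then show ?thesis
    unfolding block_upper_def using diag_block_mat_entry[of _ Vs] by (auto simp: Let_def split: if_splits)
qed

lemma upper_adjoint_diag_block:
  assumes "list_all2 unitary_mat ks Vs"
  shows "block_upper (sum_list ks) (strip_of ks) (mat_adjoint (diag_block_mat Vs))"
  using diag_block_unitary[OF assms] diag_block_upper[OF assms] block_upper_inverse
  by (auto simp: unitary_mat_iff_inverse_pair)

text \<open>
  The reduced matrix is obtained after a change of basis \<open>V\<close> within the strips. As \<open>V\<close> is block
  diagonal, it preserves the flag and can be absorbed into the adapted basis.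
\<close>

lemma extends_flags_right:
  assumes n: "1 \<le> n" and rt: "right n" and ext: "extends_flags n right R L P"
    and dim: "vdim R' = vdim R" and same: "\<And>i. 1 \<le> i \<Longrightarrow> i < n \<Longrightarrow> amat R' i = amat R i"
    and M: "amat R' n \<in> carrier_mat (vdim R (Suc n)) (vdim R n)"
    and Vs: "list_all2 unitary_mat (map snd L) Vs"
    and red: "reduced_right (vdim R (Suc n)) (map snd L) ls (amat R' n * diag_block_mat Vs)"
  shows "extends_flags (Suc n) right R'
    (zip (map fst L) ls @ [(Suc n, vdim R (Suc n) - sum_list ls)]) (P + split_off n L ls)"
proof -
  let ?ks = "map snd L" and ?d = "vdim R n" and ?d' = "vdim R (Suc n)"
  let ?L' = "zip (map fst L) ls @ [(Suc n, ?d' - sum_list ls)]"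
  let ?V = "diag_block_mat Vs"
  have d: "sum_list ?ks = ?d" using ext by (simp add: extends_flags_def)
  note fit = reduced_right_fits[OF red]
  have len: "length ls = length L" "sum_list ls \<le> ?d'" using red by (auto simp: reduced_right_iff)
  have snd_L': "map snd ?L' = ls @ [?d' - sum_list ls]" using len by simp
  have V: "?V \<in> carrier_mat ?d ?d" "inverse_pair ?d ?V (mat_adjoint ?V)" "block_upper ?d (strip_of ?ks) ?V"
    using diag_block_unitary[OF Vs] diag_block_upper[OF Vs] d
    by (auto simp: unitary_mat_iff_inverse_pair inverse_pair_def)
  show ?thesis
  proof (rule extends_flags_step[OF n ext dim same, where D = "{..<sum_list ls}" and s = "right_survivor ?ks ls"])
    show "amat R' n \<in> carrier_mat (vdim R (tgt right n)) (vdim R (src right n))" using M rt by simp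
    show "sum_list (map snd ?L') = ?d'" unfolding snd_L' using len by simp
    show "{..<sum_list ls} \<subseteq> {..<?d'}" using len by auto
    show "inj_on (right_survivor ?ks ls) {..<sum_list ls}" by (rule survivor_inj[OF fit])
    fix j
    {
      assume "j \<in> {..<sum_list ls}"
      then have j: "j < sum_list ls" by simp
      show "right_survivor ?ks ls j < ?d" using survivor_less_and_strip[OF fit j] d by simp
      show "fst (?L' ! strip_of (map snd ?L') j) = fst (L ! strip_of ?ks (right_survivor ?ks ls j))"
        unfolding snd_L' using survivor_less_and_strip[OF fit j] j strip_of_less[OF j] len
        by (simp add: strip_of_append nth_append)
    next
      assume "j < ?d'" "j \<notin> {..<sum_list ls}"
      then have "\<not> j < sum_list ls" "j - sum_list ls < ?d' - sum_list ls" by auto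
      then show "fst (?L' ! strip_of (map snd ?L') j) = Suc n"
        unfolding snd_L' using len by (simp add: strip_of_append nth_append)
    }
  next
    fix E' F' assume E': "inverse_pair ?d' E' F'" "block_upper ?d' (strip_of (map snd ?L')) E'"
    have B: "amat R' n * ?V \<in> carrier_mat ?d' (sum_list ?ks)" using M V(1) d by simp
    obtain E F where E: "inverse_pair ?d E F" "block_upper ?d (strip_of ?ks) E"
      and BE1: "\<forall>a<?d'. \<forall>b<sum_list ls. (amat R' n * ?V * E) $$ (a, right_survivor ?ks ls b) = E' $$ (a, b)"
      and BE0: "\<forall>a<?d'. \<forall>c<?d. c \<notin> right_survivor ?ks ls ` {..<sum_list ls} \<longrightarrow>
          (amat R' n * ?V * E) $$ (a, c) = 0"
      using reduced_right_lift_basis[OF red B E'(1) E'(2)[unfolded snd_L']] unfolding d by blast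
    have cE: "E \<in> carrier_mat ?d ?d" using E by (simp add: inverse_pair_def)
    have assoc: "amat R' n * ?V * E = amat R' n * (?V * E)" by (rule assoc_mult_mat[OF M V(1) cE])
    show "\<exists>E F. inverse_pair ?d E F \<and> block_upper ?d (strip_of ?ks) E \<and>
       arrow_matches (right n) (amat R' n) ?d ?d' {..<sum_list ls} (right_survivor ?ks ls) E E'"
      unfolding arrow_matches_def
      using inverse_pair_mult[OF V(2) E(1)] block_upper_mult[OF V(1) cE V(3) E(2)] BE1 BE0 rt
      unfolding assoc
      by (intro exI[of _ "?V * E"] exI[of _ "F * mat_adjoint ?V"]) (simp del: index_mult_mat)
  next
    show "P + split_off n L ls = P + image_mset (\<lambda>c. (fst (L ! strip_of ?ks c), n))
        (mset_set ({..<?d} - right_survivor ?ks ls ` {..<sum_list ls}))"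
      using split_off_eq[OF fit] d by simp
  qed
qed

text \<open>
  Here the change of basis within the strips acts on the target, so it is undone by its adjoint.
\<close>

lemma extends_flags_left:
  assumes n: "1 \<le> n" and lt: "\<not> right n" and ext: "extends_flags n right R L P"
    and dim: "vdim R' = vdim R" and same: "\<And>i. 1 \<le> i \<Longrightarrow> i < n \<Longrightarrow> amat R' i = amat R i"
    and M: "amat R' n \<in> carrier_mat (vdim R n) (vdim R (Suc n))"
    and Vs: "list_all2 unitary_mat (map snd L) Vs"
    and red: "reduced_left (vdim R (Suc n)) (map snd L) ls (diag_block_mat Vs * amat R' n)"
  shows "extends_flags (Suc n) right R'
    ((Suc n, vdim R (Suc n) - sum_list ls) # zip (map fst L) ls) (P + split_off n L ls)"
proof -
  let ?ks = "map snd L" and ?d = "vdim R n" and ?d' = "vdim R (Suc n)"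
  let ?q = "?d' - sum_list ls"
  let ?L' = "(Suc n, ?q) # zip (map fst L) ls"
  let ?V = "diag_block_mat Vs" and ?s = "\<lambda>j. left_survivor ?ks ls (j - ?q)"
  have d: "sum_list ?ks = ?d" using ext by (simp add: extends_flags_def)
  note fit = reduced_left_fits[OF red]
  have len: "length ls = length L" "sum_list ls \<le> ?d'" using red by (auto simp: reduced_left_iff)
  have snd_L': "map snd ?L' = ?q # ls" using len by simp
  have V: "?V \<in> carrier_mat ?d ?d" "inverse_pair ?d (mat_adjoint ?V) ?V" "block_upper ?d (strip_of ?ks) (mat_adjoint ?V)"
    using diag_block_unitary[OF Vs] upper_adjoint_diag_block[OF Vs] d
    by (auto simp: unitary_mat_iff_inverse_pair inverse_pair_def)
  have D: "(\<lambda>j. j - ?q) ` {?q..<?d'} = {..<sum_list ls}"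
  proof (intro equalityI subsetI)
    fix b assume "b \<in> {..<sum_list ls}"
    then have "b = (b + ?q) - ?q" "b + ?q \<in> {?q..<?d'}" using len by auto
    then show "b \<in> (\<lambda>j. j - ?q) ` {?q..<?d'}" by blast
  qed (use len in auto)
  have sD: "?s ` {?q..<?d'} = left_survivor ?ks ls ` {..<sum_list ls}"
    unfolding D[symmetric] by (simp add: image_image)
  show ?thesis
  proof (rule extends_flags_step[OF n ext dim same, where D = "{?q..<?d'}" and s = ?s])
    show "amat R' n \<in> carrier_mat (vdim R (tgt right n)) (vdim R (src right n))" using M lt by simp
    show "sum_list (map snd ?L') = ?d'" unfolding snd_L' using len by simp
    show "{?q..<?d'} \<subseteq> {..<?d'}" by auto
    have "inj_on (left_survivor ?ks ls \<circ> (\<lambda>j. j - ?q)) {?q..<?d'}"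
      by (rule comp_inj_on) (auto simp: inj_on_def D survivor_inj[OF fit, unfolded inj_on_def, rule_format])
    then show "inj_on ?s {?q..<?d'}" by (simp add: comp_def)
    fix j
    {
      assume "j \<in> {?q..<?d'}"
      then have j: "j - ?q < sum_list ls" "\<not> j < ?q" using len by auto
      show "?s j < ?d" using survivor_less_and_strip[OF fit j(1)] d by simp
      show "fst (?L' ! strip_of (map snd ?L') j) = fst (L ! strip_of ?ks (?s j))"
        unfolding snd_L' using survivor_less_and_strip[OF fit j(1)] j(2) strip_of_less[OF j(1)] len
        by simp
    next
      assume "j < ?d'" "j \<notin> {?q..<?d'}"
      then show "fst (?L' ! strip_of (map snd ?L') j) = Suc n"
        unfolding snd_L' by simp
    }
  next
    fix E' F' assume E': "inverse_pair ?d' E' F'" "block_upper ?d' (strip_of (map snd ?L')) E'"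
    have B: "?V * amat R' n \<in> carrier_mat (sum_list ?ks) ?d'" using M V(1) d by simp
    obtain E F where E: "inverse_pair ?d E F" "block_upper ?d (strip_of ?ks) E"
      and BE0: "\<forall>a<?d. \<forall>b<?q. (?V * amat R' n * E') $$ (a, b) = 0"
      and BE1: "\<forall>a<?d. \<forall>b<sum_list ls.
          (?V * amat R' n * E') $$ (a, ?q + b) = E $$ (a, left_survivor ?ks ls b)"
      using reduced_left_lift_basis[OF red B E'(1) E'(2)[unfolded snd_L']] unfolding d by blast
    have c: "E \<in> carrier_mat ?d ?d" "E' \<in> carrier_mat ?d' ?d'" "mat_adjoint ?V \<in> carrier_mat ?d ?d"
      "mat_adjoint ?V * ?V = 1\<^sub>m ?d"
      using E E' V by (auto simp: inverse_pair_def)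
    have ME: "(amat R' n * E') $$ (a, j) = (\<Sum>i<?d. mat_adjoint ?V $$ (a, i) * (?V * amat R' n * E') $$ (i, j))"
      if "a < ?d" "j < ?d'" for a j
    proof -
      have "amat R' n * E' = (mat_adjoint ?V * ?V) * (amat R' n * E')" using c M by simp
      also have "\<dots> = mat_adjoint ?V * (?V * (amat R' n * E'))"
        by (rule assoc_mult_mat) (use c M V in auto)
      also have "?V * (amat R' n * E') = ?V * amat R' n * E'"
        by (rule assoc_mult_mat[symmetric]) (use c M V in auto)
      finally show ?thesis
        using mult_mat_entry[of "mat_adjoint ?V" ?d ?d "?V * amat R' n * E'" ?d' a j] that c M V(1)
        by (simp del: index_mult_mat)
    qed
    have VE: "(mat_adjoint ?V * E) $$ (a, k) = (\<Sum>i<?d. mat_adjoint ?V $$ (a, i) * E $$ (i, k))"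
      if "a < ?d" "k < ?d" for a k
      by (rule mult_mat_entry[OF c(3,1) that])
    have 1: "(amat R' n * E') $$ (a, j) = (mat_adjoint ?V * E) $$ (a, ?s j)"
      if a: "a < ?d" and j: "j \<in> {?q..<?d'}" for a j
    proof -
      have j': "j < ?d'" "j - ?q < sum_list ls" "?q + (j - ?q) = j" using j len by auto
      have s: "?s j < ?d" using survivor_less_and_strip[OF fit j'(2)] d by simp
      have "(?V * amat R' n * E') $$ (i, j) = E $$ (i, ?s j)" if "i < ?d" for i
        using BE1[rule_format, OF that j'(2)] unfolding j'(3) .
      then show ?thesis unfolding ME[OF a j'(1)] VE[OF a s] by (intro sum.cong) auto
    qed
    have 0: "(amat R' n * E') $$ (a, j) = 0" if "a < ?d" "j < ?d'" "j \<notin> {?q..<?d'}" for a j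
      unfolding ME[OF that(1,2)] using BE0 that by (simp del: index_mult_mat)
    show "\<exists>E F. inverse_pair ?d E F \<and> block_upper ?d (strip_of ?ks) E \<and>
       arrow_matches (right n) (amat R' n) ?d ?d' {?q..<?d'} ?s E E'"
      unfolding arrow_matches_def
      using inverse_pair_mult[OF V(2) E(1)] block_upper_mult[OF c(3,1) V(3) E(2)] lt 0 1
      by (intro exI[of _ "mat_adjoint ?V * E"] exI[of _ "F * ?V"]) (simp del: index_mult_mat)
  next
    show "P + split_off n L ls = P + image_mset (\<lambda>c. (fst (L ! strip_of ?ks c), n))
        (mset_set ({..<?d} - ?s ` {?q..<?d'}))"
      unfolding sD using split_off_eq[OF fit] d by simp
  qed
qed

lemma vertex_transform_step:
  assumes A: "mat_rep (chain t right) A" and R: "mat_rep (chain t right) R" "vdim R = vdim A"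
      "rep_iso (chain t right) A R"
    and r: "1 \<le> r" "r < t" and S: "unitary_mat (vdim A (r + 1)) S"
  defines "R' \<equiv> vertex_transform (chain t right) (r + 1) S R"
  shows "mat_rep (chain t right) R'" "vdim R' = vdim A" "rep_iso (chain t right) A R'"
    and "\<And>i. 1 \<le> i \<Longrightarrow> i < r \<Longrightarrow> amat R' i = amat R i"
    and "amat R' r \<in> carrier_mat (vdim R (tgt right r)) (vdim R (src right r))"
proof -
  have "inverse_pair (vdim R (r + 1)) S (mat_adjoint S)"
    using S R(2) by (simp add: unitary_mat_iff_inverse_pair)
  from vertex_transform_rep[OF R(1) this]
  have R': "mat_rep (chain t right) R'" "rep_iso (chain t right) R R'" by (auto simp: R'_def)
  show "mat_rep (chain t right) R'" "vdim R' = vdim A" using R' R(2) by (auto simp: R'_def)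
  show "rep_iso (chain t right) A R'"
    by (rule rep_iso_trans[OF wf_chain A R(1) R'(1) R(3) R'(2)])
  show "amat R' i = amat R i" if "1 \<le> i" "i < r" for i
    using that by (simp add: R'_def vertex_transform_def Let_def)
  show "amat R' r \<in> carrier_mat (vdim R (tgt right r)) (vdim R (src right r))"
    using R'(1)[unfolded mat_rep_def, rule_format, of r] r by (simp add: R'_def)
qed

lemma chain_run_invariant:
  assumes A: "mat_rep (chain t right) A" and run: "chain_run t right A r P L R" and r: "r < t"
  shows "mat_rep (chain t right) R \<and> vdim R = vdim A \<and> rep_iso (chain t right) A R \<and>
    extends_flags (Suc r) right R L P"
  using run r
proof (induction rule: chain_run.induct)
  case start
  then show ?case using A rep_iso_refl extends_flags_start by auto
next
  case (step_right r P L R d' ks S R' Vs ls)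
  then have R: "mat_rep (chain t right) R" "vdim R = vdim A" "rep_iso (chain t right) A R"
    and ext: "extends_flags r right R L P" and r: "1 \<le> r" "r < t"
    and S: "unitary_mat (vdim A (r + 1)) S"
    by auto
  note R' = vertex_transform_step[OF A R r S, folded step_right(8)]
  have "extends_flags (Suc r) right R' (zip (map fst L) ls @ [(Suc r, vdim R (Suc r) - sum_list ls)])
      (P + split_off r L ls)"
    by (rule extends_flags_right[OF r(1) _ ext _ R'(4)]) (use step_right R R' in auto)
  then show ?case using R' R(2) step_right by simp
next
  case (step_left r P L R d' ks S R' Vs ls)
  then have R: "mat_rep (chain t right) R" "vdim R = vdim A" "rep_iso (chain t right) A R"
    and ext: "extends_flags r right R L P" and r: "1 \<le> r" "r < t"
    and S: "unitary_mat (vdim A (r + 1)) S"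
    by auto
  note R' = vertex_transform_step[OF A R r S, folded step_left(8)]
  have "extends_flags (Suc r) right R' ((Suc r, vdim R (Suc r) - sum_list ls) # zip (map fst L) ls)
      (P + split_off r L ls)"
    by (rule extends_flags_left[OF r(1) _ ext _ R'(4)]) (use step_left R R' in auto)
  then show ?case using R' R(2) step_left by simp
qed

text \<open>
  At the last vertex any adapted basis will do; the standard basis is taken.
\<close>

lemma extends_flags_interval_basis:
  assumes "extends_flags n right R L P"
  shows "\<exists>(K :: (nat \<times> nat) set) lab b f. interval_basis n right R K lab b f \<and>
    image_mset lab (mset_set K) = P + (\<Sum>i<length L. replicate_mset (snd (L ! i)) (fst (L ! i), n))"
proof -
  let ?ks = "map snd L" and ?d = "vdim R n"
  have d: "sum_list ?ks = ?d" using assms by (simp add: extends_flags_def)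
  have "block_upper ?d (strip_of ?ks) (1\<^sub>m ?d)" by (auto simp: block_upper_def split: if_splits)
  with assms inverse_pair_one[of ?d] obtain K :: "(nat \<times> nat) set" and lab b f pos where
    basis: "interval_basis n right R K lab b f"
    and pos: "bij_betw pos {..<?d} (alive lab K n)"
    and lab: "\<And>c. c < ?d \<Longrightarrow> lab (pos c) = (fst (L ! strip_of ?ks c), n)"
    and P: "image_mset lab (mset_set (K - alive lab K n)) = P"
    unfolding extends_flags_def extends_basis_def by metis
  have fin: "finite K" using basis by (simp add: interval_basis_def)
  have "mset_set (alive lab K n) = image_mset pos (mset_set {..<?d})"
    using pos by (simp add: bij_betw_def image_mset_mset_set)
  then have "image_mset lab (mset_set (alive lab K n)) =
      image_mset (\<lambda>c. (fst (L ! strip_of ?ks c), n)) (mset_set {..<?d})"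
    using lab by (simp add: multiset.map_comp) (intro image_mset_cong, simp)
  also have "\<dots> = (\<Sum>i<length L. replicate_mset (card {c \<in> {..<?d}. strip_of ?ks c = i}) (fst (L ! i), n))"
    using strip_of_less[of _ ?ks] d
    by (intro image_mset_by_fibres[where g = "\<lambda>i. (fst (L ! i), n)" and h = "strip_of ?ks"]) auto
  also have "\<dots> = (\<Sum>i<length L. replicate_mset (snd (L ! i)) (fst (L ! i), n))"
  proof (rule sum.cong)
    fix i assume "i \<in> {..<length L}"
    then show "replicate_mset (card {c \<in> {..<?d}. strip_of ?ks c = i}) (fst (L ! i), n) =
        replicate_mset (snd (L ! i)) (fst (L ! i), n)"
      using card_strip[of i ?ks] d by simp
  qed simp
  finally have "image_mset lab (mset_set (alive lab K n)) =
    (\<Sum>i<length L. replicate_mset (snd (L ! i)) (fst (L ! i), n))" .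
  moreover have "mset_set K = mset_set (K - alive lab K n) + mset_set (alive lab K n)"
    using fin by (subst mset_set_Union[symmetric]) (auto simp: alive_def intro: arg_cong[of _ _ mset_set])
  ultimately have "image_mset lab (mset_set K) =
      P + (\<Sum>i<length L. replicate_mset (snd (L ! i)) (fst (L ! i), n))"
    using P by simp
  with basis show ?thesis by blast
qed

section \<open>Uniqueness of the decomposition\<close>

text \<open>
  The coefficient at \<open>k\<close> of the vector \<open>b l\<close>, expanded in the basis with dual basis \<open>f\<close>.
\<close>

definition coef ::
  "nat \<Rightarrow> ('k \<Rightarrow> nat \<Rightarrow> complex) \<Rightarrow> ('l \<Rightarrow> nat \<Rightarrow> complex) \<Rightarrow> 'k \<Rightarrow> 'l \<Rightarrow> complex" where
  "coef d f b k l = (\<Sum>a<d. f k a * b l a)"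

lemma coef_compose:
  assumes "dual_families d I b f" "dual_families d I' b' f'" "k \<in> I" "k' \<in> I"
  shows "(\<Sum>l\<in>I'. coef d f b' k l * coef d f' b l k') = (if k = k' then 1 else 0)"
proof -
  have "(\<Sum>l\<in>I'. coef d f b' k l * coef d f' b l k')
      = (\<Sum>l\<in>I'. \<Sum>a<d. \<Sum>a'<d. f k a * (b' l a * f' l a') * b k' a')"
    unfolding coef_def sum_product by (simp add: mult.assoc)
  also have "\<dots> = (\<Sum>a<d. \<Sum>l\<in>I'. \<Sum>a'<d. f k a * (b' l a * f' l a') * b k' a')"
    by (rule sum.swap)
  also have "\<dots> = (\<Sum>a<d. \<Sum>a'<d. \<Sum>l\<in>I'. f k a * (b' l a * f' l a') * b k' a')"
    by (rule sum.cong[OF refl], rule sum.swap)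
  also have "\<dots> = (\<Sum>a<d. \<Sum>a'<d. f k a * (\<Sum>l\<in>I'. b' l a * f' l a') * b k' a')"
    by (simp add: sum_distrib_left sum_distrib_right)
  also have "\<dots> = (\<Sum>a<d. \<Sum>a'<d. if a = a' then f k a * b k' a else 0)"
    using assms(2) by (intro sum.cong refl) (auto simp: dual_families_def)
  also have "\<dots> = (\<Sum>a<d. f k a * b k' a)" by simp
  also have "\<dots> = (if k = k' then 1 else 0)" using assms by (simp add: dual_families_def)
  finally show ?thesis .
qed

text \<open>
  The transposed action of an arrow: expand the standard vector in the basis at the source and use
  duality at the target.
\<close>

lemma interval_basis_dual_arrow:
  assumes basis: "interval_basis n right R K lab b f" and i: "i \<in> {1..<n}"
    and k: "k \<in> alive lab K (tgt right i)" and c: "c < vdim R (src right i)"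
  shows "(\<Sum>a<vdim R (tgt right i). f (tgt right i) k a * amat R i $$ (a, c)) =
    (if k \<in> alive lab K (src right i) then f (src right i) k c else 0)"
proof -
  let ?u = "src right i" and ?w = "tgt right i"
  let ?du = "vdim R ?u" and ?dw = "vdim R ?w" and ?M = "\<lambda>a c. amat R i $$ (a, c)"
  let ?Iu = "alive lab K ?u" and ?Iw = "alive lab K ?w"
  have uw: "?u \<in> {1..n}" "?w \<in> {1..n}" using i by auto
  have du: "dual_families ?du ?Iu (b ?u) (f ?u)" and dw: "dual_families ?dw ?Iw (b ?w) (f ?w)"
    using basis uw by (auto simp: interval_basis_def)
  have fin: "finite ?Iu" using basis by (simp add: interval_basis_def alive_def)
  have "(\<Sum>a<?dw. f ?w k a * ?M a c) = (\<Sum>a<?dw. f ?w k a * (\<Sum>e<?du. ?M a e * (\<Sum>m\<in>?Iu. b ?u m e * f ?u m c)))"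
  proof (rule sum.cong)
    fix a
    have "(\<Sum>e<?du. ?M a e * (\<Sum>m\<in>?Iu. b ?u m e * f ?u m c)) = (\<Sum>e<?du. if e = c then ?M a c else 0)"
      using du c by (intro sum.cong) (auto simp: dual_families_def)
    then show "f ?w k a * ?M a c = f ?w k a * (\<Sum>e<?du. ?M a e * (\<Sum>m\<in>?Iu. b ?u m e * f ?u m c))"
      using c by simp
  qed simp
  also have "\<dots> = (\<Sum>a<?dw. \<Sum>m\<in>?Iu. f ?w k a * (\<Sum>e<?du. ?M a e * b ?u m e) * f ?u m c)"
    unfolding sum_distrib_left sum_distrib_right
    by (rule sum.cong[OF refl], subst sum.swap) (simp add: mult.assoc)
  also have "\<dots> = (\<Sum>a<?dw. \<Sum>m\<in>?Iu. f ?w k a * (if m \<in> ?Iw then b ?w m a else 0) * f ?u m c)"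
    using basis i by (intro sum.cong refl) (simp add: interval_basis_def)
  also have "\<dots> = (\<Sum>m\<in>?Iu. \<Sum>a<?dw. f ?w k a * (if m \<in> ?Iw then b ?w m a else 0) * f ?u m c)"
    by (rule sum.swap)
  also have "\<dots> = (\<Sum>m\<in>?Iu. if m \<in> ?Iw then (\<Sum>a<?dw. f ?w k a * b ?w m a) * f ?u m c else 0)"
    by (intro sum.cong refl) (simp add: sum_distrib_right)
  also have "\<dots> = (\<Sum>m\<in>?Iu. if m = k then f ?u k c else 0)"
    using dw k by (intro sum.cong refl) (auto simp: dual_families_def)
  also have "\<dots> = (if k \<in> ?Iu then f ?u k c else 0)" using fin by simp
  finally show ?thesis .
qed

text \<open>
  Naturality: the identity, written in two interval bases, commutes with the arrows. Both sides are the
  matrix element of the arrow between a dual vector at its target and a basis vector at its source.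
\<close>

lemma coef_arrow:
  assumes basis: "interval_basis n right R K lab b f" "interval_basis n right R K' lab' b' f'"
    and i: "i \<in> {1..<n}"
    and k: "k \<in> alive lab K (tgt right i)" and l: "l \<in> alive lab' K' (src right i)"
  defines "c \<equiv> \<lambda>v. coef (vdim R v) (f v) (b' v) k l"
  shows "(if l \<in> alive lab' K' (tgt right i) then c (tgt right i) else 0) =
    (if k \<in> alive lab K (src right i) then c (src right i) else 0)"
proof -
  let ?u = "src right i" and ?w = "tgt right i"
  let ?du = "vdim R ?u" and ?dw = "vdim R ?w" and ?M = "\<lambda>a c. amat R i $$ (a, c)"
  have "(if l \<in> alive lab' K' ?w then c ?w else 0) =
      (\<Sum>a<?dw. f ?w k a * (if l \<in> alive lab' K' ?w then b' ?w l a else 0))"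
    by (simp add: c_def coef_def)
  also have "\<dots> = (\<Sum>a<?dw. f ?w k a * (\<Sum>e<?du. ?M a e * b' ?u l e))"
    using basis(2) i l by (intro sum.cong refl) (simp add: interval_basis_def)
  also have "\<dots> = (\<Sum>e<?du. (\<Sum>a<?dw. f ?w k a * ?M a e) * b' ?u l e)"
    unfolding sum_distrib_left sum_distrib_right by (subst sum.swap) (simp add: mult.assoc)
  also have "\<dots> = (\<Sum>e<?du. (if k \<in> alive lab K ?u then f ?u k e else 0) * b' ?u l e)"
    using interval_basis_dual_arrow[OF basis(1) i k] by (intro sum.cong refl) simp
  also have "\<dots> = (if k \<in> alive lab K ?u then c ?u else 0)"
    by (simp add: c_def coef_def)
  finally show ?thesis .
qed

text \<open>
  The product describes the composite of homomorphisms between two different intervals, from the one of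
  \<open>l\<close> to the one of \<open>k\<close> and back. By naturality it is constant along their intersection. Since the
  intervals differ, one of them continues beyond an end of the intersection where the other one
  stops, and naturality for the arrow there makes one of the factors vanish, whatever the direction
  of the arrow.
\<close>

lemma coef_product_vanishes:
  assumes basis: "interval_basis n right R K lab b f" "interval_basis n right R K' lab' b' f'"
    and k: "k \<in> K" "k' \<in> K" "lab k' = lab k" and l: "l \<in> K'" "lab' l \<noteq> lab k"
    and v: "k \<in> alive lab K v" "l \<in> alive lab' K' v"
  shows "coef (vdim R v) (f v) (b' v) k l * coef (vdim R v) (f' v) (b v) l k' = 0"
proof -
  define c where "c v = coef (vdim R v) (f v) (b' v) k l" for v
  define c' where "c' v = coef (vdim R v) (f' v) (b v) l k'" for v
  define g where "g v = c v * c' v" for v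
  obtain i j where I: "lab k = (i, j)" by (cases "lab k")
  obtain i' j' where I': "lab' l = (i', j')" by (cases "lab' l")
  have ij: "1 \<le> i" "i \<le> j" "j \<le> n" "1 \<le> i'" "i' \<le> j'" "j' \<le> n"
  proof -
    have "lab k \<in> interval_index n" "lab' l \<in> interval_index n"
      using basis k(1) l(1) unfolding interval_basis_def by blast+
    then show "1 \<le> i" "i \<le> j" "j \<le> n" "1 \<le> i'" "i' \<le> j'" "j' \<le> n"
      using I I' by (simp_all add: interval_index_def)
  qed
  have al: "k \<in> alive lab K v \<longleftrightarrow> i \<le> v \<and> v \<le> j" "k' \<in> alive lab K v \<longleftrightarrow> i \<le> v \<and> v \<le> j"
    "l \<in> alive lab' K' v \<longleftrightarrow> i' \<le> v \<and> v \<le> j'" for v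
    using k l I I' by (auto simp: alive_def)
  have A: "(if i' \<le> tgt right m \<and> tgt right m \<le> j' then c (tgt right m) else 0) =
      (if i \<le> src right m \<and> src right m \<le> j then c (src right m) else 0)"
    if "m \<in> {1..<n}" "i \<le> tgt right m \<and> tgt right m \<le> j" "i' \<le> src right m \<and> src right m \<le> j'" for m
    using coef_arrow[OF basis that(1), of k l] that(2,3) unfolding c_def by (simp add: al)
  have B: "(if i \<le> tgt right m \<and> tgt right m \<le> j then c' (tgt right m) else 0) =
      (if i' \<le> src right m \<and> src right m \<le> j' then c' (src right m) else 0)"
    if "m \<in> {1..<n}" "i' \<le> tgt right m \<and> tgt right m \<le> j'" "i \<le> src right m \<and> src right m \<le> j" for m
    using coef_arrow[OF basis(2,1) that(1), of l k'] that(2,3) unfolding c'_def by (simp add: al)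
  let ?lo = "max i i'" and ?hi = "min j j'"
  have const: "g w = g ?lo" if "?lo \<le> w" "w \<le> ?hi" for w
    using that
  proof (induction w rule: dec_induct)
    case base
    then show ?case by simp
  next
    case (step w)
    have "g (Suc w) = g w"
      using A[of w] B[of w] step ij by (cases "right w") (auto simp: g_def)
    with step show ?case by simp
  qed
  have vb: "?lo \<le> v" "v \<le> ?hi" using v al by auto
  have "g v = 0"
  proof (cases "i = i'")
    case False
    \<comment> \<open>The vertex before the intersection belongs to exactly one of the two intervals.\<close>
    define m where "m = ?lo - 1"
    have lo: "?lo = Suc m" using ij by (simp add: m_def)
    have m: "m \<in> {1..<n}" using False ij vb by (auto simp: m_def)
    have in_both: "i \<le> Suc m" "Suc m \<le> j" "i' \<le> Suc m" "Suc m \<le> j'"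
      using vb unfolding lo[symmetric] by auto
    have "i \<le> m \<and> m \<le> j \<and> \<not> i' \<le> m \<or> i' \<le> m \<and> m \<le> j' \<and> \<not> i \<le> m"
      using False in_both lo by auto
    then have "g (Suc m) = 0"
      using A[OF m] B[OF m] in_both by (cases "right m") (auto simp: g_def)
    then have "g ?lo = 0" unfolding lo .
    then show ?thesis using const vb by simp
  next
    case True
    then have "j \<noteq> j'" using l(2) I I' by auto
    \<comment> \<open>The vertex after the intersection belongs to exactly one of the two intervals.\<close>
    define m where "m = ?hi"
    have m: "m \<in> {1..<n}" using \<open>j \<noteq> j'\<close> ij vb by (auto simp: m_def)
    have in_both: "i \<le> m" "m \<le> j" "i' \<le> m" "m \<le> j'"
      using vb by (auto simp: m_def)
    have "Suc m \<le> j \<and> \<not> Suc m \<le> j' \<or> Suc m \<le> j' \<and> \<not> Suc m \<le> j"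
      using \<open>j \<noteq> j'\<close> by (auto simp: m_def)
    then have "g m = 0"
      using A[OF m] B[OF m] in_both by (cases "right m") (auto simp: g_def)
    then have "g ?hi = 0" unfolding m_def .
    then show ?thesis using const[of v] const[of ?hi] vb by simp
  qed
  then show ?thesis by (simp add: g_def c_def c'_def)
qed

lemma coef_product_sum:
  assumes basis: "interval_basis n right R K lab b f" "interval_basis n right R K' lab' b' f'"
    and k: "k \<in> K" and v: "k \<in> alive lab K v" "v \<in> {1..n}"
  shows "(\<Sum>l | l \<in> K' \<and> lab' l = lab k. coef (vdim R v) (f v) (b' v) k l * coef (vdim R v) (f' v) (b v) l k) = 1"
proof -
  have fin: "finite K'" using basis(2) by (simp add: interval_basis_def)
  have "(\<Sum>l\<in>alive lab' K' v. coef (vdim R v) (f v) (b' v) k l * coef (vdim R v) (f' v) (b v) l k) = 1"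
    using basis v by (subst coef_compose[where I = "alive lab K v"]) (auto simp: interval_basis_def)
  also have "(\<Sum>l\<in>alive lab' K' v. coef (vdim R v) (f v) (b' v) k l * coef (vdim R v) (f' v) (b v) l k)
    = (\<Sum>l | l \<in> K' \<and> lab' l = lab k. coef (vdim R v) (f v) (b' v) k l * coef (vdim R v) (f' v) (b v) l k)"
  proof (rule sum.mono_neutral_right)
    show "finite (alive lab' K' v)" using fin by (simp add: alive_def)
    show "{l \<in> K'. lab' l = lab k} \<subseteq> alive lab' K' v" using v(1) by (auto simp: alive_def)
    show "\<forall>l\<in>alive lab' K' v - {l \<in> K'. lab' l = lab k}.
        coef (vdim R v) (f v) (b' v) k l * coef (vdim R v) (f' v) (b v) l k = 0"
    proof
      fix l assume "l \<in> alive lab' K' v - {l \<in> K'. lab' l = lab k}"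
      then have "l \<in> alive lab' K' v" "l \<in> K'" "lab' l \<noteq> lab k" by (auto simp: alive_def)
      then show "coef (vdim R v) (f v) (b' v) k l * coef (vdim R v) (f' v) (b v) l k = 0"
        using coef_product_vanishes[OF basis k k refl] v(1) by blast
    qed
  qed
  finally show ?thesis .
qed

text \<open>
  For a fixed label the two blocks of coefficients are inverse to each other, so the numbers of
  basis vectors with this label are the traces of their products in both orders.
\<close>

theorem interval_basis_unique:
  assumes basis: "interval_basis n right R K lab b f" "interval_basis n right R K' lab' b' f'"
  shows "image_mset lab (mset_set K) = image_mset lab' (mset_set K')"
proof (rule multiset_eqI)
  fix x
  let ?X = "{k \<in> K. lab k = x}" and ?X' = "{l \<in> K'. lab' l = x}"
  have fin: "finite K" "finite K'" using basis by (auto simp: interval_basis_def)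
  define v where "v = fst x"
  define c where "c k l = coef (vdim R v) (f v) (b' v) k l" for k l
  define c' where "c' l k = coef (vdim R v) (f' v) (b v) l k" for l k
  have 1: "(\<Sum>l\<in>?X'. c k l * c' l k) = 1" if k: "k \<in> ?X" for k
  proof -
    have "k \<in> K" "k \<in> alive lab K v" "v \<in> {1..n}" "lab k = x"
      using k basis(1) by (auto simp: interval_basis_def alive_def v_def interval_index_def)
    then show ?thesis using coef_product_sum[OF basis, of k v] by (simp add: c_def c'_def)
  qed
  have 2: "(\<Sum>k\<in>?X. c k l * c' l k) = 1" if l: "l \<in> ?X'" for l
  proof -
    have "l \<in> K'" "l \<in> alive lab' K' v" "v \<in> {1..n}" "lab' l = x"
      using l basis(2) by (auto simp: interval_basis_def alive_def v_def interval_index_def)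
    then show ?thesis using coef_product_sum[OF basis(2,1), of l v]
      by (simp add: c_def c'_def mult.commute)
  qed
  have "of_nat (card ?X) = (\<Sum>k\<in>?X. \<Sum>l\<in>?X'. c k l * c' l k)" using 1 by simp
  also have "\<dots> = (\<Sum>l\<in>?X'. \<Sum>k\<in>?X. c k l * c' l k)" by (rule sum.swap)
  also have "\<dots> = (of_nat (card ?X') :: complex)" using 2 by simp
  finally have "card ?X = card ?X'" using of_nat_eq_iff by blast
  moreover have "count (image_mset lab (mset_set K)) x = card ?X"
    using fin(1) by (simp add: count_image_mset vimage_def Int_def conj_commute)
  moreover have "count (image_mset lab' (mset_set K')) x = card ?X'"
    using fin(2) by (simp add: count_image_mset vimage_def Int_def conj_commute)
  ultimately show "count (image_mset lab (mset_set K)) x = count (image_mset lab' (mset_set K')) x"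
    by simp
qed

section \<open>Unitary reduction of a matrix\<close>

text \<open>
  A nonzero vector becomes a column of a unitary matrix up to a factor: the reflection
  \<open>1 - 2 w w\<^sup>* / (w\<^sup>* w)\<close> with \<open>w = x + \<beta> e\<^sub>q\<close> exchanges the lines of \<open>x\<close> and \<open>e\<^sub>q\<close>, provided that
  \<open>\<beta>\<close> has the norm of \<open>x\<close> and the phase of \<open>x\<^sub>q\<close>, which is arbitrary if \<open>x\<^sub>q = 0\<close>.
\<close>

lemma householder:
  assumes q: "q < n" and x: "i < n" "x i \<noteq> 0"
  shows "\<exists>U \<alpha>. unitary_mat n U \<and> (\<forall>a<n. U $$ (a, q) = \<alpha> * x a)"
proof -
  define s where "s = (\<Sum>k<n. (cmod (x k))\<^sup>2)"
  have s: "s > 0" unfolding s_def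
    by (rule sum_pos2[of _ i]) (use x in auto)
  define \<beta> where "\<beta> = (if x q = 0 then 1 else sgn (x q)) * complex_of_real (sqrt s)"
  have \<beta>x: "\<beta> * cnj (x q) = complex_of_real (sqrt s * cmod (x q))"
    by (simp add: \<beta>_def sgn_eq complex_norm_square[symmetric] power2_eq_square)
  have \<beta>\<beta>: "\<beta> * cnj \<beta> = complex_of_real s"
  proof -
    have "(cmod \<beta>)\<^sup>2 = s" using s by (simp add: \<beta>_def norm_mult norm_sgn)
    then show ?thesis by (metis complex_norm_square)
  qed
  define w where "w k = (if k = q then x q + \<beta> else x k)" for k
  define N where "N = complex_of_real (2 * s + 2 * (sqrt s * cmod (x q)))"
  have N0: "N \<noteq> 0"
  proof -
    have "2 * s + 2 * (sqrt s * cmod (x q)) > 0" using s by (intro add_pos_nonneg) auto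
    then show ?thesis unfolding N_def by (metis less_irrefl of_real_eq_0_iff)
  qed
  have x\<beta>: "x q * cnj \<beta> = complex_of_real (sqrt s * cmod (x q))"
    using arg_cong[OF \<beta>x, of cnj] by (simp add: mult.commute)
  have N: "(\<Sum>k<n. cnj (w k) * w k) = N"
  proof -
    have "(\<Sum>k<n. cnj (w k) * w k) = (\<Sum>k<n. cnj (x k) * x k + (if k = q then cnj (w q) * w q - cnj (x q) * x q else 0))"
      by (rule sum.cong) (auto simp: w_def)
    also have "\<dots> = (\<Sum>k<n. cnj (x k) * x k) + (cnj (w q) * w q - cnj (x q) * x q)"
      using q by (simp add: sum.distrib)
    also have "(\<Sum>k<n. cnj (x k) * x k) = complex_of_real s"
      unfolding s_def of_real_sum by (rule sum.cong) (simp_all only: complex_norm_square mult.commute)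
    also have "cnj (w q) * w q - cnj (x q) * x q = x q * cnj \<beta> + \<beta> * cnj (x q) + \<beta> * cnj \<beta>"
      by (simp add: w_def algebra_simps)
    finally show ?thesis unfolding \<beta>x x\<beta> \<beta>\<beta> by (simp add: N_def)
  qed
  have cnj_N: "cnj N = N" unfolding N_def by (rule complex_cnj_complex_of_real)
  define U where "U = mat n n (\<lambda>(k, j). (if k = j then 1 else 0) - 2 / N * w k * cnj (w j))"
  have "unitary_mat n U"
  proof (rule unitary_matI)
    fix i j assume ij: "i < n" "j < n"
    define A where "A k = 2 / N * cnj (w k) * w i" for k
    define B where "B k = 2 / N * w k * cnj (w j)" for k
    have "(\<Sum>k<n. cnj (U $$ (k, i)) * U $$ (k, j)) =
        (\<Sum>k<n. ((if k = i then 1 else 0) - A k) * ((if k = j then 1 else 0) - B k))"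
      using ij by (intro sum.cong) (auto simp: U_def A_def B_def cnj_N)
    also have "\<dots> = (\<Sum>k<n. (if k = i then (if i = j then 1 else 0) - B i else 0) - (if k = j then A j else 0) + A k * B k)"
      by (intro sum.cong) (auto simp: algebra_simps)
    also have "\<dots> = (if i = j then 1 else 0) - B i - A j + (\<Sum>k<n. A k * B k)"
      using ij by (simp add: sum.distrib sum_subtractf)
    also have "(\<Sum>k<n. A k * B k) = (\<Sum>k<n. cnj (w k) * w k) * (2 / N * (2 / N) * w i * cnj (w j))"
      unfolding sum_distrib_right by (intro sum.cong) (auto simp: A_def B_def)
    also have "\<dots> = 2 * (2 / N) * w i * cnj (w j)" unfolding N using N0 by (simp add: field_simps)
    also have "(if i = j then 1 else 0) - B i - A j + 2 * (2 / N) * w i * cnj (w j) = (if i = j then 1 else 0)"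
      by (simp add: A_def B_def algebra_simps)
    finally show "(\<Sum>k<n. cnj (U $$ (k, i)) * U $$ (k, j)) = (if i = j then 1 else 0)" .
  qed (simp add: U_def)
  moreover have "U $$ (a, q) = - 2 / N * cnj (w q) * x a" if a: "a < n" for a
  proof (cases "a = q")
    case True
    have "2 * (\<beta> * cnj (w q)) = N"
      by (simp add: w_def N_def \<beta>x \<beta>\<beta> distrib_left)
    then have "2 / N * \<beta> * cnj (w q) = 1" using N0 by (simp add: field_simps)
    then have "U $$ (q, q) = 2 / N * \<beta> * cnj (w q) - 2 / N * w q * cnj (w q)"
      using q by (simp add: U_def)
    also have "\<dots> = - 2 / N * cnj (w q) * x q"
    proof -
      have "c * \<beta> * r - c * (x q + \<beta>) * r = - (c * r * x q)" for c r
        by (simp add: algebra_simps)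
      from this[of "2 / N" "cnj (w q)"] show ?thesis by (simp add: w_def)
    qed
    finally show ?thesis using True by simp
  next
    case False
    then show ?thesis using a q by (simp add: U_def w_def)
  qed
  ultimately show ?thesis by blast
qed

text \<open>
  As long as the columns are dependent, a reflection turns a kernel vector into the first unit
  vector, which makes the first column zero; then continue with the other columns.
\<close>

lemma unitary_column_compression:
  fixes M :: "complex mat"
  assumes "M \<in> carrier_mat m n"
  shows "\<exists>V l. unitary_mat n V \<and> l \<le> n \<and> (\<forall>a<m. \<forall>c<n-l. (M * V) $$ (a, c) = 0) \<and>
    trivial_kernel l (mat m l (\<lambda>(a, c). (M * V) $$ (a, n - l + c)))"
  using assms
proof (induction n arbitrary: M)
  case 0
  have "trivial_kernel 0 (mat m 0 (\<lambda>(a, c). (M * 1\<^sub>m 0) $$ (a, 0 - 0 + c)))"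
    by (rule trivial_kernelI[of _ m]) auto
  then show ?case using unitary_one[of 0] by (intro exI[of _ "1\<^sub>m 0"] exI[of _ 0]) simp
next
  case (Suc n)
  note M = Suc.prems
  show ?case
  proof (cases "trivial_kernel (Suc n) M")
    case True
    have "mat m (Suc n) (\<lambda>(a, c). (M * 1\<^sub>m (Suc n)) $$ (a, Suc n - Suc n + c)) = M"
      using M by (intro eq_matI) auto
    then show ?thesis using True unitary_one[of "Suc n"]
      by (intro exI[of _ "1\<^sub>m (Suc n)"] exI[of _ "Suc n"]) simp
  next
    case False
    then obtain x i where x0: "\<And>a. a < m \<Longrightarrow> (\<Sum>j<Suc n. M $$ (a, j) * x j) = 0" and i: "i < Suc n" "x i \<noteq> 0"
      using trivial_kernelI[OF M] by blast
    obtain U \<alpha> where U: "unitary_mat (Suc n) U" and U0: "\<And>a. a < Suc n \<Longrightarrow> U $$ (a, 0) = \<alpha> * x a"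
      using householder[where q = 0 and n = "Suc n" and i = i and x = x] i by auto
    have cU: "U \<in> carrier_mat (Suc n) (Suc n)" using U by (rule unitary_carrier)
    have MU: "M * U \<in> carrier_mat m (Suc n)" using M cU by simp
    have MU0: "(M * U) $$ (a, 0) = 0" if a: "a < m" for a
    proof -
      have "(M * U) $$ (a, 0) = (\<Sum>j<Suc n. M $$ (a, j) * U $$ (j, 0))"
        by (rule mult_mat_entry[OF M cU a]) simp
      also have "\<dots> = (\<Sum>j<Suc n. M $$ (a, j) * x j) * \<alpha>"
        unfolding sum_distrib_right by (rule sum.cong) (auto simp: U0)
      finally show ?thesis using x0[OF a] by simp
    qed
    define M' where "M' = mat m n (\<lambda>(a, c). (M * U) $$ (a, Suc c))"
    have M': "M' \<in> carrier_mat m n" by (simp add: M'_def)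
    obtain V l where V: "unitary_mat n V" "l \<le> n" "\<forall>a<m. \<forall>c<n-l. (M' * V) $$ (a, c) = 0"
      "trivial_kernel l (mat m l (\<lambda>(a, c). (M' * V) $$ (a, n - l + c)))"
      using Suc.IH[OF M'] by blast
    have cV: "V \<in> carrier_mat n n" using V(1) by (rule unitary_carrier)
    define W where "W = four_block_mat (1\<^sub>m 1) (0\<^sub>m 1 n) (0\<^sub>m n 1) V"
    have W: "unitary_mat (Suc n) W"
      using unitary_four_block_diag[OF unitary_one[of 1] V(1)] by (simp add: W_def)
    have cW: "W \<in> carrier_mat (Suc n) (Suc n)" using W by (rule unitary_carrier)
    have assoc: "M * (U * W) = (M * U) * W" by (rule assoc_mult_mat[OF M cU cW, symmetric])
    have entry: "(M * (U * W)) $$ (a, c) = (\<Sum>k<n. M' $$ (a, k) * W $$ (Suc k, c))" if "a < m" "c < Suc n" for a c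
      unfolding assoc mult_mat_entry[OF MU cW that] sum.lessThan_Suc_shift
      using that by (simp add: MU0 M'_def del: index_mult_mat)
    have e0: "(M * (U * W)) $$ (a, 0) = 0" if "a < m" for a
      unfolding entry[OF that zero_less_Suc] using cV by (simp add: W_def)
    have eSuc: "(M * (U * W)) $$ (a, Suc c) = (M' * V) $$ (a, c)" if a: "a < m" and c: "c < n" for a c
    proof -
      have "W $$ (Suc k, Suc c) = V $$ (k, c)" if "k < n" for k
        using that c cV by (simp add: W_def)
      then show ?thesis
        using entry[OF a, of "Suc c"] mult_mat_entry[OF M' cV a c] c by (simp del: index_mult_mat)
    qed
    have "(M * (U * W)) $$ (a, c) = 0" if "a < m" "c < Suc n - l" for a c
      using that e0 eSuc V(2,3) by (cases c) (auto simp del: index_mult_mat)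
    moreover have "mat m l (\<lambda>(a, c). (M * (U * W)) $$ (a, Suc n - l + c)) =
        mat m l (\<lambda>(a, c). (M' * V) $$ (a, n - l + c))"
      using V(2) by (intro eq_matI) (auto simp: Suc_diff_le eSuc simp del: index_mult_mat)
    ultimately show ?thesis using unitary_mult[OF U W] V(2,4)
      by (intro exI[of _ "U * W"] exI[of _ l]) (simp del: index_mult_mat)
  qed
qed

text \<open>
  Column compression of the adjoint gives a zero block above a block \<open>H\<close> with independent rows. As
  \<open>C\<close> has trivial kernel, so has \<open>H\<close>, hence \<open>H\<close> is square. A permutation moves it to the top.
\<close>

lemma unitary_row_compression:
  fixes C :: "complex mat"
  assumes C: "C \<in> carrier_mat m l" and ker: "trivial_kernel l C"
  shows "\<exists>S H G. unitary_mat m S \<and> inverse_pair l H G \<and>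
    (\<forall>a<m. \<forall>c<l. (S * C) $$ (a, c) = (if a < l then H $$ (a, c) else 0))"
proof -
  have cC: "mat_adjoint C \<in> carrier_mat l m" using C by simp
  obtain W l' where W: "unitary_mat m W" "l' \<le> m" "\<forall>a<l. \<forall>c<m-l'. (mat_adjoint C * W) $$ (a, c) = 0"
    "trivial_kernel l' (mat l l' (\<lambda>(a, c). (mat_adjoint C * W) $$ (a, m - l' + c)))"
    using unitary_column_compression[OF cC] by blast
  have cW: "W \<in> carrier_mat m m" "mat_adjoint W \<in> carrier_mat m m"
    using unitary_carrier[OF W(1)] by simp_all
  have le1: "l' \<le> l" by (rule trivial_kernel_imp_dim_le[OF _ W(4)]) simp
  define Z where "Z = mat_adjoint W * C"
  have cZ: "Z \<in> carrier_mat m l" unfolding Z_def by (rule mult_carrier_mat[OF cW(2) C])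
  have adj: "mat_adjoint C * W = mat_adjoint Z"
    unfolding Z_def adjoint_mult[OF cW(2) C] adjoint_adjoint[OF cW(1)] ..
  have Z0: "Z $$ (a, c) = 0" if "a < m - l'" "c < l" for a c
    using W(3) that adjoint_entry[OF cZ that(2), of a] unfolding adj by auto
  define H where "H = mat l' l (\<lambda>(a, c). Z $$ (m - l' + a, c))"
  have cH: "H \<in> carrier_mat l' l" by (simp add: H_def)
  have kerZ: "trivial_kernel l Z"
    unfolding trivial_kernel_def
  proof (intro ballI impI)
    fix x :: "complex vec" assume x: "x \<in> carrier_vec l" and 0: "Z *\<^sub>v x = 0\<^sub>v (dim_row Z)"
    have Wid: "W * mat_adjoint W = 1\<^sub>m m" using W(1) by (simp add: unitary_mat_def)
    have "C *\<^sub>v x = (W * mat_adjoint W) *\<^sub>v (C *\<^sub>v x)" unfolding Wid using C x by simp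
    also have "\<dots> = W *\<^sub>v (mat_adjoint W *\<^sub>v (C *\<^sub>v x))"
      by (rule assoc_mult_mat_vec) (use cW C x in auto)
    also have "mat_adjoint W *\<^sub>v (C *\<^sub>v x) = Z *\<^sub>v x"
      unfolding Z_def by (rule assoc_mult_mat_vec[symmetric]) (use cW C x in auto)
    also have "W *\<^sub>v (Z *\<^sub>v x) = 0\<^sub>v m" unfolding 0 using cW cZ by auto
    finally show "x = 0\<^sub>v l" using ker x C unfolding trivial_kernel_def by auto
  qed
  have kerH: "trivial_kernel l H"
  proof (rule trivial_kernelI[OF cH])
    fix x j assume *: "\<And>i. i < l' \<Longrightarrow> (\<Sum>j<l. H $$ (i, j) * x j) = 0" and j: "j < l"
    have "(\<Sum>j<l. Z $$ (i, j) * x j) = 0" if i: "i < m" for i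
    proof (cases "i < m - l'")
      case True
      then show ?thesis using Z0 by simp
    next
      case False
      then have "i - (m - l') < l'" "m - l' + (i - (m - l')) = i" using i W(2) by auto
      then show ?thesis using *[of "i - (m - l')"] by (simp add: H_def)
    qed
    then show "x j = 0" by (rule trivial_kernelD[OF kerZ cZ _ j])
  qed
  have "l \<le> l'" by (rule trivial_kernel_imp_dim_le[OF cH kerH])
  with le1 have l: "l' = l" by simp
  obtain G where G: "inverse_pair l H G"
    using trivial_kernel_imp_inverse_pair[of H l] cH kerH l by blast
  have lm: "l \<le> m" using W(2) l by simp
  \<comment> \<open>The cyclic permutation that moves the last \<open>l\<close> rows to the top.\<close>
  define p where "p j = (if j < l then m - l + j else j - l)" for j
  have "bij_betw p {..<m} {..<m}"
    by (rule bij_betw_byWitness[where f' = "\<lambda>j. if j < m - l then j + l else j - (m - l)"])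
      (use lm in \<open>auto simp: p_def\<close>)
  note U = unitary_permute_columns[OF W(1) this]
  define U where "U = mat m m (\<lambda>(i, j). W $$ (i, p j))"
  have cU: "U \<in> carrier_mat m m" "mat_adjoint U \<in> carrier_mat m m" by (simp_all add: U_def)
  have p: "p j < m" if "j < m" for j using that lm by (auto simp: p_def)
  have "(mat_adjoint U * C) $$ (a, c) = (if a < l then H $$ (a, c) else 0)" if a: "a < m" and c: "c < l" for a c
  proof -
    have "(mat_adjoint U * C) $$ (a, c) = (\<Sum>k<m. mat_adjoint U $$ (a, k) * C $$ (k, c))"
      by (rule mult_mat_entry[OF cU(2) C a c])
    also have "\<dots> = (\<Sum>k<m. mat_adjoint W $$ (p a, k) * C $$ (k, c))"
      using a by (intro sum.cong refl) (simp add: adjoint_entry[OF cU(1)] adjoint_entry[OF cW(1)] p, simp add: U_def)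
    also have "\<dots> = Z $$ (p a, c)"
      unfolding Z_def by (rule mult_mat_entry[OF cW(2) C p[OF a] c, symmetric])
    also have "\<dots> = (if a < l then H $$ (a, c) else 0)"
      using a c l lm Z0[of "p a" c] by (auto simp: p_def H_def)
    finally show ?thesis .
  qed
  then show ?thesis using unitary_adjoint[OF U[folded U_def]] G by blast
qed

lemma unitary_rank_decomposition:
  fixes M :: "complex mat"
  assumes M: "M \<in> carrier_mat m n"
  shows "\<exists>S V l H G. unitary_mat m S \<and> unitary_mat n V \<and> l \<le> m \<and> l \<le> n \<and> inverse_pair l H G \<and>
    (\<forall>a<m. \<forall>c<n. (S * M * V) $$ (a, c) = (if a < l \<and> n - l \<le> c then H $$ (a, c - (n - l)) else 0))"
proof -
  obtain V l where V: "unitary_mat n V" "l \<le> n" "\<forall>a<m. \<forall>c<n-l. (M * V) $$ (a, c) = 0"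
    "trivial_kernel l (mat m l (\<lambda>(a, c). (M * V) $$ (a, n - l + c)))"
    using unitary_column_compression[OF M] by blast
  define C where "C = mat m l (\<lambda>(a, c). (M * V) $$ (a, n - l + c))"
  have C: "C \<in> carrier_mat m l" by (simp add: C_def)
  obtain S H G where S: "unitary_mat m S" "inverse_pair l H G"
    "\<forall>a<m. \<forall>c<l. (S * C) $$ (a, c) = (if a < l then H $$ (a, c) else 0)"
    using unitary_row_compression[OF C V(4)[folded C_def]] by blast
  have cS: "S \<in> carrier_mat m m" and cV: "V \<in> carrier_mat n n" and MV: "M * V \<in> carrier_mat m n"
    using S V M unitary_carrier by auto
  have "(S * M * V) $$ (a, c) = (if a < l \<and> n - l \<le> c then H $$ (a, c - (n - l)) else 0)"
    if a: "a < m" and c: "c < n" for a c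
  proof -
    have "(S * M * V) $$ (a, c) = (\<Sum>k<m. S $$ (a, k) * (M * V) $$ (k, c))"
      unfolding assoc_mult_mat[OF cS M cV] by (rule mult_mat_entry[OF cS MV a c])
    also have "\<dots> = (if n - l \<le> c then (S * C) $$ (a, c - (n - l)) else 0)"
    proof (cases "n - l \<le> c")
      case True
      then have "c - (n - l) < l" using c V(2) by auto
      then show ?thesis using True mult_mat_entry[OF cS C a, of "c - (n - l)"]
        by (simp add: C_def del: index_mult_mat)
    next
      case False
      then show ?thesis using V(3) by (simp del: index_mult_mat)
    qed
    also have "\<dots> = (if a < l \<and> n - l \<le> c then H $$ (a, c - (n - l)) else 0)"
      using S(3) a c V(2) by (auto simp del: index_mult_mat)
    finally show ?thesis .
  qed
  moreover have "l \<le> m" using trivial_kernel_imp_dim_le[OF _ V(4)] by simp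
  ultimately show ?thesis using S V by blast
qed

lemma reduced_right_Cons:
  assumes red: "reduced_right (d' - l) ks ls B'" and l: "l \<le> k" "l \<le> d'" and HG: "inverse_pair l H G"
    and diag: "\<And>a b. a < l \<Longrightarrow> b < k \<Longrightarrow> B $$ (a, b) = (if b < k - l then 0 else H $$ (a, b - (k - l)))"
    and below: "\<And>a b. l \<le> a \<Longrightarrow> a < d' \<Longrightarrow> b < k \<Longrightarrow> B $$ (a, b) = 0"
    and rest: "\<And>a b. a < d' - l \<Longrightarrow> b < sum_list ks \<Longrightarrow> B $$ (l + a, k + b) = B' $$ (a, b)"
  shows "reduced_right d' (k # ks) (l # ls) B"
  unfolding reduced_right_iff
proof (intro conjI allI impI)
  note r = red[unfolded reduced_right_iff]
  show "length (l # ls) = length (k # ks)" "sum_list (l # ls) \<le> d'" using r l by auto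
  fix i assume i: "i < length (k # ks)"
  show "(l # ls) ! i \<le> (k # ks) ! i" using r l i by (cases i) auto
  show "\<exists>H G. inverse_pair ((l # ls) ! i) H G \<and>
     (\<forall>a<(l # ls) ! i. \<forall>b<(k # ks) ! i. B $$ (off (l # ls) i + a, off (k # ks) i + b) =
        (if b < (k # ks) ! i - (l # ls) ! i then 0 else H $$ (a, b - ((k # ks) ! i - (l # ls) ! i))))"
  proof (cases i)
    case 0
    then show ?thesis using HG diag by auto
  next
    case (Suc j)
    then have j: "j < length ks" using i by simp
    obtain H' G' where H': "inverse_pair (ls ! j) H' G'" "\<forall>a < ls ! j. \<forall>b < ks ! j. B' $$ (off ls j + a, off ks j + b) =
              (if b < ks ! j - ls ! j then 0 else H' $$ (a, b - (ks ! j - ls ! j)))"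
      using r j by blast
    have "B $$ (l + (off ls j + a), k + (off ks j + b)) = B' $$ (off ls j + a, off ks j + b)"
      if "a < ls ! j" "b < ks ! j" for a b
      using rest[of "off ls j + a" "off ks j + b"] off_add_less_sum[of j ls a] off_add_less_sum[of j ks b] that j r
      by auto
    then show ?thesis using H' Suc by (intro exI[of _ H'] exI[of _ G']) (simp add: add.assoc)
  qed
  fix a b assume a: "a < d'" "off (l # ls) (Suc i) \<le> a" and b: "b < (k # ks) ! i"
  show "B $$ (a, off (k # ks) i + b) = 0"
  proof (cases i)
    case 0
    then show ?thesis using below a b by simp
  next
    case (Suc j)
    then have j: "j < length ks" "b < ks ! j" using i b by auto
    have a': "a - l < d' - l" "off ls (Suc j) \<le> a - l" "l + (a - l) = a" using a Suc l by auto
    have "B $$ (l + (a - l), k + (off ks j + b)) = B' $$ (a - l, off ks j + b)"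
      using rest[OF a'(1)] off_add_less_sum[OF j] by blast
    also have "\<dots> = 0" using r j a' by blast
    finally show ?thesis using Suc a'(3) by (simp add: add.assoc)
  qed
qed

lemma reduced_left_snoc:
  assumes red: "reduced_left (d' - l) ks ls B'" and l: "l \<le> k" "l \<le> d'" and HG: "inverse_pair l H G"
    and last: "\<And>a b. a < k \<Longrightarrow> b < d' \<Longrightarrow>
      B $$ (sum_list ks + a, b) = (if a < l \<and> d' - l \<le> b then H $$ (a, b - (d' - l)) else 0)"
    and rest: "\<And>a b. a < sum_list ks \<Longrightarrow> b < d' - l \<Longrightarrow> B $$ (a, b) = B' $$ (a, b)"
  shows "reduced_left d' (ks @ [k]) (ls @ [l]) B"
  unfolding reduced_left_iff
proof (intro conjI allI impI)
  note r = red[unfolded reduced_left_iff]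
  have len: "length ls = length ks" using r by blast
  have sum: "l + sum_list ls \<le> d'" using r l by auto
  have q: "d' - sum_list (ls @ [l]) = d' - l - sum_list ls" by simp
  show "length (ls @ [l]) = length (ks @ [k])" "sum_list (ls @ [l]) \<le> d'" using r l by auto
  fix i assume i: "i < length (ks @ [k])"
  show "(ls @ [l]) ! i \<le> (ks @ [k]) ! i" using r l i by (auto simp: nth_append less_Suc_eq)
  show "\<exists>H G. inverse_pair ((ls @ [l]) ! i) H G \<and>
     (\<forall>a<(ks @ [k]) ! i. \<forall>b<(ls @ [l]) ! i. B $$ (off (ks @ [k]) i + a, d' - sum_list (ls @ [l]) + off (ls @ [l]) i + b) =
        (if a < (ls @ [l]) ! i then H $$ (a, b) else 0))"
  proof (cases "i = length ks")
    case True
    have n: "(ks @ [k]) ! i = k" "(ls @ [l]) ! i = l" "off (ks @ [k]) i = sum_list ks" "off (ls @ [l]) i = sum_list ls"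
      unfolding True using len by (simp_all add: nth_append) (simp_all flip: len)
    have col: "d' - sum_list (ls @ [l]) + sum_list ls = d' - l" using sum by simp
    show ?thesis unfolding n col using HG last l by (intro exI[of _ H] exI[of _ G]) auto
  next
    case False
    then have j: "i < length ks" using i by simp
    have n: "(ks @ [k]) ! i = ks ! i" "(ls @ [l]) ! i = ls ! i" "off (ks @ [k]) i = off ks i" "off (ls @ [l]) i = off ls i"
      using len j by (simp_all add: nth_append)
    obtain H' G' where H': "inverse_pair (ls ! i) H' G'" "\<And>a b. a < ks ! i \<Longrightarrow> b < ls ! i \<Longrightarrow>
        B' $$ (off ks i + a, d' - l - sum_list ls + off ls i + b) = (if a < ls ! i then H' $$ (a, b) else 0)"
      using r j by blast
    have "B $$ (off ks i + a, d' - l - sum_list ls + off ls i + b) = (if a < ls ! i then H' $$ (a, b) else 0)"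
      if "a < ks ! i" "b < ls ! i" for a b
    proof -
      have "off ls i + b < sum_list ls" using off_add_less_sum[of i ls b] that j len by simp
      then have "d' - l - sum_list ls + off ls i + b < d' - l" using sum by linarith
      then show ?thesis using rest[OF off_add_less_sum[OF j that(1)]] H'(2)[OF that] by simp
    qed
    then show ?thesis unfolding n q using H'(1) by (intro exI[of _ H'] exI[of _ G']) blast
  qed
  fix a b assume a: "a < (ks @ [k]) ! i" and b: "b < d' - sum_list (ls @ [l]) + off (ls @ [l]) i"
  show "B $$ (off (ks @ [k]) i + a, b) = 0"
  proof (cases "i = length ks")
    case True
    have n: "(ks @ [k]) ! i = k" "off (ks @ [k]) i = sum_list ks" "off (ls @ [l]) i = sum_list ls"
      unfolding True using len by (simp_all add: nth_append) (simp_all flip: len)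
    have "b < d' - l" using b sum unfolding n by simp
    then show ?thesis unfolding n using last[of a b] a l unfolding n by simp
  next
    case False
    then have j: "i < length ks" using i by simp
    have n: "(ks @ [k]) ! i = ks ! i" "off (ks @ [k]) i = off ks i" "off (ls @ [l]) i = off ls i"
      using len j by (simp_all add: nth_append)
    have a': "a < ks ! i" and b': "b < d' - l - sum_list ls + off ls i" using a b unfolding n q by auto
    have "b < d' - l" using b' off_le_sum[of ls i] sum by linarith
    then show ?thesis unfolding n
      using rest[OF off_add_less_sum[OF j a']] r j a' b' by auto
  qed
qed

text \<open>
  Decompose the first vertical strip. The row transformation also acts on the other strips, and the
  rows below the block \<open>H\<close> are treated recursively; this leaves the zeros in the first strip intact.
\<close>

lemma unitary_reduction_right:
  assumes "M \<in> carrier_mat d' (sum_list ks)"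
  shows "\<exists>S Vs ls. unitary_mat d' S \<and> list_all2 unitary_mat ks Vs \<and>
    reduced_right d' ks ls (S * M * diag_block_mat Vs)"
  using assms
proof (induction ks arbitrary: d' M)
  case Nil
  show ?case by (intro exI[of _ "1\<^sub>m d'"] exI[of _ "[]"]) (simp add: unitary_one reduced_right_iff)
next
  case (Cons k ks)
  let ?s = "sum_list ks"
  have M: "M \<in> carrier_mat d' (k + ?s)" using Cons.prems by simp
  define M1 where "M1 = mat d' k (\<lambda>(a, c). M $$ (a, c))"
  have M1: "M1 \<in> carrier_mat d' k" by (simp add: M1_def)
  obtain S1 V l H G where S1: "unitary_mat d' S1" and V: "unitary_mat k V" and l: "l \<le> d'" "l \<le> k"
    and HG: "inverse_pair l H G"
    and SMV: "\<And>a c. a < d' \<Longrightarrow> c < k \<Longrightarrow>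
      (S1 * M1 * V) $$ (a, c) = (if a < l \<and> k - l \<le> c then H $$ (a, c - (k - l)) else 0)"
    using unitary_rank_decomposition[OF M1] by blast
  have cS1: "S1 \<in> carrier_mat d' d'" and cV: "V \<in> carrier_mat k k"
    using S1 V unitary_carrier by auto
  define Z where "Z = S1 * M"
  have cZ: "Z \<in> carrier_mat d' (k + ?s)" unfolding Z_def by (rule mult_carrier_mat[OF cS1 M])
  have SM1: "S1 * M1 \<in> carrier_mat d' k" by (rule mult_carrier_mat[OF cS1 M1])
  have Z1: "(S1 * M1) $$ (a, c) = Z $$ (a, c)" if "a < d'" "c < k" for a c
    unfolding Z_def mult_mat_entry[OF cS1 M1 that] using that
    by (subst mult_mat_entry[OF cS1 M]) (auto simp: M1_def)
  let ?d = "d' - l"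
  define Y where "Y = mat ?d ?s (\<lambda>(a, c). Z $$ (l + a, k + c))"
  have cY: "Y \<in> carrier_mat ?d ?s" by (simp add: Y_def)
  obtain S2 Vs ls where S2: "unitary_mat ?d S2" and Vs: "list_all2 unitary_mat ks Vs"
    and red: "reduced_right ?d ks ls (S2 * Y * diag_block_mat Vs)"
    using Cons.IH[OF cY] by blast
  let ?D = "diag_block_mat Vs"
  have cS2: "S2 \<in> carrier_mat ?d ?d" and cD: "?D \<in> carrier_mat ?s ?s"
    using S2 diag_block_unitary[OF Vs] unitary_carrier by auto
  define Z11 where "Z11 = mat l k (\<lambda>(a, c). Z $$ (a, c))"
  define Z12 where "Z12 = mat l ?s (\<lambda>(a, c). Z $$ (a, k + c))"
  define Z21 where "Z21 = mat ?d k (\<lambda>(a, c). Z $$ (l + a, c))"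
  have c: "Z11 \<in> carrier_mat l k" "Z12 \<in> carrier_mat l ?s" "Z21 \<in> carrier_mat ?d k"
    by (simp_all add: Z11_def Z12_def Z21_def)
  have Z: "Z = four_block_mat Z11 Z12 Z21 Y"
    by (rule eq_matI) (use cZ l in \<open>auto simp: Z11_def Z12_def Z21_def Y_def\<close>)
  define T where "T = four_block_mat (1\<^sub>m l) (0\<^sub>m l ?d) (0\<^sub>m ?d l) S2"
  have T: "unitary_mat d' T"
    using unitary_four_block_diag[OF unitary_one[of l] S2] l by (simp add: T_def)
  have cT: "T \<in> carrier_mat d' d'" using T by (rule unitary_carrier)
  have DV: "diag_block_mat (V # Vs) = four_block_mat V (0\<^sub>m k ?s) (0\<^sub>m ?s k) ?D"
    using cV cD by (auto simp: Let_def)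
  have TZ: "T * Z = four_block_mat Z11 Z12 (S2 * Z21) (S2 * Y)"
    unfolding T_def Z
    by (subst mult_four_block_mat[of _ l l _ ?d _ ?d _ _ k _ ?s]) (use c cY cS2 in auto)
  have B: "T * Z * diag_block_mat (V # Vs) =
      four_block_mat (Z11 * V) (Z12 * ?D) (S2 * Z21 * V) (S2 * Y * ?D)"
    unfolding TZ DV
    by (subst mult_four_block_mat[of _ l k _ ?s _ ?d _ _ k _ ?s]) (use c cY cS2 cV cD in auto)
  have SMV': "(S1 * M1 * V) $$ (a, c) = (\<Sum>e<k. Z $$ (a, e) * V $$ (e, c))" if "a < d'" "c < k" for a c
    unfolding mult_mat_entry[OF SM1 cV that] using that Z1 by (intro sum.cong) auto
  have Z11V: "(Z11 * V) $$ (a, b) = (if b < k - l then 0 else H $$ (a, b - (k - l)))" if "a < l" "b < k" for a b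
    using SMV[of a b] SMV'[of a b] that l
    by (subst mult_mat_entry[OF c(1) cV that]) (auto simp: Z11_def)
  have Z21V: "Z21 * V = 0\<^sub>m ?d k"
  proof (rule eq_matI)
    fix a b assume "a < dim_row (0\<^sub>m ?d k)" "b < dim_col (0\<^sub>m ?d k)"
    then have ab: "a < ?d" "b < k" by auto
    show "(Z21 * V) $$ (a, b) = 0\<^sub>m ?d k $$ (a, b)"
      unfolding mult_mat_entry[OF c(3) cV ab] using SMV[of "l + a" b] SMV'[of "l + a" b] ab
      by (simp add: Z21_def)
  qed (use c cV in auto)
  have S2Z: "S2 * Z21 * V = 0\<^sub>m ?d k"
    unfolding assoc_mult_mat[OF cS2 c(3) cV] Z21V using cS2 by simp
  have dims: "Z11 * V \<in> carrier_mat l k" "Z12 * ?D \<in> carrier_mat l ?s" "S2 * Y * ?D \<in> carrier_mat ?d ?s"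
    using c cV cD cS2 cY by auto
  have "reduced_right d' (k # ks) (l # ls) (T * Z * diag_block_mat (V # Vs))"
  proof (rule reduced_right_Cons[OF red l(2,1) HG])
    fix a b assume "a < l" "b < k"
    then show "(T * Z * diag_block_mat (V # Vs)) $$ (a, b) = (if b < k - l then 0 else H $$ (a, b - (k - l)))"
      unfolding B using dims Z11V by (simp del: index_mult_mat add: carrier_matD)
  next
    fix a b assume "l \<le> a" "a < d'" "b < k"
    then show "(T * Z * diag_block_mat (V # Vs)) $$ (a, b) = 0"
      unfolding B S2Z using dims by (simp del: index_mult_mat add: carrier_matD)
  next
    fix a b assume "a < ?d" "b < ?s"
    then show "(T * Z * diag_block_mat (V # Vs)) $$ (l + a, k + b) = (S2 * Y * ?D) $$ (a, b)"
      unfolding B S2Z using dims by (simp del: index_mult_mat add: carrier_matD)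
  qed
  moreover have "T * Z = T * S1 * M" unfolding Z_def by (rule assoc_mult_mat[OF cT cS1 M, symmetric])
  ultimately show ?case using unitary_mult[OF T S1] V Vs
    by (intro exI[of _ "T * S1"] exI[of _ "V # Vs"] exI[of _ "l # ls"]) simp
qed

text \<open>
  Decompose the lowest horizontal strip, whose block \<open>H\<close> occupies the last columns, and treat the
  other strips recursively in the remaining columns.
\<close>

lemma unitary_reduction_left:
  assumes "M \<in> carrier_mat (sum_list ks) d'"
  shows "\<exists>S Vs ls. unitary_mat d' S \<and> list_all2 unitary_mat ks Vs \<and>
    reduced_left d' ks ls (diag_block_mat Vs * (M * S))"
  using assms
proof (induction ks arbitrary: d' M rule: rev_induct)
  case Nil
  show ?case by (intro exI[of _ "1\<^sub>m d'"] exI[of _ "[]"]) (simp add: unitary_one reduced_left_iff)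
next
  case (snoc k ks)
  let ?s = "sum_list ks"
  have M: "M \<in> carrier_mat (?s + k) d'" using snoc.prems by simp
  define M2 where "M2 = mat k d' (\<lambda>(a, c). M $$ (?s + a, c))"
  have M2: "M2 \<in> carrier_mat k d'" by (simp add: M2_def)
  obtain V S1 l H G where V: "unitary_mat k V" and S1: "unitary_mat d' S1" and l: "l \<le> k" "l \<le> d'"
    and HG: "inverse_pair l H G"
    and VMS: "\<And>a c. a < k \<Longrightarrow> c < d' \<Longrightarrow>
      (V * M2 * S1) $$ (a, c) = (if a < l \<and> d' - l \<le> c then H $$ (a, c - (d' - l)) else 0)"
    using unitary_rank_decomposition[OF M2] by blast
  have cS1: "S1 \<in> carrier_mat d' d'" and cV: "V \<in> carrier_mat k k"
    using S1 V unitary_carrier by auto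
  define Z where "Z = M * S1"
  have cZ: "Z \<in> carrier_mat (?s + k) d'" unfolding Z_def by (rule mult_carrier_mat[OF M cS1])
  have MS2: "M2 * S1 \<in> carrier_mat k d'" by (rule mult_carrier_mat[OF M2 cS1])
  have Z2: "(M2 * S1) $$ (a, c) = Z $$ (?s + a, c)" if "a < k" "c < d'" for a c
    unfolding Z_def mult_mat_entry[OF M2 cS1 that] using that
    by (subst mult_mat_entry[OF M cS1]) (auto simp: M2_def)
  let ?d = "d' - l"
  define Y where "Y = mat ?s ?d (\<lambda>(a, c). Z $$ (a, c))"
  have cY: "Y \<in> carrier_mat ?s ?d" by (simp add: Y_def)
  obtain S2 Vs ls where S2: "unitary_mat ?d S2" and Vs: "list_all2 unitary_mat ks Vs"
    and red: "reduced_left ?d ks ls (diag_block_mat Vs * (Y * S2))"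
    using snoc.IH[OF cY] by blast
  let ?D = "diag_block_mat Vs"
  have cS2: "S2 \<in> carrier_mat ?d ?d" and cD: "?D \<in> carrier_mat ?s ?s"
    using S2 diag_block_unitary[OF Vs] unitary_carrier by auto
  define Z12 where "Z12 = mat ?s l (\<lambda>(a, c). Z $$ (a, ?d + c))"
  define Z21 where "Z21 = mat k ?d (\<lambda>(a, c). Z $$ (?s + a, c))"
  define Z22 where "Z22 = mat k l (\<lambda>(a, c). Z $$ (?s + a, ?d + c))"
  have c: "Z12 \<in> carrier_mat ?s l" "Z21 \<in> carrier_mat k ?d" "Z22 \<in> carrier_mat k l"
    by (simp_all add: Z12_def Z21_def Z22_def)
  have Z: "Z = four_block_mat Y Z12 Z21 Z22"
    by (rule eq_matI) (use cZ l in \<open>auto simp: Z12_def Z21_def Z22_def Y_def\<close>)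
  define T where "T = four_block_mat S2 (0\<^sub>m ?d l) (0\<^sub>m l ?d) (1\<^sub>m l)"
  have T: "unitary_mat d' T"
    using unitary_four_block_diag[OF S2 unitary_one[of l]] l by (simp add: T_def)
  have cT: "T \<in> carrier_mat d' d'" using T by (rule unitary_carrier)
  have DV: "diag_block_mat (Vs @ [V]) = four_block_mat ?D (0\<^sub>m ?s k) (0\<^sub>m k ?s) V"
    using cV cD by (auto simp: diag_block_mat_last Let_def)
  have ZT: "Z * T = four_block_mat (Y * S2) Z12 (Z21 * S2) Z22"
    unfolding T_def Z
    by (subst mult_four_block_mat[of _ ?s ?d _ l _ k _ _ ?d _ l]) (use c cY cS2 in auto)
  have B: "diag_block_mat (Vs @ [V]) * (Z * T) =
      four_block_mat (?D * (Y * S2)) (?D * Z12) (V * (Z21 * S2)) (V * Z22)"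
    unfolding ZT DV
    by (subst mult_four_block_mat[of _ ?s ?s _ k _ k _ _ ?d _ l]) (use c cY cS2 cV cD in auto)
  have VMS': "(V * M2 * S1) $$ (a, c) = (\<Sum>e<k. V $$ (a, e) * Z $$ (?s + e, c))" if "a < k" "c < d'" for a c
    unfolding assoc_mult_mat[OF cV M2 cS1] mult_mat_entry[OF cV MS2 that] using that Z2
    by (intro sum.cong) auto
  have VZ22: "(V * Z22) $$ (a, b) = (if a < l then H $$ (a, b) else 0)" if "a < k" "b < l" for a b
  proof -
    have "?d + b < d'" using that(2) l by simp
    from VMS[OF that(1) this, unfolded VMS'[OF that(1) this]] show ?thesis
      unfolding mult_mat_entry[OF cV c(3) that] using that by (simp add: Z22_def)
  qed
  have VZ21: "V * Z21 = 0\<^sub>m k ?d"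
  proof (rule eq_matI)
    fix a b assume "a < dim_row (0\<^sub>m k ?d)" "b < dim_col (0\<^sub>m k ?d)"
    then have ab: "a < k" "b < ?d" by auto
    show "(V * Z21) $$ (a, b) = 0\<^sub>m k ?d $$ (a, b)"
      unfolding mult_mat_entry[OF cV c(2) ab] using VMS[of a b] VMS'[of a b] ab
      by (simp add: Z21_def)
  qed (use c cV in auto)
  have VZS: "V * (Z21 * S2) = 0\<^sub>m k ?d"
    unfolding assoc_mult_mat[OF cV c(2) cS2, symmetric] VZ21 using cS2 by simp
  have dims: "?D * (Y * S2) \<in> carrier_mat ?s ?d" "?D * Z12 \<in> carrier_mat ?s l" "V * Z22 \<in> carrier_mat k l"
    using c cV cD cS2 cY by auto
  have "reduced_left d' (ks @ [k]) (ls @ [l]) (diag_block_mat (Vs @ [V]) * (Z * T))"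
  proof (rule reduced_left_snoc[OF red l HG])
    fix a b assume a: "a < k" and b: "b < d'"
    then have "b - ?d < l \<or> b < ?d" by auto
    then show "(diag_block_mat (Vs @ [V]) * (Z * T)) $$ (?s + a, b) =
        (if a < l \<and> ?d \<le> b then H $$ (a, b - ?d) else 0)"
      unfolding B VZS using dims VZ22[OF a, of "b - ?d"] a b l
      by (auto simp del: index_mult_mat simp: carrier_matD)
  next
    fix a b assume "a < ?s" "b < ?d"
    then show "(diag_block_mat (Vs @ [V]) * (Z * T)) $$ (a, b) = (?D * (Y * S2)) $$ (a, b)"
      unfolding B using dims by (simp del: index_mult_mat add: carrier_matD)
  qed
  moreover have "Z * T = M * (S1 * T)" unfolding Z_def by (rule assoc_mult_mat[OF M cS1 cT])
  moreover have "list_all2 unitary_mat (ks @ [k]) (Vs @ [V])"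
    using V Vs by (simp add: list_all2_appendI)
  ultimately show ?case using unitary_mult[OF S1 T] by metis
qed

section \<open>Existence of runs and the canonical form\<close>

lemma chain_run_exists:
  assumes A: "mat_rep (chain t right) A" and r: "r < t"
  shows "\<exists>P L R. chain_run t right A r P L R"
  using r
proof (induction r)
  case 0
  show ?case using chain_run.start by blast
next
  case (Suc r)
  then obtain P L R where run: "chain_run t right A r P L R" by auto
  let ?n = "Suc r" and ?d' = "vdim A (Suc r + 1)"
  from chain_run_invariant[OF A run] Suc.prems have R: "mat_rep (chain t right) R" "vdim R = vdim A"
    and sum: "sum_list (map snd L) = vdim A ?n"
    by (auto simp: extends_flags_def)
  have M: "amat R ?n \<in> carrier_mat (vdim A (tgt right ?n)) (vdim A (src right ?n))"
    using R Suc.prems by (auto simp: mat_rep_def)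
  show ?case
  proof (cases "right ?n")
    case True
    then have "amat R ?n \<in> carrier_mat ?d' (sum_list (map snd L))" using M sum by simp
    from unitary_reduction_right[OF this] obtain S Vs ls where S: "unitary_mat ?d' S"
      and Vs: "list_all2 unitary_mat (map snd L) Vs"
      and red: "reduced_right ?d' (map snd L) ls (S * amat R ?n * diag_block_mat Vs)" by blast
    have "amat (vertex_transform (chain t right) (?n + 1) S R) ?n = S * amat R ?n"
      using True by (simp add: vertex_transform_def)
    then show ?thesis
      using chain_run.step_right[of t right A ?n P L R ?d' "map snd L" S _ Vs ls]
        run Suc.prems True S Vs red by (metis diff_Suc_1 le_add1 plus_1_eq_Suc)
  next
    case False
    then have cM: "amat R ?n \<in> carrier_mat (sum_list (map snd L)) ?d'" using M sum by simp
    from unitary_reduction_left[OF this] obtain S Vs ls where S: "unitary_mat ?d' S"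
      and Vs: "list_all2 unitary_mat (map snd L) Vs"
      and red: "reduced_left ?d' (map snd L) ls (diag_block_mat Vs * (amat R ?n * S))" by blast
    \<comment> \<open>The transformation at a vertex multiplies outgoing arrows by the inverse.\<close>
    have "the (mat_inverse (mat_adjoint S)) = S"
      using the_mat_inverse[OF inverse_pair_sym] S unfolding unitary_mat_iff_inverse_pair by blast
    then have "amat (vertex_transform (chain t right) (?n + 1) (mat_adjoint S) R) ?n = amat R ?n * S"
      using False by (simp add: vertex_transform_def)
    then show ?thesis
      using chain_run.step_left[of t right A ?n P L R ?d' "map snd L" "mat_adjoint S" _ Vs ls]
        run Suc.prems False unitary_adjoint[OF S] Vs red by (metis diff_Suc_1 le_add1 plus_1_eq_Suc)
  qed
qed

theorem proposition4p1:
  fixes t :: nat and right :: "nat \<Rightarrow> bool" and A :: "(nat, nat) quiver_rep"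
  assumes "1 \<le> t" and "mat_rep (chain t right) A"
  shows "(\<exists>M. chain_result t right A M) \<and>
    (\<forall>M. chain_result t right A M \<longrightarrow>
       set_mset M \<subseteq> interval_index t \<and>
       (\<forall>xs. mset xs = M \<longrightarrow> rep_iso (chain t right) A (interval_sum t right xs)) \<and>
       (\<forall>ys. set ys \<subseteq> interval_index t \<and> rep_iso (chain t right) A (interval_sum t right ys)
              \<longrightarrow> mset ys = M))"
proof (intro conjI allI impI)
  note A = assms(2)
  have r: "t - 1 < t" "Suc (t - 1) = t" using assms(1) by auto
  show "\<exists>M. chain_result t right A M"
    using chain_run_exists[OF A r(1)] unfolding chain_result_def by blast
  fix M assume "chain_result t right A M"
  then obtain P L R where run: "chain_run t right A (t - 1) P L R"
    and M: "M = P + (\<Sum>i<length L. replicate_mset (snd (L ! i)) (fst (L ! i), t))"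
    unfolding chain_result_def by blast
  from chain_run_invariant[OF A run r(1)] have R: "mat_rep (chain t right) R"
    and AR: "rep_iso (chain t right) A R" and ext: "extends_flags t right R L P"
    using r(2) by auto
  obtain K :: "(nat \<times> nat) set" and lab b f where basis: "interval_basis t right R K lab b f"
    and K: "image_mset lab (mset_set K) = M"
    using extends_flags_interval_basis[OF ext] M by blast
  have fin: "finite K" "lab ` K \<subseteq> interval_index t" using basis by (auto simp: interval_basis_def)
  show "set_mset M \<subseteq> interval_index t" unfolding K[symmetric] using fin by simp
  {
    fix xs assume "mset xs = M"
    then obtain zs where zs: "distinct zs" "set zs = K" "map lab zs = xs"
      using enumerate_labels[OF fin(1)] K by metis
    have bij: "bij_betw ((!) zs) {..<length xs} K"
      using zs by (auto intro!: bij_betw_nth)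
    have "interval_basis t right R {..<length xs} ((!) xs) (\<lambda>v i. b v (zs ! i)) (\<lambda>v i. f v (zs ! i))"
      by (rule interval_basis_reindex[OF bij basis]) (use zs in auto)
    then have "rep_iso (chain t right) (interval_sum t right xs) R"
      by (rule rep_iso_if_interval_basis[OF R])
    then have "rep_iso (chain t right) R (interval_sum t right xs)"
      by (rule rep_iso_sym[OF wf_chain mat_rep_interval_sum R])
    then show "rep_iso (chain t right) A (interval_sum t right xs)"
      by (rule rep_iso_trans[OF wf_chain A R mat_rep_interval_sum AR])
  next
    fix ys assume ys: "set ys \<subseteq> interval_index t \<and> rep_iso (chain t right) A (interval_sum t right ys)"
    have "rep_iso (chain t right) (interval_sum t right ys) A"
      by (rule rep_iso_sym[OF wf_chain A mat_rep_interval_sum]) (use ys in blast)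
    then have "rep_iso (chain t right) (interval_sum t right ys) R"
      by (rule rep_iso_trans[OF wf_chain mat_rep_interval_sum A R _ AR])
    then obtain b' f' where "interval_basis t right R {..<length ys} ((!) ys) b' f'"
      using interval_basis_if_rep_iso[OF R] ys by blast
    from interval_basis_unique[OF this basis]
    have "image_mset ((!) ys) (mset_set {..<length ys}) = M" unfolding K .
    moreover have "mset (map ((!) ys) [0..<length ys]) = image_mset ((!) ys) (mset_set {..<length ys})"
      by (simp only: mset_map mset_upt atLeast0LessThan)
    ultimately show "mset ys = M" by (simp add: map_nth)
  }
qed

end
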